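(* Let $\lambda\in\mathbb R$ be a constant, and let $\Omega(t)$, $\Gamma(t)$, $D_r(t)$, $t\ge 0$, be continuous and bounded, where $\Omega(t)$ is an antisymmetric real $3\times 3$ matrix, $\Gamma(t)$ is a symmetric real $3\times3$ matrix with $\operatorname{tr}\Gamma(t)=0$, and $D_r(t)\ge 0$ is a scalar. Let $B_0$ be a symmetric positive definite $3\times3$ matrix with $\det B_0=1$ and put $A_0=A(B_0)$. Consider the Fast Exact Closure system with isotropic diffusion $$\frac{dA}{dt}=\tfrac12\,\mathbb C(B):\big[B\cdot(\Omega+\lambda\Gamma)+(-\Omega+\lambda\Gamma)\cdot B\big]+D_r\,(2I-6A),$$ $$\frac{dB}{dt}=-\tfrac12\big(B\cdot(\Omega+\lambda\Gamma)+(-\Omega+\lambda\Gamma)\cdot B\big)-D_r\,\mathbb D(B):(2I-6A),$$ with $A(0)=A_0$, $B(0)=B_0$. Then this system has a solution defined for all $t\ge0$ which stays physical: for every $t\ge 0$, $B(t)$ is symmetric positive definite and finite (none of its eigenvalues becomes $0$ or infinite in finite time), $\det B(t)=1$, and $A(t)=A(B(t))$ is positive definite with $\operatorname{tr}A(t)=1$.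
   Context: All matrices are real $3\times3$. For a symmetric positive definite matrix $B$ define $$A(B)=\tfrac12\int_0^\infty \frac{(B+sI)^{-1}\,ds}{\sqrt{\det(B+sI)}},\qquad \mathbb C(B)=\tfrac34\int_0^\infty\frac{\mathcal S\big((B+sI)^{-1}\otimes(B+sI)^{-1}\big)\,ds}{\sqrt{\det(B+sI)}},$$ where for a rank-4 tensor $\mathbb T$, $\mathcal S(\mathbb T)_{ijkl}$ is the average of $\mathbb T_{mnpq}$ over all permutations $(m,n,p,q)$ of $(i,j,k,l)$. For a rank-4 tensor $\mathbb T$ and a matrix $M$, $(\mathbb T:M)_{ij}=\sum_{k,l}\mathbb T_{ijkl}M_{kl}$. The linear map $M\mapsto \mathbb C(B):M$ on symmetric matrices is invertible; $\mathbb D(B)$ denotes the rank-4 tensor with $\mathbb D_{ijkl}=\mathbb D_{jikl}=\mathbb D_{ijlk}$ representing its inverse, i.e. $\mathbb C(B):\mathbb D(B):M=\mathbb D(B):\mathbb C(B):M=M$ for every symmetric $M$. Here $t$ plays the role of time along a material (Lagrangian) trajectory, so $D/Dt$ becomes $d/dt$. *)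

theory Defs
  imports "HOL-Analysis.Analysis" "HOL-Combinatorics.Permutations"
begin

type_synonym mat3 = "real^3^3"
type_synonym tensor4 = "3 \<Rightarrow> 3 \<Rightarrow> 3 \<Rightarrow> 3 \<Rightarrow> real"

definition symmetric_mat :: "mat3 \<Rightarrow> bool" where
  "symmetric_mat M \<longleftrightarrow> transpose M = M"

definition antisymmetric_mat :: "mat3 \<Rightarrow> bool" where
  "antisymmetric_mat M \<longleftrightarrow> transpose M = - M"

definition spd :: "mat3 \<Rightarrow> bool" where
  "spd M \<longleftrightarrow> symmetric_mat M \<and> (\<forall>x::real^3. x \<noteq> 0 \<longrightarrow> x \<bullet> (M *v x) > 0)"

definition pos_def :: "mat3 \<Rightarrow> bool" where
  "pos_def M \<longleftrightarrow> (\<forall>x::real^3. x \<noteq> 0 \<longrightarrow> x \<bullet> (M *v x) > 0)"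

definition Amap :: "mat3 \<Rightarrow> mat3" where
  "Amap B = (1/2) *\<^sub>R integral {0..}
     (\<lambda>s::real. (1 / sqrt (det (B + s *\<^sub>R mat 1))) *\<^sub>R matrix_inv (B + s *\<^sub>R mat 1))"

definition outer :: "mat3 \<Rightarrow> mat3 \<Rightarrow> tensor4" where
  "outer P Q = (\<lambda>i j k l. P$i$j * Q$k$l)"

definition sym4 :: "tensor4 \<Rightarrow> tensor4" where
  "sym4 T = (\<lambda>i j k l. (1/24) * (\<Sum>p\<in>{p. p permutes {0::nat..<4}}.
       (let idx = (\<lambda>n. [i,j,k,l] ! n) in T (idx (p 0)) (idx (p 1)) (idx (p 2)) (idx (p 3)))))"

definition Ctens :: "mat3 \<Rightarrow> tensor4" where
  "Ctens B = (\<lambda>i j k l. (3/4) * integral {0..}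
     (\<lambda>s::real. sym4 (outer (matrix_inv (B + s *\<^sub>R mat 1)) (matrix_inv (B + s *\<^sub>R mat 1))) i j k l
                / sqrt (det (B + s *\<^sub>R mat 1))))"

definition contract :: "tensor4 \<Rightarrow> mat3 \<Rightarrow> mat3" where
  "contract T M = (\<chi> i j. \<Sum>k\<in>UNIV. \<Sum>l\<in>UNIV. T i j k l * M$k$l)"

definition Dtens :: "mat3 \<Rightarrow> tensor4" where
  "Dtens B = (THE D. (\<forall>i j k l. D i j k l = D j i k l \<and> D i j k l = D i j l k) \<and>
     (\<forall>M. symmetric_mat M \<longrightarrow>
        contract (Ctens B) (contract D M) = M \<and> contract D (contract (Ctens B) M) = M))"

end

theory Submission
  imports Defs "HOL-Complex_Analysis.Great_Picard"
begin

text \<open>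
  Put \<open>X = (B + s I)\<^sup>-\<^sup>1\<close>. On symmetric matrices the tensor \<open>\<bbbC>(B)\<close> acts as the self-adjoint, positive operator
  \<open>M \<mapsto> 1/4 \<integral> ((X \<bullet> M) X + 2 X M X) / sqrt (det (B + s I)) ds\<close>, which is minus the derivative of \<open>B \<mapsto> A(B)\<close>.
  Hence the equation for \<open>A\<close> is the chain rule applied to \<open>A(B(t))\<close>, and only the equation for \<open>B\<close> has to be solved.

  Integrating a total derivative in \<open>s\<close> gives \<open>tr A(B) = (det B)\<^sup>-\<^sup>1\<^sup>/\<^sup>2\<close>; along the flow \<open>u = tr A\<close> satisfies
  \<open>u' = 6 D\<^sub>r (1 - u)\<close>, so \<open>det B = 1\<close> is preserved. With \<open>W = \<Omega> + \<lambda> \<Gamma>\<close> the transport term acts on \<open>A\<close> as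
  \<open>1/2 (W A + A W\<^sup>T)\<close> up to an error bounded by a multiple of \<open>A\<close>; as \<open>tr W = 0\<close>, this gives
  \<open>(det A)' \<ge> - K det A\<close>, so \<open>det A\<close> stays away from \<open>0\<close> on bounded time intervals. Since
  \<open>tr A = 1\<close> and \<open>tr (A B) \<le> 6\<close>, a lower bound on \<open>det A\<close> bounds \<open>tr B\<close>, and \<open>det B = 1\<close> then keeps
  the eigenvalues of \<open>B\<close> away from \<open>0\<close>. Peano's theorem for a bounded extension of the vector field and a
  first exit argument yield a solution on each unit interval, and these are concatenated.
\<close>

section \<open>Ordinary differential equations and improper integrals\<close>

text \<open>The relaxation term, which contains \<open>Dtens B\<close>, has no evident bound near
  the boundary of the positive definite cone, so positivity is not estimated on the \<open>B\<close>
  equation. Applying the closure operator cancels \<open>Dtens B\<close> and leaves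
  \<open>Dr (2 I - 6 A)\<close>, which is at least \<open>- 6 Dr A\<close>; hence
  \<open>det A\<close> is tracked, and the bound is transferred to \<open>B\<close> afterwards. The
  price is that the image of the transport term is not a function of \<open>A\<close> alone. Writing
  \<open>B = (B + s I) - s I\<close> under the integral isolates an exact congruence; the remainder
  carries a factor \<open>s\<close>, which the decay of the resolvent absorbs with a constant
  independent of the lower bound on \<open>B\<close>. Therefore the decay rate of
  \<open>det A\<close> depends only on the bounds of the coefficients, and steps of length 1 can be
  repeated forever although the region confining \<open>B\<close> changes from step to step. Only
  continuity of the vector field is established, on compact pieces of the cone; hence Peano's
  theorem, preceded by an extension of the field to all matrices.\<close>

lemma has_vector_derivative_nonneg_imp_mono:
  fixes f :: "real \<Rightarrow> real"
  assumes "\<And>t. t \<in> {a..b} \<Longrightarrow> (f has_vector_derivative f' t) (at t within {a..b})"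
    and "\<And>t. t \<in> {a..b} \<Longrightarrow> f' t \<ge> 0" and "t \<in> {a..b}"
  shows "f a \<le> f t"
proof (cases "a = t")
  case False
  then have "a < t" using assms(3) by auto
  have "\<exists>x. f t - f a = (t - a) * x \<and> x \<ge> 0"
  proof -
    have d: "(f has_derivative (\<lambda>h. h * f' x)) (at x within {a..t})" if "a \<le> x" "x \<le> t" for x
    proof -
      have "x \<in> {a..b}" using that assms(3) by auto
      from assms(1)[OF this] have "(f has_vector_derivative f' x) (at x within {a..t})"
        by (rule has_vector_derivative_within_subset) (use assms(3) in auto)
      then show ?thesis by (simp add: has_vector_derivative_def)
    qed
    obtain x where "x \<in> {a<..<t}" "f t - f a = (t - a) * f' x"
      using mvt_simple[OF \<open>a < t\<close> d] by auto
    then show ?thesis using assms(2)[of x] assms(3) by auto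
  qed
  then show ?thesis using \<open>a < t\<close> by (metis diff_ge_0_iff_ge less_imp_le mult_nonneg_nonneg)
qed simp

lemma exponential_lower_bound:
  fixes f :: "real \<Rightarrow> real"
  assumes d: "\<And>t. t \<in> {a..b} \<Longrightarrow> (f has_vector_derivative f' t) (at t within {a..b})"
    and ge: "\<And>t. t \<in> {a..b} \<Longrightarrow> f' t \<ge> - K * f t" and t: "t \<in> {a..b}"
  shows "f t \<ge> exp (- K * (t - a)) * f a"
proof -
  have d': "((\<lambda>t. exp (K * (t - a)) * f t) has_vector_derivative
      exp (K * (t - a)) * (f' t + K * f t)) (at t within {a..b})" if "t \<in> {a..b}" for t
  proof -
    have "(f has_field_derivative f' t) (at t within {a..b})"
      using d[OF that] by (simp add: has_real_derivative_iff_has_vector_derivative)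
    then have "((\<lambda>t. exp (K * (t - a)) * f t) has_field_derivative
      exp (K * (t - a)) * (f' t + K * f t)) (at t within {a..b})"
      by (auto intro!: derivative_eq_intros simp: algebra_simps)
    then show ?thesis by (simp add: has_real_derivative_iff_has_vector_derivative)
  qed
  have "exp (K * (a - a)) * f a \<le> exp (K * (t - a)) * f t"
  proof (rule has_vector_derivative_nonneg_imp_mono[OF d' _ t])
    show "0 \<le> exp (K * (u - a)) * (f' u + K * f u)" if "u \<in> {a..b}" for u
      using ge[OF that] by (intro mult_nonneg_nonneg) auto
  qed
  then have "exp (- (K * (t - a))) * f a \<le> exp (- (K * (t - a))) * (exp (K * (t - a)) * f t)"
    by (intro mult_left_mono) auto
  also have "\<dots> = f t" by (simp add: mult.assoc[symmetric] exp_add[symmetric])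
  finally show ?thesis by simp
qed

text \<open>The square of \<open>f\<close> cannot grow, its derivative being
  \<open>- 2 * k t * (f t)^2\<close>. Working with the square avoids an antiderivative of
  \<open>k\<close>.\<close>

lemma linear_decay_from_zero:
  fixes f :: "real \<Rightarrow> real"
  assumes d: "\<And>t. t \<in> {a..b} \<Longrightarrow> (f has_vector_derivative (- k t * f t)) (at t within {a..b})"
    and k: "\<And>t. t \<in> {a..b} \<Longrightarrow> k t \<ge> 0" and "f a = 0" and t: "t \<in> {a..b}"
  shows "f t = 0"
proof -
  have d': "((\<lambda>t. - (f t)\<^sup>2) has_vector_derivative 2 * k t * (f t)\<^sup>2) (at t within {a..b})"
    if "t \<in> {a..b}" for t
  proof -
    have "(f has_field_derivative - k t * f t) (at t within {a..b})"
      using d[OF that] by (simp add: has_real_derivative_iff_has_vector_derivative)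
    then have "((\<lambda>t. - (f t)\<^sup>2) has_field_derivative 2 * k t * (f t)\<^sup>2) (at t within {a..b})"
      by (auto intro!: derivative_eq_intros simp: algebra_simps power2_eq_square)
    then show ?thesis by (simp add: has_real_derivative_iff_has_vector_derivative)
  qed
  have "- (f a)\<^sup>2 \<le> - (f t)\<^sup>2"
    by (rule has_vector_derivative_nonneg_imp_mono[OF d' _ t]) (use k in auto)
  then show ?thesis using assms(3) by simp
qed

section \<open>Integrals over the half-line and their dependence on a parameter\<close>

lemma has_integral_FTC_to_inf:
  fixes F :: "real \<Rightarrow> 'a::euclidean_space"
  assumes F: "\<And>s. s \<ge> 0 \<Longrightarrow> (F has_vector_derivative f s) (at s within {0..})"
    and b: "\<And>s. s \<ge> 0 \<Longrightarrow> norm (f s) \<le> h s" and h: "h integrable_on {0..}"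
    and l: "(F \<longlongrightarrow> l) at_top"
  shows "(f has_integral (l - F 0)) {0..}"
proof -
  define g where "g n s = (if s \<in> {0..real n} then f s else 0)" for n s
  have 1: "(g n has_integral (F (real n) - F 0)) {0..}" for n
  proof -
    have "(f has_integral (F (real n) - F 0)) {0..real n}"
      by (rule fundamental_theorem_of_calculus)
         (auto intro!: has_vector_derivative_within_subset[OF F])
    then show ?thesis
      unfolding g_def by (subst has_integral_restrict) auto
  qed
  have conv: "(\<lambda>n. g n s) \<longlonglongrightarrow> f s" if "s \<in> {0..}" for s
  proof (rule tendsto_eventually)
    obtain N where "s \<le> real N" using real_arch_simple by blast
    then show "\<forall>\<^sub>F n in sequentially. g n s = f s"
      using that by (auto simp: eventually_sequentially g_def intro!: exI[of _ N])
  qed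
  have le: "norm (g n s) \<le> h s" if "s \<in> {0..}" for n s
    using b[of s] that order_trans[OF norm_ge_zero, of "f s" "h s"] by (auto simp: g_def)
  have gi: "g n integrable_on {0..}" for n
    using 1 by blast
  note dc = dominated_convergence[OF gi h le conv]
  have "(\<lambda>n. integral {0..} (g n)) \<longlonglongrightarrow> l - F 0"
    unfolding integral_unique[OF 1]
    by (intro tendsto_intros filterlim_compose[OF l filterlim_real_sequentially])
  with dc have "integral {0..} f = l - F 0"
    using LIMSEQ_unique by blast
  with dc(1) show ?thesis by (metis integrable_integral)
qed

text \<open>The source of the majorants: if \<open>coercive \<delta> B\<close>, then
  \<open>B + s I\<close> is bounded below by \<open>\<delta> + s\<close>, so each kernel decays like
  a power of \<open>\<delta> + s\<close>.\<close>

lemma has_integral_shifted_powr_to_inf: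
  fixes d e :: real
  assumes "d > 0" "e < -1"
  shows "((\<lambda>s. (d + s) powr e) has_integral (d powr (e + 1) / (- e - 1))) {0..}"
proof (rule has_integral_to_inf)
  have D: "((\<lambda>s. (d + s) powr (e + 1) / (e + 1)) has_vector_derivative (d + s) powr e) (at s within S)"
    if "s \<ge> 0" for s S
    unfolding has_real_derivative_iff_has_vector_derivative[symmetric]
    using that assms by (auto intro!: derivative_eq_intros)
  have I: "((\<lambda>s. (d + s) powr e) has_integral ((d + y) powr (e + 1) / (e + 1) - (d + 0) powr (e + 1) / (e + 1))) {0..y}"
    if "y \<ge> 0" for y
    by (rule fundamental_theorem_of_calculus) (use that D in auto)
  show "(\<lambda>s. (d + s) powr e) integrable_on {0..y}" for y
    using I[of y] by (cases "y \<ge> 0") (auto simp: integrable_on_empty)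
  have "((\<lambda>y. (d + y) powr (e + 1) / (e + 1) - (d + 0) powr (e + 1) / (e + 1)) \<longlongrightarrow>
      0 / (e + 1) - (d + 0) powr (e + 1) / (e + 1)) at_top"
    using assms
    by (intro tendsto_intros tendsto_neg_powr filterlim_tendsto_add_at_top[OF tendsto_const] filterlim_ident) auto
  moreover have "\<forall>\<^sub>F y in at_top. (d + y) powr (e + 1) / (e + 1) - (d + 0) powr (e + 1) / (e + 1)
      = integral {0..y} (\<lambda>s. (d + s) powr e)"
    using eventually_ge_at_top[of 0] by eventually_elim (rule integral_unique[OF I, symmetric])
  ultimately have "((\<lambda>y. integral {0..y} (\<lambda>s. (d + s) powr e)) \<longlongrightarrow>
      0 / (e + 1) - (d + 0) powr (e + 1) / (e + 1)) at_top"
    by (rule Lim_transform_eventually)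
  also have "0 / (e + 1) - (d + 0) powr (e + 1) / (e + 1) = d powr (e + 1) / (- e - 1)"
    using assms by (simp add: field_simps)
  finally show "((\<lambda>y. integral {0..y} (\<lambda>s. (d + s) powr e)) \<longlongrightarrow> d powr (e + 1) / (- e - 1)) at_top" .
qed auto

lemma continuous_dominated_integrable:
  fixes f :: "real \<Rightarrow> 'a::euclidean_space"
  assumes "continuous_on {0..} f" "h integrable_on {0..}" "\<And>s. s \<ge> 0 \<Longrightarrow> norm (f s) \<le> h s"
  shows "f integrable_on {0..}"
  by (rule measurable_bounded_by_integrable_imp_integrable[OF _ assms(2)])
     (use assms in \<open>auto intro: continuous_imp_measurable_on_sets_lebesgue\<close>)

text \<open>The quotient form lets a derivative be tested along sequences, where dominated
  convergence applies, and reduces the derivative of the matrix inverse to the resolvent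
  identity.\<close>

lemma has_vector_derivative_iff_quotient:
  "(f has_vector_derivative D) (at t within S) \<longleftrightarrow>
   ((\<lambda>u. (f u - f t) /\<^sub>R (u - t)) \<longlongrightarrow> D) (at t within S)"
proof -
  have "((\<lambda>u. (1 / norm (u - t)) *\<^sub>R (f u - (f t + (u - t) *\<^sub>R D))) \<longlongrightarrow> 0) (at t within S) \<longleftrightarrow>
        ((\<lambda>u. norm ((1 / norm (u - t)) *\<^sub>R (f u - (f t + (u - t) *\<^sub>R D)))) \<longlongrightarrow> 0) (at t within S)"
    by (simp only: tendsto_norm_zero_iff)
  also have "\<dots> \<longleftrightarrow> ((\<lambda>u. norm ((f u - f t) /\<^sub>R (u - t) - D)) \<longlongrightarrow> 0) (at t within S)"
  proof (rule tendsto_cong)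
    have "norm ((1 / norm (u - t)) *\<^sub>R (f u - (f t + (u - t) *\<^sub>R D))) = norm ((f u - f t) /\<^sub>R (u - t) - D)"
      if "u \<noteq> t" for u
    proof -
      have "(f u - f t) /\<^sub>R (u - t) - D = (1 / (u - t)) *\<^sub>R (f u - (f t + (u - t) *\<^sub>R D))"
        using that by (simp add: scaleR_diff_right scaleR_add_right divide_inverse)
      then show ?thesis by simp
    qed
    then show "\<forall>\<^sub>F u in at t within S. norm ((1 / norm (u - t)) *\<^sub>R (f u - (f t + (u - t) *\<^sub>R D)))
        = norm ((f u - f t) /\<^sub>R (u - t) - D)"
      by (auto simp: eventually_at_filter)
  qed
  also have "\<dots> \<longleftrightarrow> ((\<lambda>u. (f u - f t) /\<^sub>R (u - t) - D) \<longlongrightarrow> 0) (at t within S)"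
    by (simp only: tendsto_norm_zero_iff)
  also have "\<dots> \<longleftrightarrow> ((\<lambda>u. (f u - f t) /\<^sub>R (u - t)) \<longlongrightarrow> D) (at t within S)"
    by (rule Lim_null[symmetric])
  finally show ?thesis
    by (simp add: has_vector_derivative_def has_derivative_within bounded_linear_scaleR_left)
qed

text \<open>The mean value inequality bounds all difference quotients in \<open>t\<close> by
  \<open>h s\<close>, so dominated convergence takes their limit under the integral.\<close>

lemma leibniz_dominated:
  fixes f :: "real \<Rightarrow> real \<Rightarrow> 'a::euclidean_space"
  assumes d: "\<And>s t. s \<in> S \<Longrightarrow> t \<in> {a..b} \<Longrightarrow> ((\<lambda>t. f t s) has_vector_derivative f' t s) (at t within {a..b})"
    and bd: "\<And>s t. s \<in> S \<Longrightarrow> t \<in> {a..b} \<Longrightarrow> norm (f' t s) \<le> h s"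
    and h: "h integrable_on S" and fi: "\<And>t. t \<in> {a..b} \<Longrightarrow> f t integrable_on S"
    and t: "t \<in> {a..b}"
  shows "((\<lambda>t. integral S (f t)) has_vector_derivative integral S (f' t)) (at t within {a..b})"
proof -
  have "((\<lambda>u. (integral S (f u) - integral S (f t)) /\<^sub>R (u - t)) \<longlongrightarrow> integral S (f' t)) (at t within {a..b})"
    unfolding tendsto_at_iff_sequentially comp_def
  proof (intro allI impI)
    fix X :: "nat \<Rightarrow> real"
    assume X: "\<forall>i. X i \<in> {a..b} - {t}" and lim: "X \<longlonglongrightarrow> t"
    let ?q = "\<lambda>i s. (f (X i) s - f t s) /\<^sub>R (X i - t)"
    have "(\<lambda>i. integral S (?q i)) \<longlonglongrightarrow> integral S (f' t)"
    proof (rule dominated_convergence(2)[OF _ h])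
      show "?q i integrable_on S" for i
        using X t by (intro integrable_cmul integrable_diff fi) auto
      show "norm (?q i s) \<le> h s" if s: "s \<in> S" for i s
      proof -
        have Xi: "X i \<in> {a..b}" "X i \<noteq> t" using X by auto
        have "norm (f (X i) s - f t s) \<le> h s * norm (X i - t)"
        proof (rule differentiable_bound[of "{a..b}" "\<lambda>t. f t s" "\<lambda>t x. x *\<^sub>R f' t s"])
          show "((\<lambda>t. f t s) has_derivative (\<lambda>x. x *\<^sub>R f' u s)) (at u within {a..b})" if "u \<in> {a..b}" for u
            using d[OF s that] by (simp add: has_vector_derivative_def)
          show "onorm (\<lambda>x. x *\<^sub>R f' u s) \<le> h s" if "u \<in> {a..b}" for u
            using bd[OF s that] by (intro onorm_le) (auto simp: mult.commute intro: mult_left_mono)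
        qed (use Xi t in auto)
        then have "norm (f (X i) s - f t s) / \<bar>X i - t\<bar> \<le> h s"
          using Xi by (simp add: divide_le_eq)
        then show ?thesis by (simp add: divide_inverse mult.commute)
      qed
      show "(\<lambda>i. ?q i s) \<longlonglongrightarrow> f' t s" if s: "s \<in> S" for s
      proof -
        have "((\<lambda>u. (f u s - f t s) /\<^sub>R (u - t)) \<longlongrightarrow> f' t s) (at t within {a..b})"
          using d[OF s t] by (simp add: has_vector_derivative_iff_quotient)
        then show ?thesis using X lim unfolding tendsto_at_iff_sequentially comp_def by blast
      qed
    qed
    moreover have "integral S (?q i) = (integral S (f (X i)) - integral S (f t)) /\<^sub>R (X i - t)" for i
      using X t by (simp add: fi integral_diff)
    ultimately show "(\<lambda>i. (integral S (f (X i)) - integral S (f t)) /\<^sub>R (X i - t)) \<longlonglongrightarrow> integral S (f' t)"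
      by (simp only:)
  qed
  then show ?thesis
    by (simp add: has_vector_derivative_iff_quotient)
qed


section \<open>Peano's theorem and continuation in time\<close>

theorem peano_existence:
  fixes f :: "real \<Rightarrow> 'a::euclidean_space \<Rightarrow> 'a"
  assumes ab: "a \<le> b"
    and cf: "continuous_on ({a..b} \<times> UNIV) (\<lambda>p. f (fst p) (snd p))"
    and bd: "\<And>t x. t \<in> {a..b} \<Longrightarrow> norm (f t x) \<le> M"
  shows "\<exists>x. x a = x0 \<and> (\<forall>t\<in>{a..b}. (x has_vector_derivative f t (x t)) (at t within {a..b}))"
proof -
  \<comment> \<open>Tonelli's approximations: the integral equation with the argument delayed by \<open>h\<close> is solved exactly by
    iterating \<open>T h\<close> finitely often, since each iteration extends the fixed part by \<open>h\<close>.\<close>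
  have M0: "M \<ge> 0" using bd[of a undefined] ab order_trans[OF norm_ge_zero] by auto
  \<comment> \<open>Clamping the delayed time at \<open>a\<close> freezes the argument at
    \<open>y a\<close> on the first window of length \<open>h\<close>.\<close>
  define T where "T h y t = x0 + integral {a..t} (\<lambda>s. f s (y (max a (s - h))))"
    for h :: real and y :: "real \<Rightarrow> 'a" and t
  have comp: "continuous_on {a..b} (\<lambda>s. f s (y s))" if "continuous_on {a..b} y" for y
  proof -
    have "continuous_on {a..b} (\<lambda>s. f (fst (s, y s)) (snd (s, y s)))"
      by (rule continuous_on_compose2[OF cf]) (auto intro!: continuous_on_Pair that)
    then show ?thesis by simp
  qed
  have delay: "continuous_on {a..b} (\<lambda>s. f s (y (max a (s - h))))"
    if "continuous_on {a..b} y" "h \<ge> 0" for y h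
    by (rule comp, rule continuous_on_compose2[OF that(1)])
       (use that(2) ab in \<open>auto intro!: continuous_intros\<close>)
  have Tlip: "norm (T h y t - T h y u) \<le> M * \<bar>t - u\<bar>"
    if y: "continuous_on {a..b} y" "h \<ge> 0" and tu: "t \<in> {a..b}" "u \<in> {a..b}" for y h t u
  proof -
    have *: "norm (T h y t - T h y u) \<le> M * (t - u)" if "u \<le> t" "t \<in> {a..b}" "u \<in> {a..b}" for t u
    proof -
      let ?g = "\<lambda>s. f s (y (max a (s - h)))"
      have ig: "?g integrable_on {a..t}"
        by (rule integrable_continuous_real, rule continuous_on_subset[OF delay[OF y]]) (use that in auto)
      have "integral {a..u} ?g + integral {u..t} ?g = integral {a..t} ?g"
        by (rule Henstock_Kurzweil_Integration.integral_combine[OF _ _ ig]) (use that in auto)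
      then have "T h y t - T h y u = integral {u..t} ?g"
        by (simp add: T_def algebra_simps)
      moreover have "norm (integral {u..t} ?g) \<le> M * (t - u)"
        by (rule integral_bound)
           (use that bd in \<open>auto intro!: continuous_on_subset[OF delay[OF y]]\<close>)
      ultimately show ?thesis by simp
    qed
    show ?thesis
      using *[of u t] *[of t u] tu by (cases "u \<le> t") (auto simp: norm_minus_commute)
  qed
  have Tcont: "continuous_on {a..b} (T h y)" if "continuous_on {a..b} y" "h \<ge> 0" for y h
    by (rule lipschitz_on_continuous_on[of M], rule lipschitz_onI)
       (use Tlip[OF that] M0 in \<open>auto simp: dist_norm\<close>)
  define Y where "Y h k = ((T h) ^^ k) (\<lambda>_. x0)" for h k
  have Y_Suc: "Y h (Suc k) = T h (Y h k)" for h k by (simp add: Y_def)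
  have Ycont: "continuous_on {a..b} (Y h k)" if "h \<ge> 0" for h k
  proof (induction k)
    case 0
    show ?case by (simp add: Y_def)
  qed (simp add: Y_Suc Tcont that)
  \<comment> \<open>At time \<open>s\<close> the integrand reads the iterate only at
    \<open>s - h\<close>, so agreement up to \<open>a + k * h\<close> passes to agreement up to
    \<open>a + (k + 1) * h\<close>.\<close>
  have Yfix: "Y h (Suc k) t = Y h k t" if "h \<ge> 0" "t \<in> {a..b}" "t \<le> a + real k * h" for h k t
    using that(2,3)
  proof (induction k arbitrary: t)
    case 0
    then have "t = a" by auto
    then show ?case by (simp add: Y_def T_def)
  next
    case (Suc k)
    have "integral {a..t} (\<lambda>s. f s (Y h (Suc k) (max a (s - h)))) = integral {a..t} (\<lambda>s. f s (Y h k (max a (s - h))))"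
    proof (rule integral_cong)
      fix s assume "s \<in> {a..t}"
      then have "max a (s - h) \<in> {a..b}" "max a (s - h) \<le> a + real k * h"
        using Suc.prems that(1) by (auto simp: algebra_simps max_def)
      then show "f s (Y h (Suc k) (max a (s - h))) = f s (Y h k (max a (s - h)))"
        using Suc.IH by simp
    qed
    then show ?case
      by (subst (1) Y_Suc, subst (2) Y_Suc) (simp add: T_def)
  qed
  \<comment> \<open>\<open>Suc n\<close> windows of this length reach exactly \<open>b\<close>, so
    \<open>Suc n\<close> iterations solve the delayed equation on the whole interval.\<close>
  define h where "h n = (b - a) / real (Suc n)" for n
  define z where "z n = Y (h n) (Suc n)" for n
  have h0: "h n \<ge> 0" for n using ab by (simp add: h_def)
  have hlim: "h \<longlonglongrightarrow> 0"
    unfolding h_def by (rule LIMSEQ_Suc, rule lim_const_over_n)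
  have zcont: "continuous_on {a..b} (z n)" for n
    unfolding z_def by (rule Ycont[OF h0])
  have zfix: "z n t = T (h n) (z n) t" if "t \<in> {a..b}" for n t
    using Yfix[OF h0 that, of "Suc n" n] that unfolding z_def Y_Suc[symmetric] by (simp add: h_def)
  have zlip: "norm (z n t - z n u) \<le> M * \<bar>t - u\<bar>" if "t \<in> {a..b}" "u \<in> {a..b}" for n t u
    using Tlip[OF zcont h0 that] zfix that by simp
  have za: "z n a = x0" for n
    using zfix[of a n] ab by (simp add: T_def)
  have znorm: "norm (z n t) \<le> norm x0 + M * (b - a)" if "t \<in> {a..b}" for n t
  proof -
    have "norm (z n t) \<le> norm (z n a) + norm (z n t - z n a)"
      by (metis add.commute diff_add_cancel norm_triangle_ineq)
    also have "norm (z n t - z n a) \<le> M * \<bar>t - a\<bar>" using zlip[of t a] that by auto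
    also have "\<dots> \<le> M * (b - a)" using that M0 by (intro mult_left_mono) auto
    finally show ?thesis by (simp add: za)
  qed
  obtain x k where xc: "continuous_on {a..b} x" and k: "strict_mono (k :: nat \<Rightarrow> nat)"
    and lim: "\<And>e. 0 < e \<Longrightarrow> \<exists>N. \<forall>n t. n \<ge> N \<and> t \<in> {a..b} \<longrightarrow> norm (z (k n) t - x t) < e"
  proof (rule Arzela_Ascoli[of "{a..b}" z "norm x0 + M * (b - a)"])
    show "\<exists>d. 0 < d \<and> (\<forall>n u. u \<in> {a..b} \<and> norm (t - u) < d \<longrightarrow> norm (z n t - z n u) < e)"
      if "t \<in> {a..b}" "0 < e" for t e
    \<comment> \<open>\<open>M\<close> may be 0, hence the denominator \<open>M + 1\<close>.\<close>
    proof (intro exI[of _ "e / (M + 1)"] conjI allI impI)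
      fix n u assume u: "u \<in> {a..b} \<and> norm (t - u) < e / (M + 1)"
      have "norm (z n t - z n u) \<le> M * \<bar>t - u\<bar>" using zlip that u by auto
      also have "\<dots> \<le> (M + 1) * \<bar>t - u\<bar>" by (intro mult_right_mono) auto
      also have "\<dots> < e" using u M0 by (simp add: field_simps)
      finally show "norm (z n t - z n u) < e" .
    qed (use M0 that in auto)
  qed (use znorm in auto)
  have zx: "(\<lambda>n. z (k n) t) \<longlonglongrightarrow> x t" if "t \<in> {a..b}" for t
    unfolding LIMSEQ_iff using lim that by blast
  have hk: "(\<lambda>n. h (k n)) \<longlonglongrightarrow> 0"
    using LIMSEQ_subseq_LIMSEQ[OF hlim k] by (simp add: comp_def)
  \<comment> \<open>The Lipschitz constant \<open>M\<close> is common to all approximations, so the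
    vanishing delay does not change the limit.\<close>
  have zdx: "(\<lambda>n. z (k n) (max a (s - h (k n)))) \<longlonglongrightarrow> x s" if s: "s \<in> {a..b}" for s
  proof -
    have "(\<lambda>n. z (k n) (max a (s - h (k n))) - z (k n) s) \<longlonglongrightarrow> 0"
    proof (rule Lim_null_comparison)
      show "\<forall>\<^sub>F n in sequentially. norm (z (k n) (max a (s - h (k n))) - z (k n) s) \<le> M * h (k n)"
      proof (rule always_eventually, rule allI)
        fix n
        have "norm (z (k n) (max a (s - h (k n))) - z (k n) s) \<le> M * \<bar>max a (s - h (k n)) - s\<bar>"
          using zlip[of "max a (s - h (k n))" s] s h0[of "k n"] by auto
        also have "\<dots> \<le> M * h (k n)"
          using M0 s h0[of "k n"] by (intro mult_left_mono) auto
        finally show "norm (z (k n) (max a (s - h (k n))) - z (k n) s) \<le> M * h (k n)" .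
      qed
      show "(\<lambda>n. M * h (k n)) \<longlonglongrightarrow> 0" using tendsto_mult_right_zero[OF hk] by simp
    qed
    from tendsto_add[OF this zx[OF s]] show ?thesis by simp
  qed
  have xeq: "x t = x0 + integral {a..t} (\<lambda>s. f s (x s))" if t: "t \<in> {a..b}" for t
  proof -
    have "(\<lambda>n. integral {a..t} (\<lambda>s. f s (z (k n) (max a (s - h (k n)))))) \<longlonglongrightarrow> integral {a..t} (\<lambda>s. f s (x s))"
    proof (rule dominated_convergence(2)[where h = "\<lambda>_. M"])
      show "(\<lambda>s. f s (z (k n) (max a (s - h (k n))))) integrable_on {a..t}" for n
        by (rule integrable_continuous_real, rule continuous_on_subset[OF delay[OF zcont h0]]) (use t in auto)
      show "(\<lambda>n. f s (z (k n) (max a (s - h (k n))))) \<longlonglongrightarrow> f s (x s)" if "s \<in> {a..t}" for s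
      proof -
        have s: "s \<in> {a..b}" using that t by auto
        show ?thesis
          using continuous_on_tendsto_compose[OF cf tendsto_Pair[OF tendsto_const zdx[OF s]]] s
          by simp
      qed
    qed (use bd t in auto)
    then have "(\<lambda>n. T (h (k n)) (z (k n)) t) \<longlonglongrightarrow> x0 + integral {a..t} (\<lambda>s. f s (x s))"
      unfolding T_def by (intro tendsto_intros)
    then have "(\<lambda>n. z (k n) t) \<longlonglongrightarrow> x0 + integral {a..t} (\<lambda>s. f s (x s))"
      using zfix[OF t] by simp
    with zx[OF t] show ?thesis using LIMSEQ_unique by blast
  qed
  show ?thesis
  proof (intro exI[of _ x] conjI ballI)
    show "x a = x0" using xeq[of a] ab by simp
    fix t assume t: "t \<in> {a..b}"
    have "((\<lambda>u. x0 + integral {a..u} (\<lambda>s. f s (x s))) has_vector_derivative (0 + f t (x t))) (at t within {a..b})"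
      by (intro has_vector_derivative_add has_vector_derivative_const integral_has_vector_derivative comp xc t)
    then show "(x has_vector_derivative f t (x t)) (at t within {a..b})"
      using has_vector_derivative_transform[OF t xeq] by simp
  qed
qed

text \<open>\<open>P\<close> is carried along because a step may only start from a state satisfying
  \<open>P\<close>. Each chosen solution extends the previous one, so the values at a fixed time
  stabilise.\<close>

theorem glue_unit_interval_solutions:
  fixes F :: "real \<Rightarrow> 'a::real_normed_vector \<Rightarrow> 'a"
  assumes step: "\<And>n x0. P x0 \<Longrightarrow> \<exists>x. x (real n) = x0 \<and> (\<forall>t\<in>{real n..real (Suc n)}.
      P (x t) \<and> (x has_vector_derivative F t (x t)) (at t within {real n..real (Suc n)}))"
    and P0: "P x0"
  shows "\<exists>x. x 0 = x0 \<and> (\<forall>t\<ge>0. P (x t) \<and> (x has_vector_derivative F t (x t)) (at t within {0..}))"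
proof -
  define Q where "Q n z \<longleftrightarrow> z 0 = x0 \<and> (\<forall>t\<in>{0..real (Suc n)}.
      P (z t) \<and> (z has_vector_derivative F t (z t)) (at t within {0..real (Suc n)}))" for n z
  have "\<exists>z. \<forall>n. Q n (z n) \<and> (\<forall>t\<in>{0..real (Suc n)}. z (Suc n) t = z n t)"
  proof (rule dependent_nat_choice)
    show "\<exists>z. Q 0 z" using step[OF P0, of 0] by (auto simp: Q_def)
    fix z n assume z: "Q n z"
    define c where "c = real (Suc n)"
    have c: "c > 0" "real (Suc (Suc n)) = c + 1" by (auto simp: c_def)
    have "P (z c)" using z by (auto simp: Q_def c_def)
    from step[OF this, of "Suc n"] obtain y where y: "y c = z c"
      "\<And>t. t \<in> {c..c+1} \<Longrightarrow> P (y t) \<and> (y has_vector_derivative F t (y t)) (at t within {c..c+1})"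
      unfolding c(2) c_def[symmetric] by blast
    define w where "w t = (if t \<in> {0..c} then z t else y t)" for t
    have zd: "P (z t)" "(z has_vector_derivative F t (z t)) (at t within {0..c})" if "t \<in> {0..c}" for t
      using z that by (auto simp: Q_def c_def)
    have un: "{0..c + 1} = {0..c} \<union> {c..c + 1}" using c(1) by auto
    have cl: "closure {0..c} \<inter> closure {c..c+1} = {c}" using c(1) by auto
    \<comment> \<open>At the joint \<open>c\<close> both one-sided derivatives equal
      \<open>F c (z c)\<close>, since \<open>y c = z c\<close>.\<close>
    have "((\<lambda>t. if t \<in> {0..c} then z t else y t) has_vector_derivative
        (if t \<in> {0..c} then F t (z t) else F t (y t))) (at t within {0..c + 1})" if "t \<in> {0..c+1}" for t
    proof (rule has_vector_derivative_If_within_closures[OF _ un])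
      show "t \<in> {0..c} \<union> {c..c+1}" using that un by simp
      have i: "{0..c} \<union> {c} = {0..c}" "{c..c+1} \<union> {c} = {c..c+1}" using c(1) by auto
      show "(z has_vector_derivative F t (z t)) (at t within {0..c} \<union> closure {0..c} \<inter> closure {c..c+1})"
        if "t \<in> {0..c} \<union> closure {0..c} \<inter> closure {c..c+1}"
        using zd that unfolding cl i by blast
      show "(y has_vector_derivative F t (y t)) (at t within {c..c+1} \<union> closure {0..c} \<inter> closure {c..c+1})"
        if "t \<in> {c..c+1} \<union> closure {0..c} \<inter> closure {c..c+1}"
        using y that unfolding cl i by blast
      show "z t = y t" if "t \<in> closure {0..c}" "t \<in> closure {c..c+1}"
        using IntI[OF that] y(1) unfolding cl by simp
      then show "F t (z t) = F t (y t)" if "t \<in> closure {0..c}" "t \<in> closure {c..c+1}"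
        using that by simp
    qed
    then have "(w has_vector_derivative F t (w t)) (at t within {0..c + 1})" if "t \<in> {0..c+1}" for t
      unfolding w_def using that by (simp only: if_distrib[of "F t"])
    moreover have "P (w t)" if "t \<in> {0..c+1}" for t
      using that zd y un by (auto simp: w_def)
    ultimately have "Q (Suc n) w"
      using z c(1) unfolding Q_def c(2) by (auto simp: w_def)
    moreover have "\<forall>t\<in>{0..real (Suc n)}. w t = z t"
      by (auto simp: w_def c_def)
    ultimately show "\<exists>y. Q (Suc n) y \<and> (\<forall>t\<in>{0..real (Suc n)}. y t = z t)" by blast
  qed
  then obtain z where zQ: "\<And>n. Q n (z n)"
    and zS: "\<And>n t. t \<in> {0..real (Suc n)} \<Longrightarrow> z (Suc n) t = z n t" by blast
  have zm: "z m t = z n t" if "n \<le> m" "t \<in> {0..real (Suc n)}" for n m t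
    using that(1)
  proof (induction m rule: dec_induct)
    case (step m)
    then show ?case using zS[of t m] that(2) by auto
  qed simp
  define x where "x t = z (nat \<lceil>t\<rceil>) t" for t
  have xz: "x t = z n t" if "t \<in> {0..real (Suc n)}" for n t
  proof -
    have t: "t \<in> {0..real (Suc (nat \<lceil>t\<rceil>))}" using that by (auto intro: order_trans[OF real_nat_ceiling_ge])
    show ?thesis
      unfolding x_def using zm[OF _ that, of "nat \<lceil>t\<rceil>"] zm[OF _ t, of n] by (metis nle_le)
  qed
  show ?thesis
  proof (intro exI[of _ x] conjI allI impI)
    show "x 0 = x0" using xz[of 0 0] zQ[of 0] by (simp add: Q_def)
    fix t :: real assume t: "t \<ge> 0"
    define n where "n = nat \<lceil>t\<rceil>"
    have tn: "t < real (Suc n)" using t unfolding n_def by linarith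
    have tm: "t \<in> {0..real (Suc n)}" using t tn by auto
    show "P (x t)" using zQ[of n] xz[OF tm] tm by (auto simp: Q_def)
    have "(z n has_vector_derivative F t (x t)) (at t within {0..real (Suc n)})"
      using zQ[of n] xz[OF tm] tm by (auto simp: Q_def)
    then have "(x has_vector_derivative F t (x t)) (at t within {0..real (Suc n)})"
      by (rule has_vector_derivative_transform[OF tm, rotated]) (rule xz)
    \<comment> \<open>\<open>t < Suc n\<close> is strict, so the right end of the interval is
      invisible at \<open>t\<close>.\<close>
    moreover have "at t within {0..real (Suc n)} = at t within {0..}"
      by (rule at_within_nhd[of _ "{..<real (Suc n)}"]) (use tn in auto)
    ultimately show "(x has_vector_derivative F t (x t)) (at t within {0..})" by simp
  qed
qed

section \<open>Symmetric and coercive matrices\<close>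

declare transpose_matrix_vector [simp del] vector_transpose_matrix [simp del]

section \<open>The entrywise inner product and matrix multiplication\<close>

lemma transpose_add: "transpose (A + B) = transpose A + transpose B"
  and transpose_diff: "transpose (A - B) = transpose A - transpose (B :: real^'n^'m)"
  and transpose_minus: "transpose (- A) = - transpose (A :: real^'n^'m)"
  by (simp_all add: transpose_def vec_eq_iff)

lemma trace_mult_eq_inner: "trace (A ** B) = transpose A \<bullet> (B :: real^'n^'n)"
  unfolding trace_def matrix_matrix_mult_def inner_vec_def transpose_def
  by simp (rule sum.swap)

lemma trace_eq_inner: "trace A = mat 1 \<bullet> (A :: real^'n^'n)"
  using trace_mult_eq_inner[of "mat 1" A] by simp

lemma trace_scaleR: "trace (c *\<^sub>R A) = c * trace (A :: real^'n^'n)"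
  by (simp add: trace_eq_inner)

lemma inner_matrix_mult_left:
  fixes A B C :: "real^'n^'n"
  shows "A \<bullet> (B ** C) = (transpose B ** A) \<bullet> C"
  using trace_mult_eq_inner[of "transpose A" "B ** C"] trace_mult_eq_inner[of "transpose A ** B" C]
  by (simp add: matrix_mul_assoc matrix_transpose_mul)

lemma inner_matrix_mult_right:
  fixes A B C :: "real^'n^'n"
  shows "A \<bullet> (B ** C) = (A ** transpose C) \<bullet> B"
proof -
  have "A \<bullet> (B ** C) = trace (transpose A ** (B ** C))"
    unfolding trace_mult_eq_inner by simp
  also have "\<dots> = trace (C ** (transpose A ** B))"
    by (metis matrix_mul_assoc trace_mul_sym)
  also have "\<dots> = (A ** transpose C) \<bullet> B"
    by (simp add: matrix_mul_assoc trace_mult_eq_inner matrix_transpose_mul)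
  finally show ?thesis .
qed

lemma inner_transpose: "transpose A \<bullet> transpose B = A \<bullet> (B :: real^'n^'n)"
  unfolding inner_vec_def transpose_def by simp (rule sum.swap)

lemma norm_transpose: "norm (transpose A) = norm (A :: real^'n^'n)"
  by (simp add: norm_eq_sqrt_inner inner_transpose)

lemma norm_matrix_vector_mult_le: "norm (A *v x) \<le> norm A * norm (x :: real^'n)"
proof -
  have "norm (A *v x) \<le> L2_set (\<lambda>i. norm (A $ i) * norm x) UNIV"
    unfolding norm_vec_def[of "A *v x"]
    by (rule L2_set_mono) (simp_all add: matrix_mult_dot Cauchy_Schwarz_ineq2)
  also have "\<dots> = norm A * norm x"
    by (simp add: norm_vec_def[of A] L2_set_left_distrib)
  finally show ?thesis .
qed

lemma norm_matrix_matrix_mult_le: "norm (A ** B) \<le> norm A * norm (B :: real^'n^'n)"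
proof -
  have row: "(A ** B) $ i = transpose B *v (A $ i)" for i
    by (simp add: matrix_matrix_mult_def matrix_vector_mult_def transpose_def vec_eq_iff mult.commute)
  have "norm (A ** B) \<le> L2_set (\<lambda>i. norm (A $ i) * norm B) UNIV"
    unfolding norm_vec_def[of "A ** B"]
    by (rule L2_set_mono)
       (use norm_matrix_vector_mult_le[of "transpose B"] in \<open>auto simp: row norm_transpose mult.commute[of "norm (_ $ _)"]\<close>)
  also have "\<dots> = norm A * norm B"
    by (simp add: norm_vec_def[of A] L2_set_left_distrib)
  finally show ?thesis .
qed

lemma bounded_bilinear_matrix_mult:
  "bounded_bilinear ((**) :: real^'n^'n \<Rightarrow> real^'n^'n \<Rightarrow> real^'n^'n)"
proof
  show "\<exists>K. \<forall>a b. norm (a ** b) \<le> norm (a :: real^'n^'n) * norm (b :: real^'n^'n) * K"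
    using norm_matrix_matrix_mult_le by (intro exI[of _ 1]) auto
qed (simp_all add: matrix_matrix_mult_def vec_eq_iff sum.distrib sum_distrib_left algebra_simps)

lemmas matrix_mult_linear_simps =
  bounded_bilinear.add_left[OF bounded_bilinear_matrix_mult]
  bounded_bilinear.add_right[OF bounded_bilinear_matrix_mult]
  bounded_bilinear.diff_left[OF bounded_bilinear_matrix_mult]
  bounded_bilinear.diff_right[OF bounded_bilinear_matrix_mult]
  bounded_bilinear.minus_left[OF bounded_bilinear_matrix_mult]
  bounded_bilinear.minus_right[OF bounded_bilinear_matrix_mult]
  bounded_bilinear.scaleR_left[OF bounded_bilinear_matrix_mult]
  bounded_bilinear.scaleR_right[OF bounded_bilinear_matrix_mult]

lemma bounded_linear_transpose: "bounded_linear (transpose :: real^'n^'n \<Rightarrow> real^'n^'n)"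
  by (rule bounded_linear_intro[of _ 1])
     (auto simp: transpose_add transpose_scalar norm_transpose)

lemma bounded_linear_matrix_apply: "bounded_linear (\<lambda>A :: real^'n^'n. A *v x)"
  by (rule bounded_linear_intro[of _ "norm x"])
     (auto simp: matrix_vector_mult_add_rdistrib scaleR_matrix_vector_assoc norm_matrix_vector_mult_le)

lemma bounded_linear_trace: "bounded_linear (trace :: real^'n^'n \<Rightarrow> real)"
  unfolding trace_eq_inner by (rule bounded_linear_inner_right)

lemmas tendsto_matrix_mult [tendsto_intros] = bounded_bilinear.tendsto[OF bounded_bilinear_matrix_mult]
lemmas continuous_on_matrix_mult [continuous_intros] =
  bounded_bilinear.continuous_on[OF bounded_bilinear_matrix_mult]
lemmas continuous_on_trace [continuous_intros] = bounded_linear.continuous_on[OF bounded_linear_trace]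

section \<open>Spectral theorem in dimension three and its consequences\<close>

lemma symmetric_quadratic_swap:
  assumes "symmetric_mat B" shows "x \<bullet> (B *v y) = (B *v x) \<bullet> y"
  using assms dot_lmul_matrix[of x B y] by (metis symmetric_mat_def vector_transpose_matrix)

text \<open>Variational argument: let \<open>v\<close> maximise the quadratic form on the unit
  sphere of \<open>U\<close>. The residual \<open>w = B v - c v\<close> lies in \<open>U\<close> and
  is orthogonal to \<open>v\<close>, and moving along it would increase the form unless
  \<open>w = 0\<close>. The invariant subspace \<open>U\<close> allows eigenvectors to be split off
  one at a time.\<close>

lemma symmetric_eigenvector_exists:
  fixes B :: mat3 and U :: "(real^3) set"
  assumes sym: "symmetric_mat B" and U: "subspace U" and inv: "\<And>x. x \<in> U \<Longrightarrow> B *v x \<in> U"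
    and ne: "u \<in> U" "u \<noteq> 0"
  shows "\<exists>v c. v \<in> U \<and> norm v = 1 \<and> B *v v = c *\<^sub>R v"
proof -
  let ?S = "sphere 0 1 \<inter> U"
  have "compact ?S" using closed_subspace[OF U] by (intro compact_Int_closed) auto
  moreover have "u /\<^sub>R norm u \<in> ?S" using ne U by (auto simp: subspace_scale)
  then have "?S \<noteq> {}" by blast
  moreover have "continuous_on ?S (\<lambda>x. x \<bullet> (B *v x))"
    by (intro continuous_intros matrix_vector_mult_linear_continuous_on)
  ultimately obtain v where v: "v \<in> ?S" "\<And>y. y \<in> ?S \<Longrightarrow> y \<bullet> (B *v y) \<le> v \<bullet> (B *v v)"
    using continuous_attains_sup[of ?S "\<lambda>x. x \<bullet> (B *v x)"] by blast
  define c where "c = v \<bullet> (B *v v)"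
  have nv: "norm v = 1" "v \<bullet> v = 1" "v \<in> U" using v(1) by (auto simp: norm_eq_1)
  have max: "x \<bullet> (B *v x) \<le> c * (x \<bullet> x)" if "x \<in> U" for x
  proof (cases "x = 0")
    case False
    have "x /\<^sub>R norm x \<in> ?S" using that False U by (auto simp: subspace_scale)
    from v(2)[OF this] have "inverse (norm x) * inverse (norm x) * (x \<bullet> (B *v x)) \<le> c"
      by (simp add: matrix_vector_mult_scaleR c_def mult.assoc)
    then have "(inverse (norm x) * inverse (norm x) * (x \<bullet> (B *v x))) * (norm x * norm x) \<le> c * (norm x * norm x)"
      by (intro mult_right_mono) auto
    also have "(inverse (norm x) * inverse (norm x) * (x \<bullet> (B *v x))) * (norm x * norm x) = x \<bullet> (B *v x)"
      using False by (simp add: field_simps)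
    finally show ?thesis by (simp add: power2_norm_eq_inner[symmetric] power2_eq_square)
  qed simp
  define w where "w = B *v v - c *\<^sub>R v"
  have wU: "w \<in> U" unfolding w_def using inv nv(3) U by (simp add: subspace_diff subspace_scale)
  have wv: "w \<bullet> v = 0" by (simp add: w_def inner_diff_left inner_diff_right nv(2) c_def inner_commute)
  have wBv: "w \<bullet> (B *v v) = w \<bullet> w"
    using wv by (simp add: w_def inner_diff_right inner_diff_left)
  \<comment> \<open>The gain along \<open>w\<close> is of first order in \<open>t\<close>, the
    possible loss only of second order.\<close>
  have ineq: "2 * t * (w \<bullet> w) \<le> t * t * (c * (w \<bullet> w) - w \<bullet> (B *v w))" for t
  proof -
    have "v + t *\<^sub>R w \<in> U" using nv(3) wU U by (simp add: subspace_add subspace_scale)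
    note m = max[OF this]
    have e1: "(v + t *\<^sub>R w) \<bullet> (B *v (v + t *\<^sub>R w)) = c + 2 * t * (w \<bullet> w) + t * t * (w \<bullet> (B *v w))"
      using wBv symmetric_quadratic_swap[OF sym, of v w]
      by (simp add: matrix_vector_right_distrib matrix_vector_mult_scaleR inner_add_left inner_add_right
          c_def inner_commute algebra_simps)
    have e2: "(v + t *\<^sub>R w) \<bullet> (v + t *\<^sub>R w) = 1 + t * t * (w \<bullet> w)"
      using wv nv(2) by (simp add: inner_add_left inner_add_right inner_commute algebra_simps)
    from m[unfolded e1 e2] show ?thesis by (simp add: algebra_simps)
  qed
  have "w = 0"
  proof (rule ccontr)
    assume "w \<noteq> 0"
    then have p: "w \<bullet> w > 0" by simp
    define k where "k = c * (w \<bullet> w) - w \<bullet> (B *v w)"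
    \<comment> \<open>Chosen so small that the second-order contribution \<open>t * k\<close> is at
      most \<open>w \<bullet> w\<close>.\<close>
    define t where "t = (w \<bullet> w) / (\<bar>k\<bar> + 1)"
    have t: "t > 0" using p by (simp add: t_def)
    have "t * (2 * (w \<bullet> w)) \<le> t * (t * k)" using ineq[of t] by (simp add: k_def algebra_simps)
    then have "2 * (w \<bullet> w) \<le> t * k" using t by simp
    also have "\<dots> \<le> t * (\<bar>k\<bar> + 1)" using t by (intro mult_left_mono) auto
    also have "\<dots> = w \<bullet> w" by (simp add: t_def)
    finally show False using p by simp
  qed
  then show ?thesis using nv unfolding w_def by (intro exI[of _ v] exI[of _ c]) auto
qed

definition diag_mat :: "real^3 \<Rightarrow> mat3" where
  "diag_mat d = (\<chi> i j. if i = j then d $ i else 0)"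

text \<open>The orthogonal complement of an eigenvector of a symmetric matrix is invariant, so the
  eigenvector lemma applies three times, in ever smaller complements.\<close>

theorem spectral_theorem_3:
  assumes sym: "symmetric_mat B"
  obtains V d where "orthogonal_matrix V" "B = V ** diag_mat d ** transpose V"
proof -
  have orth_inv: "orthogonal v (B *v x)" if "B *v v = c *\<^sub>R v" "orthogonal v x" for v c x
    using that symmetric_quadratic_swap[OF sym, of v x] by (simp add: orthogonal_def)
  have "axis 1 1 \<noteq> (0 :: real^3)" by (simp add: axis_eq_0_iff)
  then obtain v1 c1 where 1: "norm v1 = 1" "B *v v1 = c1 *\<^sub>R v1"
    using symmetric_eigenvector_exists[OF sym subspace_UNIV] by blast
  have sub: "subspace {x. orthogonal v x}" for v :: "real^3"
    by (simp add: subspace_orthogonal_to_vector)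
  obtain u2 where "u2 \<noteq> 0" "orthogonal v1 u2"
    by (rule orthogonal_to_vector_exists[of v1]) auto
  then obtain v2 c2 where 2: "orthogonal v1 v2" "norm v2 = 1" "B *v v2 = c2 *\<^sub>R v2"
    using symmetric_eigenvector_exists[OF sym sub[of v1], of u2] orth_inv[OF 1(2)] by auto
  have "dim {v1, v2} < DIM(real^3)"
    using dim_le_card'[of "{v1, v2}"] card_insert_le_m1[of 2 "{v2}" v1] by (simp add: card_insert_if)
  then obtain u3 where "u3 \<noteq> 0" "\<And>y. y \<in> span {v1, v2} \<Longrightarrow> orthogonal u3 y"
    using orthogonal_to_subspace_exists by blast
  then have "u3 \<in> {x. orthogonal v1 x} \<inter> {x. orthogonal v2 x}" "u3 \<noteq> 0"
    by (auto simp: orthogonal_commute[of _ u3] span_base)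
  then obtain v3 c3 where 3: "orthogonal v1 v3" "orthogonal v2 v3" "norm v3 = 1" "B *v v3 = c3 *\<^sub>R v3"
    using symmetric_eigenvector_exists[OF sym subspace_inter[OF sub[of v1] sub[of v2]], of u3]
      orth_inv[OF 1(2)] orth_inv[OF 2(3)] by auto
  define V :: mat3 where "V = transpose (vector [v1, v2, v3])"
  define d :: "real^3" where "d = vector [c1, c2, c3]"
  have col: "column 1 V = v1" "column 2 V = v2" "column 3 V = v3"
    by (simp_all add: V_def column_transpose row_def vector_3 vec_eq_iff)
  have oV: "orthogonal_matrix V"
    unfolding orthogonal_matrix_orthonormal_columns forall_3 col
    using 1 2 3 by (auto simp: orthogonal_commute)
  have "B ** V = V ** diag_mat d"
  proof -
    have "column j (B ** V) = column j (V ** diag_mat d)" for j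
    proof -
      have l: "column j (B ** V) = B *v column j V"
        by (simp add: column_def matrix_matrix_mult_def matrix_vector_mult_def vec_eq_iff)
      have r: "column j (V ** diag_mat d) = d $ j *\<^sub>R column j V"
        by (simp add: column_def matrix_matrix_mult_def diag_mat_def vec_eq_iff if_distrib cong: if_cong)
      show ?thesis unfolding l r using exhaust_3[of j] 1 2 3 col by (auto simp: d_def vector_3)
    qed
    then show ?thesis by (simp add: column_def vec_eq_iff)
  qed
  then have "V ** diag_mat d ** transpose V = B ** (V ** transpose V)"
    by (simp add: matrix_mul_assoc)
  also have "\<dots> = B" using oV by (simp add: orthogonal_matrix_def)
  finally show ?thesis using that[OF oV, of d] by simp
qed

lemma diag_mat_apply: "diag_mat d *v y = (\<chi> i. d $ i * y $ i)"
  by (simp add: diag_mat_def matrix_vector_mult_def vec_eq_iff if_distrib[of "\<lambda>x. x * _"] cong: if_cong)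

lemma quadratic_form_transpose: "x \<bullet> ((V ** M ** transpose V) *v x) = (transpose V *v x) \<bullet> (M *v (transpose V *v (x::real^3)))"
proof -
  have "x \<bullet> ((V ** M ** transpose V) *v x) = x \<bullet> (V *v (M *v (transpose V *v x)))"
    by (simp add: matrix_vector_mul_assoc matrix_mul_assoc)
  also have "\<dots> = (transpose V *v x) \<bullet> (M *v (transpose V *v x))"
    by (metis dot_lmul_matrix vector_transpose_matrix transpose_transpose)
  finally show ?thesis .
qed

lemma spectral_facts:
  assumes V: "orthogonal_matrix V" and B: "B = V ** diag_mat d ** transpose V"
  shows spectral_quadratic: "x \<bullet> (B *v x) = (\<Sum>i\<in>UNIV. d $ i * ((transpose V *v x) $ i)\<^sup>2)"
    and spectral_norm: "x \<bullet> x = (\<Sum>i\<in>UNIV. ((transpose V *v x) $ i)\<^sup>2)"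
    and spectral_eigenvalue: "column i V \<bullet> (B *v column i V) = d $ i"
    and spectral_unit: "column i V \<bullet> column i V = 1"
    and spectral_trace: "trace (P ** B) = (\<Sum>i\<in>UNIV. d $ i * (column i V \<bullet> (P *v column i V)))"
    and spectral_trace1: "trace B = d $ 1 + d $ 2 + d $ 3"
    and spectral_det_shift: "det (B + s *\<^sub>R mat 1) = (d $ 1 + s) * (d $ 2 + s) * (d $ 3 + s)"
proof -
  have VV: "transpose V ** V = mat 1" "V ** transpose V = mat 1"
    using V by (auto simp: orthogonal_matrix_def)
  show "x \<bullet> (B *v x) = (\<Sum>i\<in>UNIV. d $ i * ((transpose V *v x) $ i)\<^sup>2)" for x
    unfolding B quadratic_form_transpose diag_mat_apply
    by (simp add: inner_vec_def power2_eq_square mult_ac)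
  then have q: "x \<bullet> (B *v x) = (\<Sum>i\<in>UNIV. d $ i * ((transpose V *v x) $ i)\<^sup>2)" for x .
  have n: "x \<bullet> x = (transpose V *v x) \<bullet> (transpose V *v x)" for x
    using quadratic_form_transpose[of x V "mat 1"] VV by simp
  then show "x \<bullet> x = (\<Sum>i\<in>UNIV. ((transpose V *v x) $ i)\<^sup>2)"
    by (simp add: inner_vec_def power2_eq_square)
  have col: "transpose V *v column i V = axis i 1"
  proof -
    have "column i V = V *v axis i 1" by (simp add: matrix_vector_mult_basis)
    then show ?thesis using VV by (simp add: matrix_vector_mul_assoc)
  qed
  show "column i V \<bullet> (B *v column i V) = d $ i"
    unfolding q col by (simp add: axis_def if_distrib[of "\<lambda>x. x\<^sup>2"] if_distrib[of "\<lambda>x. _ * x"] cong: if_cong)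
  show "column i V \<bullet> column i V = 1"
    using V by (simp add: orthogonal_matrix_orthonormal_columns norm_eq_1)
  have tr: "trace (P ** B) = (\<Sum>i\<in>UNIV. d $ i * (column i V \<bullet> (P *v column i V)))" for P
  proof -
    have "trace (P ** B) = trace ((transpose V ** P ** V) ** diag_mat d)"
    proof -
      have "trace (P ** B) = trace ((P ** V ** diag_mat d) ** transpose V)" by (simp add: B matrix_mul_assoc)
      also have "\<dots> = trace (transpose V ** (P ** V ** diag_mat d))" by (rule trace_mul_sym)
      finally show ?thesis by (simp add: matrix_mul_assoc)
    qed
    also have "\<dots> = (\<Sum>i\<in>UNIV. d $ i * (transpose V ** P ** V) $ i $ i)"
      by (simp add: trace_def matrix_matrix_mult_def diag_mat_def if_distrib mult.commute cong: if_cong)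
    also have "\<dots> = (\<Sum>i\<in>UNIV. d $ i * (column i V \<bullet> (P *v column i V)))"
    proof (rule sum.cong)
      fix i
      have "(transpose V ** P ** V) $ i $ i = axis i 1 \<bullet> ((transpose V ** P ** transpose (transpose V)) *v axis i 1)"
        by (simp add: matrix_vector_mult_basis inner_axis' column_def)
      also have "\<dots> = column i V \<bullet> (P *v column i V)"
        unfolding quadratic_form_transpose by (simp add: matrix_vector_mult_basis)
      finally show "d $ i * (transpose V ** P ** V) $ i $ i = d $ i * (column i V \<bullet> (P *v column i V))" by simp
    qed simp
    finally show ?thesis .
  qed
  show "trace (P ** B) = (\<Sum>i\<in>UNIV. d $ i * (column i V \<bullet> (P *v column i V)))" by (rule tr)
  show "trace B = d $ 1 + d $ 2 + d $ 3"
    using tr[of "mat 1"] V by (simp add: sum_3 orthogonal_matrix_orthonormal_columns norm_eq_1)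
  have "B + s *\<^sub>R mat 1 = V ** (diag_mat d + s *\<^sub>R mat 1) ** transpose V"
    by (simp add: B VV matrix_mult_linear_simps)
  then have "det (B + s *\<^sub>R mat 1) = det V * det (diag_mat d + s *\<^sub>R mat 1) * det V"
    by (simp add: det_mul)
  \<comment> \<open>\<open>det V\<close> is 1 or -1 and enters twice.\<close>
  also have "\<dots> = det (diag_mat d + s *\<^sub>R mat 1)"
    using det_orthogonal_matrix[OF V] by auto
  also have "\<dots> = (d $ 1 + s) * (d $ 2 + s) * (d $ 3 + s)"
    by (simp add: det_3 diag_mat_def mat_def)
  finally show "det (B + s *\<^sub>R mat 1) = (d $ 1 + s) * (d $ 2 + s) * (d $ 3 + s)" .
qed


text \<open>\<^term>\<open>coercive \<delta> B\<close> is the order relation \<open>B \<ge> \<delta> I\<close> between symmetric matrices.\<close>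

definition coercive :: "real \<Rightarrow> mat3 \<Rightarrow> bool" where
  "coercive \<delta> B \<longleftrightarrow> symmetric_mat B \<and> (\<forall>x. \<delta> * (x \<bullet> x) \<le> x \<bullet> (B *v x))"

lemma coerciveD:
  assumes "coercive \<delta> B"
  shows "symmetric_mat B" "transpose B = B" "\<delta> * (x \<bullet> x) \<le> x \<bullet> (B *v x)"
  using assms by (auto simp: coercive_def symmetric_mat_def)

lemma coercive_mono: "coercive c B \<Longrightarrow> d \<le> c \<Longrightarrow> coercive d B"
  unfolding coercive_def by (meson inner_ge_zero mult_right_mono order_trans)

lemma coercive_shift: "coercive c B \<Longrightarrow> coercive (c + s) (B + s *\<^sub>R mat 1)"
  by (auto simp: coercive_def symmetric_mat_def transpose_add transpose_scalar matrix_vector_mult_add_rdistrib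
      algebra_simps scaleR_matrix_vector_assoc[symmetric])

lemma coercive_imp_spd:
  assumes "coercive c B" "c > 0" shows "spd B"
proof -
  have "x \<bullet> (B *v x) > 0" if "x \<noteq> 0" for x
    using coerciveD(3)[OF assms(1), of x] that assms(2) by (smt (verit) inner_gt_zero_iff mult_pos_pos)
  then show ?thesis using assms(1) by (simp add: spd_def coercive_def)
qed

lemma coercive_eigenvalue:
  assumes "coercive c B" "orthogonal_matrix V" "B = V ** diag_mat d ** transpose V"
  shows "c \<le> d $ i"
  using coerciveD(3)[OF assms(1), of "column i V"] spectral_eigenvalue[OF assms(2,3)] spectral_unit[OF assms(2,3)]
  by simp

lemma eigenvalue_coercive:
  assumes "symmetric_mat B" "orthogonal_matrix V" "B = V ** diag_mat d ** transpose V" "\<And>i. c \<le> d $ i"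
  shows "coercive c B"
  unfolding coercive_def spectral_quadratic[OF assms(2,3)] spectral_norm[OF assms(2,3)] sum_distrib_left
  using assms by (auto intro!: sum_mono mult_right_mono)

lemma spd_imp_coercive:
  assumes "spd B" shows "\<exists>c>0. coercive c B"
proof -
  have sym: "symmetric_mat B" using assms by (simp add: spd_def)
  obtain V d where V: "orthogonal_matrix V" and B: "B = V ** diag_mat d ** transpose V"
    using spectral_theorem_3[OF sym] .
  have "d $ i > 0" for i
  proof -
    have "column i V \<noteq> 0" using spectral_unit[OF V B, of i] by auto
    then show ?thesis using assms spectral_eigenvalue[OF V B, of i] by (metis spd_def)
  qed
  then have "Min (range (($) d)) > 0" by simp
  moreover have "coercive (Min (range (($) d))) B"
    by (rule eigenvalue_coercive[OF sym V B]) simp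
  ultimately show ?thesis by blast
qed

text \<open>The product \<open>P ** Q\<close> need not be symmetric, but in an eigenbasis of
  \<open>Q\<close> its trace is a sum of eigenvalues of \<open>Q\<close> times values of the form of
  \<open>P\<close>. Many matrix inequalities below come from a suitable choice of \<open>P\<close>
  and \<open>Q\<close>.\<close>

lemma trace_mult_nonneg:
  assumes "coercive 0 P" "coercive 0 Q" shows "0 \<le> trace (P ** Q)"
proof -
  obtain V d where V: "orthogonal_matrix V" and Q: "Q = V ** diag_mat d ** transpose V"
    using spectral_theorem_3[OF coerciveD(1)[OF assms(2)]] .
  show ?thesis
    unfolding spectral_trace[OF V Q]
    using coercive_eigenvalue[OF assms(2) V Q] coerciveD(3)[OF assms(1)]
    by (intro sum_nonneg mult_nonneg_nonneg) auto
qed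

lemma det_shift_ge:
  assumes "coercive c B" "0 \<le> c + s" shows "(c + s) ^ 3 \<le> det (B + s *\<^sub>R mat 1)"
proof -
  obtain V d where V: "orthogonal_matrix V" and B: "B = V ** diag_mat d ** transpose V"
    using spectral_theorem_3[OF coerciveD(1)[OF assms(1)]] .
  have d: "c \<le> d $ i" for i by (rule coercive_eigenvalue[OF assms(1) V B])
  have "(c + s) * (c + s) * (c + s) \<le> (d $ 1 + s) * (d $ 2 + s) * (d $ 3 + s)"
    using d[of 1] d[of 2] d[of 3] assms(2) by (intro mult_mono) auto
  then show ?thesis by (simp add: spectral_det_shift[OF V B] power3_eq_cube)
qed

lemma det_ge: "coercive c B \<Longrightarrow> 0 \<le> c \<Longrightarrow> c ^ 3 \<le> det B"
  using det_shift_ge[of c B 0] by simp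

lemma det_shift_le:
  assumes "coercive 0 B" "trace B \<le> R" "s \<ge> 0" shows "det (B + s *\<^sub>R mat 1) \<le> (R + s) ^ 3"
proof -
  obtain V d where V: "orthogonal_matrix V" and B: "B = V ** diag_mat d ** transpose V"
    using spectral_theorem_3[OF coerciveD(1)[OF assms(1)]] .
  have d: "0 \<le> d $ i" for i by (rule coercive_eigenvalue[OF assms(1) V B])
  have "d $ 1 + d $ 2 + d $ 3 \<le> R" using assms(2) spectral_trace1[OF V B] by simp
  then have "d $ 1 \<le> R" "d $ 2 \<le> R" "d $ 3 \<le> R"
    using d[of 1] d[of 2] d[of 3] by auto
  then have "(d $ 1 + s) * (d $ 2 + s) * (d $ 3 + s) \<le> (R + s) * (R + s) * (R + s)"
    using d[of 1] d[of 2] d[of 3] assms(3) by (intro mult_mono mult_nonneg_nonneg) auto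
  then show ?thesis by (simp add: spectral_det_shift[OF V B] power3_eq_cube)
qed

text \<open>Only the two extreme terms of the expanded product are kept. The lower bound depends on
  \<open>B\<close> through \<open>det B\<close> alone, which the flow preserves.\<close>

lemma det_shift_superadditive:
  assumes "coercive 0 B" "s \<ge> 0" shows "det B + s ^ 3 \<le> det (B + s *\<^sub>R mat 1)"
proof -
  obtain V d where V: "orthogonal_matrix V" and B: "B = V ** diag_mat d ** transpose V"
    using spectral_theorem_3[OF coerciveD(1)[OF assms(1)]] .
  have d: "0 \<le> d $ i" for i by (rule coercive_eigenvalue[OF assms(1) V B])
  have "(d $ 1 + s) * (d $ 2 + s) * (d $ 3 + s) - (d $ 1 * d $ 2 * d $ 3 + s ^ 3)
      = s * (d $ 1 * d $ 2 + d $ 1 * d $ 3 + d $ 2 * d $ 3) + s ^ 2 * (d $ 1 + d $ 2 + d $ 3)"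
    by (simp add: algebra_simps power2_eq_square power3_eq_cube)
  moreover have "\<dots> \<ge> 0"
    using d assms(2) by (intro add_nonneg_nonneg mult_nonneg_nonneg) auto
  moreover have "det B = d $ 1 * d $ 2 * d $ 3" using spectral_det_shift[OF V B, of 0] by simp
  ultimately show ?thesis by (simp add: spectral_det_shift[OF V B])
qed

lemma quadratic_form_le_trace:
  assumes "coercive 0 B" shows "x \<bullet> (B *v x) \<le> trace B * (x \<bullet> x)"
proof -
  obtain V d where V: "orthogonal_matrix V" and B: "B = V ** diag_mat d ** transpose V"
    using spectral_theorem_3[OF coerciveD(1)[OF assms(1)]] .
  have d: "0 \<le> d $ i" for i by (rule coercive_eigenvalue[OF assms(1) V B])
  have "d $ i \<le> trace B" for i
    using d[of 1] d[of 2] d[of 3] exhaust_3[of i] by (auto simp: spectral_trace1[OF V B])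
  then show ?thesis
    unfolding spectral_quadratic[OF V B] spectral_norm[OF V B] sum_distrib_left
    by (intro sum_mono mult_right_mono) auto
qed

text \<open>Each eigenvalue is the determinant divided by the product of the other two, and that
  product is at most \<open>R^2\<close>.\<close>

lemma coercive_of_det_trace:
  assumes "coercive 0 B" "trace B \<le> R" "R > 0" "\<epsilon> \<le> det B" "\<epsilon> > 0"
  shows "coercive (\<epsilon> / R\<^sup>2) B"
proof -
  have sym: "symmetric_mat B" by (rule coerciveD(1)[OF assms(1)])
  obtain V d where V: "orthogonal_matrix V" and B: "B = V ** diag_mat d ** transpose V"
    using spectral_theorem_3[OF sym] .
  have d: "0 \<le> d $ i" for i by (rule coercive_eigenvalue[OF assms(1) V B])
  have "d $ 1 + d $ 2 + d $ 3 \<le> R" using assms(2) spectral_trace1[OF V B] by simp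
  then have R: "d $ 1 \<le> R" "d $ 2 \<le> R" "d $ 3 \<le> R"
    using d[of 1] d[of 2] d[of 3] by auto
  have e: "\<epsilon> \<le> d $ 1 * d $ 2 * d $ 3" using spectral_det_shift[OF V B, of 0] assms(4) by simp
  have *: "\<epsilon> / R\<^sup>2 \<le> x" if "\<epsilon> \<le> x * (y * z)" "0 \<le> x" "0 \<le> y" "0 \<le> z" "y \<le> R" "z \<le> R" for x y z
  proof -
    have "x * (y * z) \<le> x * (R * R)" using that assms(3) by (intro mult_left_mono mult_mono) auto
    then have "\<epsilon> \<le> x * R\<^sup>2" using that(1) by (simp add: power2_eq_square)
    then show ?thesis using assms(3) by (simp add: field_simps)
  qed
  have "\<epsilon> / R\<^sup>2 \<le> d $ 1" by (rule *[of _ "d $ 2" "d $ 3"]) (use e d R in \<open>auto simp: mult_ac\<close>)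
  moreover have "\<epsilon> / R\<^sup>2 \<le> d $ 2" by (rule *[of _ "d $ 1" "d $ 3"]) (use e d R in \<open>auto simp: mult_ac\<close>)
  moreover have "\<epsilon> / R\<^sup>2 \<le> d $ 3" by (rule *[of _ "d $ 1" "d $ 2"]) (use e d R in \<open>auto simp: mult_ac\<close>)
  ultimately show ?thesis
    by (intro eigenvalue_coercive[OF sym V B]) (metis exhaust_3)
qed

section \<open>Inverses of coercive matrices, derivatives of inverse and determinant\<close>

lemma coercive_inverse:
  assumes P: "coercive c P" and c: "c > 0"
  shows matrix_inv_right: "P ** matrix_inv P = mat 1"
    and matrix_inv_left: "matrix_inv P ** P = mat 1"
    and transpose_matrix_inv: "transpose (matrix_inv P) = matrix_inv P"
    and matrix_inv_quadratic: "c * ((matrix_inv P *v x) \<bullet> (matrix_inv P *v x)) \<le> x \<bullet> (matrix_inv P *v x)"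
    and coercive_matrix_inv: "coercive 0 (matrix_inv P)"
    and norm_matrix_inv_le: "norm (matrix_inv P) \<le> 3 / c"
proof -
  have "det P > 0" using det_ge[OF P] c by (smt (verit) zero_less_power)
  then have "invertible P" by (simp add: invertible_det_nz)
  then have "P ** matrix_inv P = mat 1 \<and> matrix_inv P ** P = mat 1"
    unfolding invertible_def matrix_inv_def by (rule someI_ex)
  then show r: "P ** matrix_inv P = mat 1" and l: "matrix_inv P ** P = mat 1" by auto
  have "transpose (matrix_inv P) ** P = mat 1"
    using arg_cong[OF r, of transpose] coerciveD(2)[OF P] by (simp add: matrix_transpose_mul)
  then have "transpose (matrix_inv P) ** (P ** matrix_inv P) = matrix_inv P"
    by (simp add: matrix_mul_assoc)
  then show t: "transpose (matrix_inv P) = matrix_inv P" by (simp add: r)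
  have q: "c * ((matrix_inv P *v x) \<bullet> (matrix_inv P *v x)) \<le> x \<bullet> (matrix_inv P *v x)" for x
    using coerciveD(3)[OF P, of "matrix_inv P *v x"]
    by (simp add: matrix_vector_mul_assoc r inner_commute)
  then show "c * ((matrix_inv P *v x) \<bullet> (matrix_inv P *v x)) \<le> x \<bullet> (matrix_inv P *v x)" .
  have "0 \<le> x \<bullet> (matrix_inv P *v x)" for x
    using q[of x] c by (smt (verit) inner_ge_zero mult_nonneg_nonneg)
  then show "coercive 0 (matrix_inv P)" using t by (simp add: coercive_def symmetric_mat_def)
  have n: "norm (matrix_inv P *v x) \<le> norm x / c" for x
  proof (cases "matrix_inv P *v x = 0")
    case False
    have "c * (norm (matrix_inv P *v x))\<^sup>2 \<le> norm x * norm (matrix_inv P *v x)"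
      using q[of x] norm_cauchy_schwarz[of x "matrix_inv P *v x"] by (simp add: power2_norm_eq_inner)
    then have "c * norm (matrix_inv P *v x) \<le> norm x"
      using False by (simp add: power2_eq_square)
    then show ?thesis using c by (simp add: field_simps)
  qed (use c in simp)
  have "norm (matrix_inv P $ i) \<le> 1 / c" for i
  proof -
    have "matrix_inv P $ i = column i (transpose (matrix_inv P))"
      by (simp add: column_transpose row_def)
    also have "\<dots> = matrix_inv P *v axis i 1" by (simp add: t matrix_vector_mult_basis)
    finally show ?thesis using n[of "axis i 1"] by simp
  qed
  \<comment> \<open>Three rows of norm at most \<open>1 / c\<close> give the constant 3.\<close>
  then have "(\<Sum>i\<in>UNIV. norm (matrix_inv P $ i)) \<le> (\<Sum>i\<in>(UNIV::3 set). 1 / c)"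
    by (intro sum_mono)
  then show "norm (matrix_inv P) \<le> 3 / c"
    using L2_set_le_sum[of UNIV "\<lambda>i. norm (matrix_inv P $ i)"] by (simp add: norm_vec_def[of "matrix_inv P"])
qed

text \<open>Evaluating the form of \<open>P\<close> at \<open>y - (1 / R) P y\<close> and using
  \<open>P \<le> R I\<close> gives \<open>P P \<le> R P\<close>; substituting
  \<open>y = matrix_inv P *v x\<close> turns this into the claim.\<close>

lemma matrix_inv_coercive:
  assumes P: "coercive c P" and c: "c > 0" and R: "\<And>x. x \<bullet> (P *v x) \<le> R * (x \<bullet> x)" and "R > 0"
  shows "coercive (1 / R) (matrix_inv P)"
proof -
  have key: "(P *v y) \<bullet> (P *v y) / R \<le> y \<bullet> (P *v y)" for y
  proof -
    define u where "u = P *v y"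
    have "0 \<le> (y - (1 / R) *\<^sub>R u) \<bullet> (P *v (y - (1 / R) *\<^sub>R u))"
      using coerciveD(3)[OF P, of "y - (1 / R) *\<^sub>R u"] c by (smt (verit) inner_ge_zero mult_nonneg_nonneg)
    also have "\<dots> = y \<bullet> u - 2 * (1 / R) * (u \<bullet> u) + (1 / R) * (1 / R) * (u \<bullet> (P *v u))"
      using symmetric_quadratic_swap[OF coerciveD(1)[OF P], of y u]
      by (simp add: u_def matrix_vector_mult_diff_distrib matrix_vector_mult_scaleR inner_diff_left
          inner_diff_right inner_commute algebra_simps)
    also have "\<dots> \<le> y \<bullet> u - 2 * (1 / R) * (u \<bullet> u) + (1 / R) * (1 / R) * (R * (u \<bullet> u))"
      using R[of u] by (intro add_left_mono mult_left_mono) auto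
    also have "\<dots> = y \<bullet> u - (u \<bullet> u) / R" using \<open>R > 0\<close> by simp
    finally show ?thesis by (simp add: u_def)
  qed
  have "1 / R * (x \<bullet> x) \<le> x \<bullet> (matrix_inv P *v x)" for x
    using key[of "matrix_inv P *v x"]
    by (simp add: matrix_vector_mul_assoc matrix_inv_right[OF P c] inner_commute)
  then show ?thesis
    using transpose_matrix_inv[OF P c] by (simp add: coercive_def symmetric_mat_def)
qed

lemma coercive_diff_mat: "coercive k X \<Longrightarrow> coercive 0 (X - k *\<^sub>R mat 1)"
  using coercive_shift[of k X "- k"] by simp

lemma coercive_conjugate:
  assumes "coercive 0 X" shows "coercive 0 (transpose M ** X ** M)"
proof -
  have "x \<bullet> ((transpose M ** X ** transpose (transpose M)) *v x) \<ge> 0" for x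
    unfolding quadratic_form_transpose using coerciveD(3)[OF assms] by simp
  then show ?thesis
    using coerciveD(2)[OF assms]
    by (simp add: coercive_def symmetric_mat_def matrix_transpose_mul matrix_mul_assoc)
qed

text \<open>One factor \<open>X\<close> is replaced by \<open>k I\<close> at a time; each
  replacement costs a trace of a product of two positive semidefinite matrices. \<open>M\<close>
  ranges over all matrices because the closure operator will be inverted on all of them.\<close>

lemma inner_conjugate_ge:
  assumes X: "coercive k X" and k: "k \<ge> 0"
  shows "k\<^sup>2 * (M \<bullet> M) \<le> M \<bullet> (X ** M ** X)"
proof -
  have X0: "coercive 0 X" using coercive_mono[OF X k] .
  note t = coerciveD(2)[OF X]
  have "0 \<le> trace ((transpose M ** X ** M) ** (X - k *\<^sub>R mat 1))"
    by (rule trace_mult_nonneg[OF coercive_conjugate[OF X0] coercive_diff_mat[OF X]])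
  also have "\<dots> = M \<bullet> (X ** M ** X) - k * (M \<bullet> (X ** M))"
    using trace_mult_eq_inner[of "transpose M" "X ** M ** X"] trace_mult_eq_inner[of "transpose M" "X ** M"]
    by (simp add: matrix_mult_linear_simps trace_sub trace_scaleR matrix_mul_assoc)
  finally have 1: "k * (M \<bullet> (X ** M)) \<le> M \<bullet> (X ** M ** X)" by simp
  have I: "coercive 0 (mat 1)" by (simp add: coercive_def symmetric_mat_def)
  have "0 \<le> trace (transpose M ** (X - k *\<^sub>R mat 1) ** M ** mat 1)"
    by (rule trace_mult_nonneg[OF coercive_conjugate[OF coercive_diff_mat[OF X]] I])
  also have "\<dots> = M \<bullet> (X ** M) - k * (M \<bullet> M)"
    using trace_mult_eq_inner[of "transpose M" "X ** M"] trace_mult_eq_inner[of "transpose M" M]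
    by (simp add: matrix_mult_linear_simps trace_sub trace_scaleR matrix_mul_assoc)
  finally have "k * (M \<bullet> M) \<le> M \<bullet> (X ** M)" by simp
  then have "k * (k * (M \<bullet> M)) \<le> k * (M \<bullet> (X ** M))" using k by (rule mult_left_mono)
  with 1 show ?thesis by (simp add: power2_eq_square mult.assoc)
qed

text \<open>Resolvent identity; it yields the Lipschitz constant \<open>9 / c^2\<close> of the
  inverse as well as its derivative.\<close>

lemma matrix_inv_diff:
  assumes "coercive c P" "coercive c Q" "c > 0"
  shows "matrix_inv P - matrix_inv Q = - (matrix_inv P ** (P - Q) ** matrix_inv Q)"
proof -
  have "matrix_inv P ** (P - Q) ** matrix_inv Q = (matrix_inv P ** P) ** matrix_inv Q - matrix_inv P ** (Q ** matrix_inv Q)"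
    by (simp add: matrix_mult_linear_simps matrix_mul_assoc)
  then show ?thesis
    by (simp add: matrix_inv_left[OF assms(1,3)] matrix_inv_right[OF assms(2,3)])
qed

lemma continuous_on_matrix_inv:
  assumes "c > 0" shows "continuous_on {P. coercive c P} matrix_inv"
proof (rule lipschitz_on_continuous_on[of "9 / c\<^sup>2"], rule lipschitz_onI)
  fix P Q assume "P \<in> {P. coercive c P}" "Q \<in> {P. coercive c P}"
  then have P: "coercive c P" and Q: "coercive c Q" by auto
  have "norm (matrix_inv P - matrix_inv Q) \<le> norm (matrix_inv P ** (P - Q)) * norm (matrix_inv Q)"
    unfolding matrix_inv_diff[OF P Q assms] norm_minus_cancel by (rule norm_matrix_matrix_mult_le)
  also have "\<dots> \<le> (norm (matrix_inv P) * norm (P - Q)) * norm (matrix_inv Q)"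
    by (intro mult_right_mono norm_matrix_matrix_mult_le) auto
  also have "\<dots> \<le> (3 / c * norm (P - Q)) * (3 / c)"
    using assms by (intro mult_mono norm_matrix_inv_le[OF P] norm_matrix_inv_le[OF Q]) auto
  finally show "dist (matrix_inv P) (matrix_inv Q) \<le> 9 / c\<^sup>2 * dist P Q"
    by (simp add: dist_norm power2_eq_square)
qed (use assms in auto)

lemma has_vector_derivative_matrix_inv:
  assumes c: "c > 0" and P: "\<And>u. u \<in> S \<Longrightarrow> coercive c (P u)" and t: "t \<in> S"
    and d: "(P has_vector_derivative P') (at t within S)"
  shows "((\<lambda>u. matrix_inv (P u)) has_vector_derivative
    - (matrix_inv (P t) ** P' ** matrix_inv (P t))) (at t within S)"
  unfolding has_vector_derivative_iff_quotient
proof (rule Lim_transform_eventually)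
  have Pc: "(P \<longlongrightarrow> P t) (at t within S)"
    using has_vector_derivative_continuous[OF d] by (simp add: continuous_within)
  have ev: "\<forall>\<^sub>F u in at t within S. P u \<in> {P. coercive c P}"
    using P by (auto simp: eventually_at_filter)
  have "((\<lambda>u. matrix_inv (P u)) \<longlongrightarrow> matrix_inv (P t)) (at t within S)"
    using continuous_on_tendsto_compose[OF continuous_on_matrix_inv[OF c] Pc _ ev] P[OF t] by simp
  then show "((\<lambda>u. - (matrix_inv (P u) ** ((P u - P t) /\<^sub>R (u - t)) ** matrix_inv (P t))) \<longlongrightarrow>
      - (matrix_inv (P t) ** P' ** matrix_inv (P t))) (at t within S)"
    using d unfolding has_vector_derivative_iff_quotient by (intro tendsto_intros)
  show "\<forall>\<^sub>F u in at t within S. - (matrix_inv (P u) ** ((P u - P t) /\<^sub>R (u - t)) ** matrix_inv (P t))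
      = (matrix_inv (P u) - matrix_inv (P t)) /\<^sub>R (u - t)"
    using ev by eventually_elim (simp add: matrix_inv_diff[OF _ P[OF t] c] matrix_mult_linear_simps(7,8))
qed

text \<open>Jacobi's formula. Writing \<open>P' = P t ** N\<close> turns it into a polynomial
  identity in the entries of \<open>P t\<close> and \<open>N\<close>.\<close>

lemma has_vector_derivative_det:
  fixes P :: "real \<Rightarrow> mat3"
  assumes d: "(P has_vector_derivative P') (at t within S)" and X: "P t ** X = mat 1"
  shows "((\<lambda>u. det (P u)) has_vector_derivative det (P t) * trace (X ** P')) (at t within S)"
proof -
  have c: "((\<lambda>u. P u $ i $ j) has_real_derivative P' $ i $ j) (at t within S)" for i j
    unfolding has_real_derivative_iff_has_vector_derivative
    by (intro bounded_linear.has_vector_derivative[OF bounded_linear_compose[OF bounded_linear_vec_nth bounded_linear_vec_nth] d, simplified comp_def])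
  define N where "N = X ** P'"
  have P': "P' = P t ** N" by (simp add: N_def matrix_mul_assoc X)
  have e: "P' $ i $ j = P t $ i $ 1 * N $ 1 $ j + P t $ i $ 2 * N $ 2 $ j + P t $ i $ 3 * N $ 3 $ j" for i j
    by (simp add: P' matrix_matrix_mult_def sum_3)
  have "((\<lambda>u. det (P u)) has_real_derivative det (P t) * trace N) (at t within S)"
    unfolding det_3 trace_def sum_3
    by (rule derivative_eq_intros c refl)+ (simp add: e algebra_simps)
  then show ?thesis by (simp add: has_real_derivative_iff_has_vector_derivative N_def)
qed

section \<open>The moment map and the closure operator\<close>

definition inv_sqrt_det :: "mat3 \<Rightarrow> real" where
  "inv_sqrt_det P = 1 / sqrt (det P)"

definition moment_kernel :: "mat3 \<Rightarrow> mat3" where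
  "moment_kernel P = inv_sqrt_det P *\<^sub>R matrix_inv P"

text \<open>This is \<open>- 2\<close> times the derivative of \<^const>\<open>moment_kernel\<close> at \<open>P\<close> in direction \<open>M\<close>.\<close>

definition closure_kernel :: "mat3 \<Rightarrow> mat3 \<Rightarrow> mat3" where
  "closure_kernel P M = inv_sqrt_det P *\<^sub>R
     ((matrix_inv P \<bullet> M) *\<^sub>R matrix_inv P + 2 *\<^sub>R (matrix_inv P ** M ** matrix_inv P))"

lemma inverse_sqrt_cube: "c > 0 \<Longrightarrow> 1 / sqrt (c ^ 3) = c powr (- 3 / 2)"
proof -
  assume c: "c > 0"
  have "sqrt (c ^ 3) = (c powr 3) powr (1 / 2)"
    using c by (simp add: powr_half_sqrt)
  also have "\<dots> = c powr (3 / 2)" by (simp add: powr_powr)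
  finally show ?thesis by (simp add: powr_minus_divide)
qed

lemma inv_sqrt_det_bounds:
  assumes "coercive c P" "c > 0"
  shows "0 < inv_sqrt_det P" "inv_sqrt_det P \<le> c powr (- 3 / 2)"
proof -
  have d: "c ^ 3 \<le> det P" "0 < c ^ 3" using det_ge[OF assms(1)] assms(2) by auto
  then have p: "0 < det P" by linarith
  then show "0 < inv_sqrt_det P" by (simp add: inv_sqrt_det_def)
  have "1 / sqrt (det P) \<le> 1 / sqrt (c ^ 3)"
    using d p by (intro divide_left_mono mult_pos_pos) auto
  then show "inv_sqrt_det P \<le> c powr (- 3 / 2)"
    using inverse_sqrt_cube[OF assms(2)] by (simp add: inv_sqrt_det_def)
qed

lemma inv_sqrt_det_ge:
  assumes "0 < det P" "det P \<le> r ^ 3" "r > 0"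
  shows "r powr (- 3 / 2) \<le> inv_sqrt_det P"
  unfolding inverse_sqrt_cube[OF assms(3), symmetric] inv_sqrt_det_def
  using assms by (intro divide_left_mono mult_pos_pos) auto

lemma has_vector_derivative_inv_sqrt_det:
  assumes c: "c > 0" "coercive c (P t)" and d: "(P has_vector_derivative P') (at t within S)"
  shows "((\<lambda>u. inv_sqrt_det (P u)) has_vector_derivative
      - (1 / 2) * inv_sqrt_det (P t) * (matrix_inv (P t) \<bullet> P')) (at t within S)"
proof -
  have p: "det (P t) > 0" using det_ge[OF c(2)] c(1) by (smt (verit) zero_less_power)
  have "((\<lambda>u. det (P u)) has_real_derivative det (P t) * (matrix_inv (P t) \<bullet> P')) (at t within S)"
    using has_vector_derivative_det[OF d matrix_inv_right[OF c(2,1)]]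
    by (simp add: has_real_derivative_iff_has_vector_derivative trace_mult_eq_inner transpose_matrix_inv[OF c(2,1)])
  then have "((\<lambda>u. inverse (sqrt (det (P u)))) has_real_derivative
      - (inverse (sqrt (det (P t))) * ((inverse (sqrt (det (P t))) / 2) * (det (P t) * (matrix_inv (P t) \<bullet> P')))
        * inverse (sqrt (det (P t))))) (at t within S)"
    using p by (intro DERIV_inverse' DERIV_chain2[OF DERIV_real_sqrt]) auto
  also have "- (inverse (sqrt (det (P t))) * ((inverse (sqrt (det (P t))) / 2) * (det (P t) * (matrix_inv (P t) \<bullet> P')))
        * inverse (sqrt (det (P t)))) = - (1 / 2) * inv_sqrt_det (P t) * (matrix_inv (P t) \<bullet> P')"
    using p by (simp add: inv_sqrt_det_def field_simps)
  finally show ?thesis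
    unfolding inv_sqrt_det_def has_real_derivative_iff_has_vector_derivative by (simp add: inverse_eq_divide)
qed

lemma has_vector_derivative_moment_kernel:
  assumes c: "c > 0" and P: "\<And>u. u \<in> S \<Longrightarrow> coercive c (P u)" and t: "t \<in> S"
    and d: "(P has_vector_derivative P') (at t within S)"
  shows "((\<lambda>u. moment_kernel (P u)) has_vector_derivative - (1 / 2) *\<^sub>R closure_kernel (P t) P') (at t within S)"
proof -
  have "((\<lambda>u. inv_sqrt_det (P u) *\<^sub>R matrix_inv (P u)) has_vector_derivative
     inv_sqrt_det (P t) *\<^sub>R (- (matrix_inv (P t) ** P' ** matrix_inv (P t)))
     + (- (1 / 2) * inv_sqrt_det (P t) * (matrix_inv (P t) \<bullet> P')) *\<^sub>R matrix_inv (P t)) (at t within S)"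
    using has_vector_derivative_inv_sqrt_det[OF c P[OF t] d]
    by (intro has_vector_derivative_scaleR has_vector_derivative_matrix_inv[OF c P t d])
       (simp_all add: has_real_derivative_iff_has_vector_derivative)
  moreover have "inv_sqrt_det (P t) *\<^sub>R (- (matrix_inv (P t) ** P' ** matrix_inv (P t)))
     + (- (1 / 2) * inv_sqrt_det (P t) * (matrix_inv (P t) \<bullet> P')) *\<^sub>R matrix_inv (P t)
     = - (1 / 2) *\<^sub>R closure_kernel (P t) P'"
    by (simp add: closure_kernel_def scaleR_add_right scaleR_diff_right)
  ultimately show ?thesis by (simp add: moment_kernel_def)
qed

lemma continuous_on_det: "continuous_on S (det :: mat3 \<Rightarrow> real)"
  unfolding det_3 by (intro continuous_intros)

lemma continuous_on_inv_sqrt_det: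
  assumes "c > 0" shows "continuous_on {P. coercive c P} inv_sqrt_det"
proof -
  have "sqrt (det P) \<noteq> 0" if "coercive c P" for P
    using det_ge[OF that] assms by (smt (verit) real_sqrt_eq_zero_cancel_iff zero_less_power)
  then show ?thesis
    unfolding inv_sqrt_det_def
    by (intro continuous_on_divide continuous_on_const continuous_on_real_sqrt continuous_on_det) auto
qed

lemma continuous_on_moment_kernel:
  assumes "c > 0" shows "continuous_on {P. coercive c P} moment_kernel"
  unfolding moment_kernel_def
  by (intro continuous_on_scaleR continuous_on_inv_sqrt_det continuous_on_matrix_inv assms)

lemma continuous_on_closure_kernel:
  assumes "c > 0" shows "continuous_on {P. coercive c P} (\<lambda>P. closure_kernel P M)"
  unfolding closure_kernel_def
  by (intro continuous_intros continuous_on_inv_sqrt_det continuous_on_matrix_inv assms)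

lemma powr_div_power:
  "c > 0 \<Longrightarrow> c powr a / c = c powr (a - 1)" "c > 0 \<Longrightarrow> c powr a / c\<^sup>2 = c powr (a - 2)"
  for c :: real
  by (simp_all add: powr_diff)

lemma norm_moment_kernel_le:
  assumes "coercive c P" "c > 0" shows "norm (moment_kernel P) \<le> 3 * c powr (- 5 / 2)"
proof -
  have "norm (moment_kernel P) \<le> c powr (- 3 / 2) * (3 / c)"
    unfolding moment_kernel_def norm_scaleR
    using inv_sqrt_det_bounds[OF assms] norm_matrix_inv_le[OF assms] by (intro mult_mono) auto
  also have "\<dots> = 3 * (c powr (- 3 / 2) / c)" by simp
  also have "\<dots> = 3 * c powr (- 5 / 2)"
    using powr_div_power(1)[OF assms(2), of "- 3 / 2"] by simp
  finally show ?thesis .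
qed

lemma norm_closure_kernel_le:
  assumes "coercive c P" "c > 0" shows "norm (closure_kernel P M) \<le> 27 * norm M * c powr (- 7 / 2)"
proof -
  let ?X = "matrix_inv P"
  have X: "norm ?X \<le> 3 / c" by (rule norm_matrix_inv_le[OF assms])
  have XX: "norm ?X * norm ?X \<le> (3 / c) * (3 / c)"
    using X assms(2) by (intro mult_mono) auto
  have "norm ((?X \<bullet> M) *\<^sub>R ?X + 2 *\<^sub>R (?X ** M ** ?X)) \<le> norm ((?X \<bullet> M) *\<^sub>R ?X) + norm (2 *\<^sub>R (?X ** M ** ?X))"
    by (rule norm_triangle_ineq)
  also have "norm ((?X \<bullet> M) *\<^sub>R ?X) \<le> (norm ?X * norm M) * norm ?X"
    by (simp add: Cauchy_Schwarz_ineq2 mult_right_mono)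
  also have "norm (2 *\<^sub>R (?X ** M ** ?X)) \<le> 2 * ((norm ?X * norm M) * norm ?X)"
    using norm_matrix_matrix_mult_le[of "?X ** M" ?X] mult_right_mono[OF norm_matrix_matrix_mult_le[of ?X M], of "norm ?X"]
    by simp
  also have "norm ?X * norm M * norm ?X + 2 * (norm ?X * norm M * norm ?X) = 3 * norm M * (norm ?X * norm ?X)"
    by simp
  also have "\<dots> \<le> 3 * norm M * ((3 / c) * (3 / c))"
    using XX by (intro mult_left_mono) auto
  finally have "norm (closure_kernel P M) \<le> c powr (- 3 / 2) * (3 * norm M * ((3 / c) * (3 / c)))"
    unfolding closure_kernel_def norm_scaleR
    using inv_sqrt_det_bounds[OF assms] by (intro mult_mono) auto
  also have "\<dots> = 27 * norm M * (c powr (- 3 / 2) / c\<^sup>2)" by (simp add: power2_eq_square)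
  also have "\<dots> = 27 * norm M * c powr (- 7 / 2)"
    using powr_div_power(2)[OF assms(2), of "- 3 / 2"] by simp
  finally show ?thesis .
qed

section \<open>Integration of kernels along the shift \<open>B + s I\<close>\<close>

lemma integrable_shifted_powr:
  "d > 0 \<Longrightarrow> e < -1 \<Longrightarrow> (\<lambda>s. K * (d + s) powr e) integrable_on {0..}" for d e K :: real
  using has_integral_mult_right[OF has_integral_shifted_powr_to_inf, of d e K] by blast

context
  fixes G :: "mat3 \<Rightarrow> 'a::euclidean_space" and K e :: real
  assumes cont: "\<And>c. c > 0 \<Longrightarrow> continuous_on {P. coercive c P} G"
    and bound: "\<And>c P. c > 0 \<Longrightarrow> coercive c P \<Longrightarrow> norm (G P) \<le> K * c powr e"
    and e: "e < -1"
begin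

text \<open>The majorant \<open>K * (\<delta> + s) powr e\<close> is finite at \<open>s = 0\<close>
  because \<open>\<delta> > 0\<close> and integrable at infinity because \<open>e < -1\<close>. It
  involves \<open>B\<close> only through \<open>\<delta>\<close>, so it also dominates along
  sequences of \<open>\<delta>\<close>-coercive matrices, which gives continuity in
  \<open>B\<close>.\<close>

lemma resolvent_integrable:
  assumes "coercive \<delta> B" "\<delta> > 0"
  shows "(\<lambda>s. G (B + s *\<^sub>R mat 1)) integrable_on {0..}"
proof (rule continuous_dominated_integrable)
  show "continuous_on {0..} (\<lambda>s. G (B + s *\<^sub>R mat 1))"
    by (rule continuous_on_compose2[OF cont[OF assms(2)]])
       (use coercive_mono[OF coercive_shift[OF assms(1)]] in \<open>auto intro!: continuous_intros\<close>)
  show "norm (G (B + s *\<^sub>R mat 1)) \<le> K * (\<delta> + s) powr e" if "s \<ge> 0" for s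
    by (rule bound[OF _ coercive_shift[OF assms(1)]]) (use assms that in auto)
qed (rule integrable_shifted_powr[OF assms(2) e])

lemma resolvent_integral_continuous:
  assumes "\<delta> > 0"
  shows "continuous_on {B. coercive \<delta> B} (\<lambda>B. integral {0..} (\<lambda>s. G (B + s *\<^sub>R mat 1)))"
  unfolding continuous_on_sequentially comp_def
proof (intro allI ballI impI, elim conjE)
  fix X B assume B: "B \<in> {B. coercive \<delta> B}" and X: "\<forall>n. X n \<in> {B. coercive \<delta> B}" and lim: "X \<longlonglongrightarrow> B"
  show "(\<lambda>n. integral {0..} (\<lambda>s. G (X n + s *\<^sub>R mat 1))) \<longlonglongrightarrow> integral {0..} (\<lambda>s. G (B + s *\<^sub>R mat 1))"
  proof (rule dominated_convergence(2)[OF _ integrable_shifted_powr[OF assms e, of K]])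
    show "(\<lambda>s. G (X n + s *\<^sub>R mat 1)) integrable_on {0..}" for n
      by (rule resolvent_integrable[OF _ assms]) (use X in auto)
    show "norm (G (X n + s *\<^sub>R mat 1)) \<le> K * (\<delta> + s) powr e" if "s \<in> {0..}" for n s
      by (rule bound[OF _ coercive_shift]) (use assms that X in auto)
    show "(\<lambda>n. G (X n + s *\<^sub>R mat 1)) \<longlonglongrightarrow> G (B + s *\<^sub>R mat 1)" if "s \<in> {0..}" for s
    proof (rule continuous_on_tendsto_compose[OF cont[OF assms]])
      show "(\<lambda>n. X n + s *\<^sub>R mat 1) \<longlonglongrightarrow> B + s *\<^sub>R mat 1" by (intro tendsto_intros lim)
      show "B + s *\<^sub>R mat 1 \<in> {P. coercive \<delta> P}"
        using coercive_mono[OF coercive_shift] B that by auto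
      show "\<forall>\<^sub>F n in sequentially. X n + s *\<^sub>R mat 1 \<in> {P. coercive \<delta> P}"
      proof (intro always_eventually allI)
        fix n
        have "coercive (\<delta> + s) (X n + s *\<^sub>R mat 1)" using X by (intro coercive_shift) auto
        then show "X n + s *\<^sub>R mat 1 \<in> {P. coercive \<delta> P}" using that coercive_mono by auto
      qed
    qed
  qed
qed

end

lemmas moment_kernel_integrable =
  resolvent_integrable[OF continuous_on_moment_kernel norm_moment_kernel_le[rotated], simplified]
lemmas closure_kernel_integrable =
  resolvent_integrable[OF continuous_on_closure_kernel norm_closure_kernel_le[rotated], simplified]

text \<open>The factor 1/4 is 3/4 from \<open>Ctens\<close> times 1/3 from the average over the
  three pairings of four indices. It is also the 1/2 of \<open>Amap\<close> times the 1/2 in the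
  derivative of \<open>moment_kernel\<close>; this agreement makes \<open>closure_op B\<close> minus
  the derivative of \<open>Amap\<close>.\<close>

definition closure_op :: "mat3 \<Rightarrow> mat3 \<Rightarrow> mat3" where
  "closure_op B M = (1 / 4) *\<^sub>R integral {0..} (\<lambda>s. closure_kernel (B + s *\<^sub>R mat 1) M)"

lemma Amap_eq: "Amap B = (1 / 2) *\<^sub>R integral {0..} (\<lambda>s. moment_kernel (B + s *\<^sub>R mat 1))"
  by (simp add: Amap_def moment_kernel_def inv_sqrt_det_def)

lemma continuous_on_Amap: "\<delta> > 0 \<Longrightarrow> continuous_on {B. coercive \<delta> B} Amap"
  unfolding Amap_eq
  by (intro continuous_on_scaleR continuous_on_const
      resolvent_integral_continuous[OF continuous_on_moment_kernel norm_moment_kernel_le[rotated]]) auto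

lemma continuous_on_closure_op: "\<delta> > 0 \<Longrightarrow> continuous_on {B. coercive \<delta> B} (\<lambda>B. closure_op B M)"
  unfolding closure_op_def
  by (intro continuous_on_scaleR continuous_on_const
      resolvent_integral_continuous[OF continuous_on_closure_kernel norm_closure_kernel_le[rotated]]) auto

theorem has_vector_derivative_Amap:
  assumes \<delta>: "\<delta> > 0" and B: "\<And>u. u \<in> {a..b} \<Longrightarrow> coercive \<delta> (B u)"
    and d: "\<And>u. u \<in> {a..b} \<Longrightarrow> (B has_vector_derivative B' u) (at u within {a..b})"
    and N: "\<And>u. u \<in> {a..b} \<Longrightarrow> norm (B' u) \<le> N" and t: "t \<in> {a..b}"
  shows "((\<lambda>u. Amap (B u)) has_vector_derivative - closure_op (B t) (B' t)) (at t within {a..b})"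
proof -
  have "((\<lambda>u. integral {0..} (\<lambda>s. moment_kernel (B u + s *\<^sub>R mat 1))) has_vector_derivative
      integral {0..} (\<lambda>s. - (1 / 2) *\<^sub>R closure_kernel (B t + s *\<^sub>R mat 1) (B' t))) (at t within {a..b})"
  proof (rule leibniz_dominated[where h = "\<lambda>s. 14 * N * (\<delta> + s) powr (- 7 / 2)" and
      f' = "\<lambda>u s. - (1 / 2) *\<^sub>R closure_kernel (B u + s *\<^sub>R mat 1) (B' u)"])
    fix s u :: real assume s: "s \<in> {0..}" and u: "u \<in> {a..b}"
    have cs: "coercive (\<delta> + s) (B v + s *\<^sub>R mat 1)" if "v \<in> {a..b}" for v
      by (rule coercive_shift[OF B[OF that]])
    have ds: "\<delta> + s > 0" using \<delta> s by auto
    have "((\<lambda>u. B u + s *\<^sub>R mat 1) has_vector_derivative (B' u + 0)) (at u within {a..b})"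
      by (intro has_vector_derivative_add d u has_vector_derivative_const)
    then show "((\<lambda>u. moment_kernel (B u + s *\<^sub>R mat 1)) has_vector_derivative
        - (1 / 2) *\<^sub>R closure_kernel (B u + s *\<^sub>R mat 1) (B' u)) (at u within {a..b})"
      using has_vector_derivative_moment_kernel[OF ds cs u] by simp
    have "norm (closure_kernel (B u + s *\<^sub>R mat 1) (B' u)) \<le> 27 * norm (B' u) * (\<delta> + s) powr (- 7 / 2)"
      by (rule norm_closure_kernel_le[OF cs[OF u] ds])
    \<comment> \<open>27 is rounded up to 28 so that half of it is the integer 14 in the
      majorant.\<close>
    also have "\<dots> \<le> 28 * N * (\<delta> + s) powr (- 7 / 2)"
      using N[OF u] norm_ge_zero[of "B' u"] by (intro mult_right_mono) (linarith, simp)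
    finally show "norm (- (1 / 2) *\<^sub>R closure_kernel (B u + s *\<^sub>R mat 1) (B' u)) \<le> 14 * N * (\<delta> + s) powr (- 7 / 2)"
      by simp
  next
    show "(\<lambda>s. 14 * N * (\<delta> + s) powr (- 7 / 2)) integrable_on {0..}"
      by (rule integrable_shifted_powr[OF \<delta>]) simp
    show "(\<lambda>s. moment_kernel (B u + s *\<^sub>R mat 1)) integrable_on {0..}" if "u \<in> {a..b}" for u
      by (rule moment_kernel_integrable[OF B[OF that] \<delta>])
  qed (rule t)
  then have "((\<lambda>u. (1 / 2) *\<^sub>R integral {0..} (\<lambda>s. moment_kernel (B u + s *\<^sub>R mat 1))) has_vector_derivative
      (1 / 2) *\<^sub>R integral {0..} (\<lambda>s. - (1 / 2) *\<^sub>R closure_kernel (B t + s *\<^sub>R mat 1) (B' t))) (at t within {a..b})"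
    by (rule bounded_linear.has_vector_derivative[OF bounded_linear_scaleR_right])
  then show ?thesis
    unfolding Amap_eq closure_op_def integral_cmul by simp
qed

lemma linear_closure_op:
  assumes "coercive \<delta> B" "\<delta> > 0" shows "linear (closure_op B)"
proof
  note I = closure_kernel_integrable[OF assms]
  show "closure_op B (M + N) = closure_op B M + closure_op B N" for M N
  proof -
    have "closure_kernel P (M + N) = closure_kernel P M + closure_kernel P N" for P
      by (simp add: closure_kernel_def matrix_mult_linear_simps inner_add_right algebra_simps)
    then show ?thesis by (simp add: closure_op_def integral_add I scaleR_add_right)
  qed
  show "closure_op B (r *\<^sub>R M) = r *\<^sub>R closure_op B M" for r M
  proof -
    have "closure_kernel P (r *\<^sub>R M) = r *\<^sub>R closure_kernel P M" for P
      by (simp add: closure_kernel_def matrix_mult_linear_simps algebra_simps)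
    then show ?thesis by (simp add: closure_op_def)
  qed
qed

lemma integral_bounded_linear:
  fixes f :: "real \<Rightarrow> 'a::euclidean_space" and h :: "'a \<Rightarrow> 'b::euclidean_space"
  assumes "f integrable_on S" "bounded_linear h"
  shows "h (integral S f) = integral S (\<lambda>s. h (f s))"
  using integral_linear[OF assms] by (simp add: comp_def)

lemma transpose_closure_op:
  assumes "coercive \<delta> B" "\<delta> > 0"
  shows "transpose (closure_op B M) = closure_op B (transpose M)"
proof -
  have "transpose (closure_kernel (B + s *\<^sub>R mat 1) M) = closure_kernel (B + s *\<^sub>R mat 1) (transpose M)"
    if "s \<ge> 0" for s
  proof -
    have "transpose (matrix_inv (B + s *\<^sub>R mat 1)) = matrix_inv (B + s *\<^sub>R mat 1)"
      using assms that by (intro transpose_matrix_inv[OF coercive_shift[OF assms(1)]]) auto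
    then show ?thesis
      using inner_transpose[of "matrix_inv (B + s *\<^sub>R mat 1)" M]
      by (simp add: closure_kernel_def transpose_add transpose_scalar matrix_transpose_mul matrix_mul_assoc)
  qed
  then have "integral {0..} (\<lambda>s. transpose (closure_kernel (B + s *\<^sub>R mat 1) M))
      = integral {0..} (\<lambda>s. closure_kernel (B + s *\<^sub>R mat 1) (transpose M))"
    by (intro integral_cong) auto
  then show ?thesis
    unfolding closure_op_def transpose_scalar
    by (subst integral_bounded_linear[OF closure_kernel_integrable[OF assms] bounded_linear_transpose]) simp
qed

lemma inner_shift_le:
  assumes "coercive 0 B" "trace B \<le> R"
  shows "x \<bullet> ((B + s *\<^sub>R mat 1) *v x) \<le> (R + s) * (x \<bullet> x)"
proof -
  have "x \<bullet> (B *v x) \<le> R * (x \<bullet> x)"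
    using quadratic_form_le_trace[OF assms(1), of x] mult_right_mono[OF assms(2), of "x \<bullet> x"] by simp
  then show ?thesis
    by (simp add: matrix_vector_mult_add_rdistrib scaleR_matrix_vector_assoc[symmetric] algebra_simps)
qed

lemma trace_pos:
  assumes "coercive \<delta> B" "\<delta> > 0" shows "trace B > 0"
  using coerciveD(3)[OF assms(1), of "axis 1 1"]
    quadratic_form_le_trace[OF coercive_mono[OF assms(1)], of "axis 1 1"] assms(2)
  by (simp add: inner_axis_axis)

text \<open>The trace dominates the largest eigenvalue of \<open>B\<close>, hence bounds
  \<open>B + s I\<close> from above; its inverse and the inverse root of its determinant are then
  bounded from below.\<close>

lemma resolvent_coercive:
  assumes "coercive \<delta> B" "\<delta> > 0" "trace B \<le> R" "s \<ge> 0"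
  shows "coercive (1 / (R + s)) (matrix_inv (B + s *\<^sub>R mat 1))"
    and "(R + s) powr (- 3 / 2) \<le> inv_sqrt_det (B + s *\<^sub>R mat 1)"
proof -
  have B0: "coercive 0 B" using coercive_mono[OF assms(1)] assms(2) by simp
  have Rs: "R + s > 0" "\<delta> + s > 0" using trace_pos[OF assms(1,2)] assms by auto
  show "coercive (1 / (R + s)) (matrix_inv (B + s *\<^sub>R mat 1))"
    by (rule matrix_inv_coercive[OF coercive_shift[OF assms(1)] Rs(2) inner_shift_le[OF B0 assms(3)] Rs(1)])
  have "0 < det (B + s *\<^sub>R mat 1)"
    using det_shift_ge[OF assms(1), of s] Rs(2) by (smt (verit) zero_less_power)
  then show "(R + s) powr (- 3 / 2) \<le> inv_sqrt_det (B + s *\<^sub>R mat 1)"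
    using det_shift_le[OF B0 assms(3,4)] Rs(1) by (rule inv_sqrt_det_ge)
qed

text \<open>The square of \<open>X \<bullet> M\<close> is dropped and
  \<open>M \<bullet> (X M X)\<close> is bounded by \<open>inner_conjugate_ge\<close>. The constant
  1/5 is 1/4 times 2 times 2/5, the last from integrating the power -7/2. As the bound involves
  \<open>R\<close> and not \<open>\<delta>\<close>, it controls the inverse operator uniformly where
  the trace is bounded.\<close>

lemma closure_op_coercive:
  assumes "coercive \<delta> B" "\<delta> > 0" "trace B \<le> R"
  shows "R powr (- 5 / 2) / 5 * (M \<bullet> M) \<le> M \<bullet> closure_op B M"
proof -
  have R: "R > 0" using trace_pos[OF assms(1,2)] assms(3) by simp
  have le: "2 * (M \<bullet> M) * (R + s) powr (- 7 / 2) \<le> M \<bullet> closure_kernel (B + s *\<^sub>R mat 1) M"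
    if s: "s \<in> {0..}" for s
  proof -
    let ?X = "matrix_inv (B + s *\<^sub>R mat 1)" and ?w = "inv_sqrt_det (B + s *\<^sub>R mat 1)"
    have s0: "s \<ge> 0" using s by simp
    note rc = resolvent_coercive[OF assms s0]
    have "(1 / (R + s))\<^sup>2 * (M \<bullet> M) \<le> M \<bullet> (?X ** M ** ?X)"
      using R s by (intro inner_conjugate_ge[OF rc(1)]) auto
    then have "2 * ((1 / (R + s))\<^sup>2 * (M \<bullet> M)) \<le> (?X \<bullet> M) * (M \<bullet> ?X) + 2 * (M \<bullet> (?X ** M ** ?X))"
      using zero_le_square[of "M \<bullet> ?X"] by (simp add: inner_commute del: zero_le_square)
    then have "(R + s) powr (- 3 / 2) * (2 * ((1 / (R + s))\<^sup>2 * (M \<bullet> M)))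
        \<le> ?w * ((?X \<bullet> M) * (M \<bullet> ?X) + 2 * (M \<bullet> (?X ** M ** ?X)))"
      by (intro mult_mono rc(2)) (auto intro: order_trans[OF powr_ge_zero rc(2)])
    also have "\<dots> = M \<bullet> closure_kernel (B + s *\<^sub>R mat 1) M"
      by (simp add: closure_kernel_def inner_add_right)
    also have "(R + s) powr (- 3 / 2) * (2 * ((1 / (R + s))\<^sup>2 * (M \<bullet> M)))
        = 2 * (M \<bullet> M) * ((R + s) powr (- 3 / 2) / (R + s)\<^sup>2)"
      by (simp add: power_divide)
    also have "\<dots> = 2 * (M \<bullet> M) * (R + s) powr (- 7 / 2)"
      using powr_div_power(2)[of "R + s" "- 3 / 2"] R s by simp
    finally show ?thesis .
  qed
  have i1: "((\<lambda>s. 2 * (M \<bullet> M) * (R + s) powr (- 7 / 2)) has_integral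
      2 * (M \<bullet> M) * (R powr (- 7 / 2 + 1) / (- (- 7 / 2) - 1))) {0..}"
    by (intro has_integral_mult_right has_integral_shifted_powr_to_inf R) simp
  have "2 * (M \<bullet> M) * (R powr (- 7 / 2 + 1) / (- (- 7 / 2) - 1))
      \<le> integral {0..} (\<lambda>s. M \<bullet> closure_kernel (B + s *\<^sub>R mat 1) M)"
    using integral_linear[OF closure_kernel_integrable[OF assms(1,2)] bounded_linear_inner_right[of M]]
      integrable_linear[OF closure_kernel_integrable[OF assms(1,2)] bounded_linear_inner_right[of M]]
    by (intro has_integral_le[OF i1 integrable_integral] le) (auto simp: comp_def)
  also have "\<dots> = M \<bullet> integral {0..} (\<lambda>s. closure_kernel (B + s *\<^sub>R mat 1) M)"
    by (rule integral_bounded_linear[OF closure_kernel_integrable[OF assms(1,2)] bounded_linear_inner_right, symmetric])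
  finally show ?thesis by (simp add: closure_op_def mult_ac)
qed

lemma coercive_Amap:
  assumes "coercive \<delta> B" "\<delta> > 0" shows "\<exists>c>0. coercive c (Amap B)"
proof (intro exI conjI)
  define R where "R = trace B"
  have R: "R > 0" using trace_pos[OF assms] by (simp add: R_def)
  note I = moment_kernel_integrable[OF assms]
  \<comment> \<open>Half of \<open>R powr (- 3 / 2) / (3 / 2)\<close>, the integral of
    \<open>(R + s) powr (- 5 / 2)\<close>.\<close>
  let ?c = "R powr (- 3 / 2) / 3"
  show "?c > 0" using R by simp
  have t: "transpose (Amap B) = Amap B"
  proof -
    have "integral {0..} (\<lambda>s. transpose (moment_kernel (B + s *\<^sub>R mat 1))) = integral {0..} (\<lambda>s. moment_kernel (B + s *\<^sub>R mat 1))"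
      using assms(2)
      by (intro integral_cong) (simp add: moment_kernel_def transpose_scalar transpose_matrix_inv[OF coercive_shift[OF assms(1)]])
    then show ?thesis
      unfolding Amap_eq transpose_scalar by (subst integral_bounded_linear[OF I bounded_linear_transpose]) simp
  qed
  have "?c * (x \<bullet> x) \<le> x \<bullet> (Amap B *v x)" for x
  proof -
    have bl: "bounded_linear (\<lambda>A. x \<bullet> (A *v x))"
      by (rule bounded_linear_compose[OF bounded_linear_inner_right bounded_linear_matrix_apply])
    have le: "(x \<bullet> x) * (R + s) powr (- 5 / 2) \<le> x \<bullet> (moment_kernel (B + s *\<^sub>R mat 1) *v x)"
      if s: "s \<in> {0..}" for s
    proof -
      have s0: "s \<ge> 0" using s by simp
      note rc = resolvent_coercive[OF assms order_refl s0, folded R_def]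
      have "(R + s) powr (- 3 / 2) * (1 / (R + s) * (x \<bullet> x))
         \<le> inv_sqrt_det (B + s *\<^sub>R mat 1) * (x \<bullet> (matrix_inv (B + s *\<^sub>R mat 1) *v x))"
        using R s0 by (intro mult_mono rc(2) coerciveD(3)[OF rc(1)]) (auto intro: order_trans[OF powr_ge_zero rc(2)])
      also have "\<dots> = x \<bullet> (moment_kernel (B + s *\<^sub>R mat 1) *v x)"
        by (simp add: moment_kernel_def scaleR_matrix_vector_assoc[symmetric])
      also have "(R + s) powr (- 3 / 2) * (1 / (R + s) * (x \<bullet> x)) = (x \<bullet> x) * ((R + s) powr (- 3 / 2) / (R + s))"
        by simp
      also have "\<dots> = (x \<bullet> x) * (R + s) powr (- 5 / 2)"
        using powr_div_power(1)[of "R + s" "- 3 / 2"] R s0 by simp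
      finally show ?thesis .
    qed
    have i1: "((\<lambda>s. (x \<bullet> x) * (R + s) powr (- 5 / 2)) has_integral
        (x \<bullet> x) * (R powr (- 5 / 2 + 1) / (- (- 5 / 2) - 1))) {0..}"
      by (intro has_integral_mult_right has_integral_shifted_powr_to_inf R) simp
    have "(x \<bullet> x) * (R powr (- 5 / 2 + 1) / (- (- 5 / 2) - 1))
        \<le> integral {0..} (\<lambda>s. x \<bullet> (moment_kernel (B + s *\<^sub>R mat 1) *v x))"
      using integrable_linear[OF I bl] by (intro has_integral_le[OF i1 integrable_integral] le) (auto simp: comp_def)
    also have "\<dots> = x \<bullet> (integral {0..} (\<lambda>s. moment_kernel (B + s *\<^sub>R mat 1)) *v x)"
      by (rule integral_bounded_linear[OF I bl, symmetric])
    finally show ?thesis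
      by (simp add: Amap_eq scaleR_matrix_vector_assoc[symmetric] mult.commute)
  qed
  then show "coercive ?c (Amap B)" using t by (simp add: coercive_def symmetric_mat_def)
qed

section \<open>The closure tensors\<close>

lemma shift_derivative:
  "((\<lambda>s. B + s *\<^sub>R mat 1) has_vector_derivative (mat 1 :: mat3)) (at s within S)"
  unfolding has_vector_derivative_def by (auto intro!: derivative_eq_intros)

lemma shifted_powr_tendsto_0:
  fixes d e K :: real
  assumes "e < 0" shows "((\<lambda>s. K * (d + s) powr e) \<longlongrightarrow> 0) at_top"
  by (intro tendsto_mult_right_zero tendsto_neg_powr[OF assms]
      filterlim_tendsto_add_at_top[OF tendsto_const filterlim_ident])

lemma trace_Amap:
  assumes B: "coercive \<delta> B" and \<delta>: "\<delta> > 0" shows "trace (Amap B) = inv_sqrt_det B"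
proof -
  let ?P = "\<lambda>s. B + s *\<^sub>R mat 1"
  have c: "coercive (\<delta> + s) (?P s)" "\<delta> + s > 0" if "s \<ge> 0" for s
    using coercive_shift[OF B] \<delta> that by auto
  have "((\<lambda>s. trace (moment_kernel (?P s))) has_integral (0 - (- 2 * inv_sqrt_det (?P 0)))) {0..}"
  proof (rule has_integral_FTC_to_inf[where h = "\<lambda>s. norm (mat 1 :: mat3) * 3 * (\<delta> + s) powr (- 5 / 2)"])
    fix s :: real assume s: "s \<ge> 0"
    have "((\<lambda>s. - 2 * inv_sqrt_det (?P s)) has_vector_derivative
        - 2 * (- (1 / 2) * inv_sqrt_det (?P s) * (matrix_inv (?P s) \<bullet> mat 1))) (at s within {0..})"
      by (rule has_vector_derivative_mult_right, rule has_vector_derivative_inv_sqrt_det[where P = ?P, OF c(2,1)[OF s] shift_derivative])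
    then show "((\<lambda>s. - 2 * inv_sqrt_det (?P s)) has_vector_derivative trace (moment_kernel (?P s))) (at s within {0..})"
      by (simp add: trace_eq_inner moment_kernel_def inner_commute)
    have "norm (trace (moment_kernel (?P s))) \<le> norm (mat 1 :: mat3) * norm (moment_kernel (?P s))"
      by (simp add: trace_eq_inner Cauchy_Schwarz_ineq2)
    also have "\<dots> \<le> norm (mat 1 :: mat3) * (3 * (\<delta> + s) powr (- 5 / 2))"
      by (intro mult_left_mono norm_moment_kernel_le c s) auto
    finally show "norm (trace (moment_kernel (?P s))) \<le> norm (mat 1 :: mat3) * 3 * (\<delta> + s) powr (- 5 / 2)"
      by simp
  next
    show "((\<lambda>s. - 2 * inv_sqrt_det (?P s)) \<longlongrightarrow> 0) at_top"
    proof (rule Lim_null_comparison[OF _ shifted_powr_tendsto_0[of "- 3 / 2" 2 \<delta>]])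
      show "\<forall>\<^sub>F s in at_top. norm (- 2 * inv_sqrt_det (?P s)) \<le> 2 * (\<delta> + s) powr (- 3 / 2)"
        using eventually_ge_at_top[of 0]
      proof eventually_elim
        case (elim s)
        show ?case using inv_sqrt_det_bounds[OF c[OF elim]] by simp
      qed
    qed simp
  qed (rule integrable_shifted_powr[OF \<delta>], simp)
  then have "integral {0..} (\<lambda>s. trace (moment_kernel (?P s))) = 2 * inv_sqrt_det B"
    by (simp add: integral_unique)
  then show ?thesis
    unfolding Amap_eq trace_scaleR
    by (subst integral_bounded_linear[OF moment_kernel_integrable[OF B \<delta>] bounded_linear_trace]) simp
qed

lemma closure_kernel_self_adjoint:
  assumes "transpose (matrix_inv P) = matrix_inv P"
  shows "N \<bullet> closure_kernel P M = closure_kernel P N \<bullet> M"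
proof -
  have "N \<bullet> (matrix_inv P ** M ** matrix_inv P) = (matrix_inv P ** N ** matrix_inv P) \<bullet> M"
    unfolding inner_matrix_mult_right[of N "matrix_inv P ** M"] inner_matrix_mult_left[of _ "matrix_inv P" M]
    by (simp add: assms matrix_mul_assoc)
  then show ?thesis
    by (simp add: closure_kernel_def inner_add_left inner_add_right inner_commute)
qed

text \<open>The trace pairs \<open>closure_kernel P M\<close> with the identity. Self-adjointness
  moves the kernel onto the identity, and there it is -2 times the \<open>s\<close>-derivative of
  \<open>moment_kernel\<close>, so the integral reduces to a boundary term at
  \<open>s = 0\<close>.\<close>

lemma trace_closure_op:
  assumes B: "coercive \<delta> B" and \<delta>: "\<delta> > 0"
  shows "trace (closure_op B M) = (1 / 2) * inv_sqrt_det B * (matrix_inv B \<bullet> M)"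
proof -
  let ?P = "\<lambda>s. B + s *\<^sub>R mat 1"
  have c: "coercive (\<delta> + s) (?P s)" "\<delta> + s > 0" if "s \<ge> 0" for s
    using coercive_shift[OF B] \<delta> that by auto
  have c': "coercive \<delta> (?P s)" if "s \<in> {0..}" for s
    using coercive_mono[OF c(1)] that by auto
  have tr: "trace (closure_kernel (?P s) M) = closure_kernel (?P s) (mat 1) \<bullet> M" if "s \<ge> 0" for s
    unfolding trace_eq_inner by (rule closure_kernel_self_adjoint[OF transpose_matrix_inv[OF c[OF that]]])
  have "((\<lambda>s. trace (closure_kernel (?P s) M)) has_integral (0 - (- 2 * (moment_kernel (?P 0) \<bullet> M)))) {0..}"
  proof (rule has_integral_FTC_to_inf[where h = "\<lambda>s. norm (mat 1 :: mat3) * (27 * norm M) * (\<delta> + s) powr (- 7 / 2)"])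
    fix s :: real assume s: "s \<ge> 0"
    have "((\<lambda>s. moment_kernel (?P s)) has_vector_derivative - (1 / 2) *\<^sub>R closure_kernel (?P s) (mat 1)) (at s within {0..})"
      by (rule has_vector_derivative_moment_kernel[OF \<delta> c' _ shift_derivative]) (use s in auto)
    then have "((\<lambda>s. - 2 * (moment_kernel (?P s) \<bullet> M)) has_vector_derivative
        - 2 * ((- (1 / 2) *\<^sub>R closure_kernel (?P s) (mat 1)) \<bullet> M)) (at s within {0..})"
      by (intro has_vector_derivative_mult_right bounded_linear.has_vector_derivative[OF bounded_linear_inner_left])
    then show "((\<lambda>s. - 2 * (moment_kernel (?P s) \<bullet> M)) has_vector_derivative trace (closure_kernel (?P s) M)) (at s within {0..})"
      by (simp add: tr[OF s])
    have "norm (trace (closure_kernel (?P s) M)) \<le> norm (mat 1 :: mat3) * norm (closure_kernel (?P s) M)"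
      by (simp add: trace_eq_inner Cauchy_Schwarz_ineq2)
    also have "\<dots> \<le> norm (mat 1 :: mat3) * (27 * norm M * (\<delta> + s) powr (- 7 / 2))"
      by (intro mult_left_mono norm_closure_kernel_le c s) auto
    finally show "norm (trace (closure_kernel (?P s) M)) \<le> norm (mat 1 :: mat3) * (27 * norm M) * (\<delta> + s) powr (- 7 / 2)"
      by simp
  next
    show "((\<lambda>s. - 2 * (moment_kernel (?P s) \<bullet> M)) \<longlongrightarrow> 0) at_top"
    proof (rule Lim_null_comparison[OF _ shifted_powr_tendsto_0[of "- 5 / 2" "6 * norm M" \<delta>]])
      show "\<forall>\<^sub>F s in at_top. norm (- 2 * (moment_kernel (?P s) \<bullet> M)) \<le> 6 * norm M * (\<delta> + s) powr (- 5 / 2)"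
        using eventually_ge_at_top[of 0]
      proof eventually_elim
        case (elim s)
        have "\<bar>moment_kernel (?P s) \<bullet> M\<bar> \<le> norm (moment_kernel (?P s)) * norm M"
          by (rule Cauchy_Schwarz_ineq2)
        also have "\<dots> \<le> (3 * (\<delta> + s) powr (- 5 / 2)) * norm M"
          by (intro mult_right_mono norm_moment_kernel_le c elim) auto
        finally show ?case by (simp add: mult_ac)
      qed
    qed simp
  qed (rule integrable_shifted_powr[OF \<delta>], simp)
  then have "integral {0..} (\<lambda>s. trace (closure_kernel (?P s) M)) = 2 * (moment_kernel B \<bullet> M)"
    by (simp add: integral_unique)
  then show ?thesis
    unfolding closure_op_def trace_scaleR
    by (subst integral_bounded_linear[OF closure_kernel_integrable[OF B \<delta>] bounded_linear_trace])
       (simp add: moment_kernel_def)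
qed

section \<open>Symmetrised matrix units; rank-4 tensors as linear maps\<close>

lemma symmetric_entry: "transpose X = X \<Longrightarrow> X $ b $ a = X $ a $ b" for X :: "real^'n^'n"
proof -
  assume "transpose X = X"
  then have "X $ b $ a = transpose X $ b $ a" by simp
  then show ?thesis by (simp add: transpose_def)
qed

text \<open>These matrices translate between linear maps and tensors with symmetric index pairs:
  entry \<open>(i, j, k, l)\<close> of the tensor is entry \<open>(i, j)\<close> of the image of
  \<open>sym_unit k l\<close>. The factor 1/2 makes the sum over all ordered pairs
  \<open>(k, l)\<close> reproduce a symmetric matrix.\<close>

definition sym_unit :: "3 \<Rightarrow> 3 \<Rightarrow> mat3" where
  "sym_unit k l = (1 / 2) *\<^sub>R (\<chi> i j. (if i = k \<and> j = l then 1 else 0) + (if i = l \<and> j = k then 1 else 0))"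

lemma symmetric_sym_unit: "symmetric_mat (sym_unit k l)"
proof -
  have "(j = k \<and> i = l) = (i = l \<and> j = k)" for i j by blast
  then show ?thesis
    by (simp only: symmetric_mat_def sym_unit_def transpose_def vec_eq_iff vector_scaleR_component
        vec_lambda_beta add.commute) simp
qed

lemma sym_unit_commute: "sym_unit k l = sym_unit l k"
  by (simp only: sym_unit_def vec_eq_iff vector_scaleR_component vec_lambda_beta add.commute) simp

lemma sym_unit_swap: "sym_unit k l $ i $ j = sym_unit i j $ k $ l"
proof -
  have "(i = k \<and> j = l) = (k = i \<and> l = j)" "(i = l \<and> j = k) = (k = j \<and> l = i)" by blast+
  then show ?thesis by (simp only: sym_unit_def vector_scaleR_component vec_lambda_beta)
qed

lemma sum_sym_unit: "(\<Sum>a\<in>UNIV. \<Sum>b\<in>UNIV. f a b * sym_unit k l $ a $ b) = (f k l + f l k) / 2"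
proof -
  have delta: "(\<Sum>a\<in>UNIV. \<Sum>b\<in>UNIV. f a b * (if a = k \<and> b = l then 1 else 0)) = f k l" for k l
  proof -
    have "(\<Sum>b\<in>UNIV. f a b * (if a = k \<and> b = l then 1 else 0)) = (if a = k then f a l else 0)" for a
      by (cases "a = k") (simp_all add: if_distrib[of "\<lambda>x. _ * x"] cong: if_cong)
    then show ?thesis by simp
  qed
  have "(\<Sum>a\<in>UNIV. \<Sum>b\<in>UNIV. f a b * sym_unit k l $ a $ b)
      = (1 / 2) * ((\<Sum>a\<in>UNIV. \<Sum>b\<in>UNIV. f a b * (if a = k \<and> b = l then 1 else 0))
        + (\<Sum>a\<in>UNIV. \<Sum>b\<in>UNIV. f a b * (if a = l \<and> b = k then 1 else 0)))"
    unfolding sum.distrib[symmetric] sum_distrib_left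
    by (intro sum.cong refl) (simp add: sym_unit_def distrib_left)
  then show ?thesis unfolding delta by simp
qed

lemma symmetric_mat_eq_sum_sym_unit:
  assumes "symmetric_mat M" shows "(\<Sum>k\<in>UNIV. \<Sum>l\<in>UNIV. M $ k $ l *\<^sub>R sym_unit k l) = M"
proof -
  have "(\<Sum>k\<in>UNIV. \<Sum>l\<in>UNIV. M $ k $ l *\<^sub>R sym_unit k l) $ i $ j = M $ i $ j" for i j
  proof -
    have "(\<Sum>k\<in>UNIV. \<Sum>l\<in>UNIV. M $ k $ l *\<^sub>R sym_unit k l) $ i $ j
        = (\<Sum>k\<in>UNIV. \<Sum>l\<in>UNIV. M $ k $ l * sym_unit k l $ i $ j)" by simp
    also have "\<dots> = (\<Sum>k\<in>UNIV. \<Sum>l\<in>UNIV. M $ k $ l * sym_unit i j $ k $ l)"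
      by (simp only: sym_unit_swap[of _ _ i j])
    also have "\<dots> = (M $ i $ j + M $ j $ i) / 2" by (rule sum_sym_unit)
    also have "M $ j $ i = M $ i $ j"
      using assms by (intro symmetric_entry) (simp add: symmetric_mat_def)
    finally show ?thesis by simp
  qed
  then show ?thesis by (simp only: vec_eq_iff) blast
qed

lemma contract_linear:
  assumes "linear f" "symmetric_mat M"
  shows "contract (\<lambda>i j k l. f (sym_unit k l) $ i $ j) M = f M"
proof -
  have "f M = (\<Sum>k\<in>UNIV. \<Sum>l\<in>UNIV. M $ k $ l *\<^sub>R f (sym_unit k l))"
    by (subst symmetric_mat_eq_sum_sym_unit[OF assms(2), symmetric])
       (simp add: linear_sum[OF assms(1)] linear_scale[OF assms(1)])
  then show ?thesis by (simp add: contract_def vec_eq_iff mult.commute)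
qed

text \<open>Every permutation of four points is uniquely a product of transpositions
  \<open>(0 a)\<close>, \<open>(1 b)\<close>, \<open>(2 c)\<close> with \<open>b \<ge> 1\<close> and
  \<open>c \<ge> 2\<close>, where a pair of equal points means the identity. The 4 * 3 * 2 terms are
  explicit and can be evaluated.\<close>

lemma sum_permutations_4:
  "(\<Sum>p\<in>{p. p permutes {0::nat..<4}}. f (p 0) (p 1) (p 2) (p 3)) =
    (\<Sum>a\<in>{0,1,2,3}. \<Sum>b\<in>{1,2,3}. \<Sum>c\<in>{2,3}.
      (let t = Transposition.transpose 0 a \<circ> (Transposition.transpose 1 b \<circ> Transposition.transpose 2 c) in f (t 0) (t 1) (t 2) (t 3 :: nat)))"
proof -
  have S: "{0::nat..<4} = insert 0 (insert 1 (insert 2 {3}))" by auto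
  have f: "finite (insert 1 (insert 2 {3::nat}))" "(0::nat) \<notin> insert 1 (insert 2 {3})"
    "finite (insert 2 {3::nat})" "(1::nat) \<notin> insert 2 {3}" "finite {3::nat}" "(2::nat) \<notin> {3}" by auto
  show ?thesis
    unfolding S sum_over_permutations_insert[OF f(1,2)] sum_over_permutations_insert[OF f(3,4)]
      sum_over_permutations_insert[OF f(5,6)] permutes_sing
    by (simp add: Let_def comp_assoc)
qed

text \<open>For symmetric \<open>X\<close> the 24 permutations fall into the three ways of pairing
  four indices, eight permutations for each.\<close>

lemma sym4_outer:
  assumes "transpose X = X"
  shows "sym4 (outer X X) i j k l = (X $ i $ j * X $ k $ l + X $ i $ k * X $ j $ l + X $ i $ l * X $ j $ k) / 3"
proof -
  have s: "X $ b $ a = X $ a $ b" for a b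
    by (rule symmetric_entry[OF assms])
  have p: "sym4 T i j k l = (1 / 24) * (\<Sum>a\<in>{0,1,2,3}. \<Sum>b\<in>{1,2,3}. \<Sum>c\<in>{2,3}.
      (let t = Transposition.transpose 0 a \<circ> (Transposition.transpose 1 b \<circ> Transposition.transpose 2 c) in
       T ([i,j,k,l] ! t 0) ([i,j,k,l] ! t 1) ([i,j,k,l] ! t 2) ([i,j,k,l] ! t 3)))" for T
    unfolding sym4_def Let_def
    by (subst sum_permutations_4[of "\<lambda>a b c d. T ([i,j,k,l] ! a) ([i,j,k,l] ! b) ([i,j,k,l] ! c) ([i,j,k,l] ! d)"])
       (simp only: Let_def)
  show ?thesis
    unfolding p
    by (simp add: Let_def outer_def Transposition.transpose_def)
       (simp only: s[of j i] s[of k i] s[of l i] s[of k j] s[of l j] s[of l k], simp add: mult.commute)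
qed

text \<open>Tested on \<open>sym_unit k l\<close>, the kernel
  \<open>(X \<bullet> M) X + 2 X M X\<close> has as entry \<open>(i, j)\<close> the sum over the
  same three pairings that \<open>sym4\<close> averages.\<close>

lemma Ctens_eq:
  assumes "coercive \<delta> B" "\<delta> > 0"
  shows "Ctens B = (\<lambda>i j k l. closure_op B (sym_unit k l) $ i $ j)"
proof (intro ext)
  fix i j k l
  have bl: "bounded_linear (\<lambda>A :: mat3. A $ i $ j)"
    by (rule bounded_linear_compose[OF bounded_linear_vec_nth bounded_linear_vec_nth])
  have "integral {0..} (\<lambda>s. sym4 (outer (matrix_inv (B + s *\<^sub>R mat 1)) (matrix_inv (B + s *\<^sub>R mat 1))) i j k l
        / sqrt (det (B + s *\<^sub>R mat 1)))
      = integral {0..} (\<lambda>s. (1 / 3) * (closure_kernel (B + s *\<^sub>R mat 1) (sym_unit k l) $ i $ j))"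
  proof (rule integral_cong)
    fix s :: real assume "s \<in> {0..}"
    then have t: "transpose (matrix_inv (B + s *\<^sub>R mat 1)) = matrix_inv (B + s *\<^sub>R mat 1)"
      using assms by (intro transpose_matrix_inv[OF coercive_shift[OF assms(1)]]) auto
    define X where "X = matrix_inv (B + s *\<^sub>R mat 1)"
    have sX: "X $ b $ a = X $ a $ b" for a b
      unfolding X_def by (rule symmetric_entry[OF t])
    have 1: "X \<bullet> sym_unit k l = X $ k $ l"
      using sum_sym_unit[of "\<lambda>a b. X $ a $ b" k l] sX[of l k] by (simp add: inner_vec_def)
    have "(X ** sym_unit k l ** X) $ i $ j = (\<Sum>b\<in>UNIV. \<Sum>a\<in>UNIV. (X $ i $ a * X $ b $ j) * sym_unit k l $ a $ b)"
      by (simp add: matrix_matrix_mult_def sum_distrib_left sum_distrib_right mult_ac)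
    also have "\<dots> = (X $ i $ k * X $ l $ j + X $ i $ l * X $ k $ j) / 2"
      by (subst sum.swap) (rule sum_sym_unit)
    finally have 2: "2 * (X ** sym_unit k l ** X) $ i $ j = X $ i $ k * X $ j $ l + X $ i $ l * X $ j $ k"
      by (simp add: sX[of l j] sX[of k j])
    have "closure_kernel (B + s *\<^sub>R mat 1) (sym_unit k l) $ i $ j
        = (X $ k $ l * X $ i $ j + 2 * (X ** sym_unit k l ** X) $ i $ j) / sqrt (det (B + s *\<^sub>R mat 1))"
      by (simp add: closure_kernel_def X_def[symmetric] 1 inv_sqrt_det_def)
    then show "sym4 (outer (matrix_inv (B + s *\<^sub>R mat 1)) (matrix_inv (B + s *\<^sub>R mat 1))) i j k l
        / sqrt (det (B + s *\<^sub>R mat 1)) = (1 / 3) * (closure_kernel (B + s *\<^sub>R mat 1) (sym_unit k l) $ i $ j)"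
      unfolding sym4_outer[OF t] by (simp add: X_def[symmetric] 2 algebra_simps add_divide_distrib)
  qed
  also have "\<dots> = (1 / 3) * (integral {0..} (\<lambda>s. closure_kernel (B + s *\<^sub>R mat 1) (sym_unit k l)) $ i $ j)"
    by (simp add: integral_bounded_linear[OF closure_kernel_integrable[OF assms] bl])
  finally show "Ctens B i j k l = closure_op B (sym_unit k l) $ i $ j"
    by (simp add: Ctens_def closure_op_def)
qed

lemma contract_Ctens:
  assumes "coercive \<delta> B" "\<delta> > 0" "symmetric_mat M"
  shows "contract (Ctens B) M = closure_op B M"
  unfolding Ctens_eq[OF assms(1,2)] by (rule contract_linear[OF linear_closure_op[OF assms(1,2)] assms(3)])

lemma norm_closure_op_ge:
  assumes "coercive \<delta> B" "\<delta> > 0" "trace B \<le> R"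
  shows "R powr (- 5 / 2) / 5 * norm M \<le> norm (closure_op B M)"
proof (cases "M = 0")
  case False
  have "R powr (- 5 / 2) / 5 * (norm M * norm M) \<le> norm M * norm (closure_op B M)"
    using closure_op_coercive[OF assms, of M] norm_cauchy_schwarz[of M "closure_op B M"]
    by (simp add: power2_norm_eq_inner[symmetric] power2_eq_square)
  then have "norm M * (R powr (- 5 / 2) / 5 * norm M) \<le> norm M * norm (closure_op B M)" by (simp add: mult_ac)
  then show ?thesis using False by simp
qed simp

text \<open>The definite description in \<open>Dtens\<close> requires a unique tensor. Existence:
  \<open>closure_op B\<close> is injective, hence an isomorphism of the finite-dimensional space of
  matrices, and its inverse \<open>G\<close> supplies the entries. Uniqueness: the index symmetries
  let each entry be read off from the action on \<open>sym_unit k l\<close>.\<close>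

lemma contract_Dtens:
  assumes B: "coercive \<delta> B" "\<delta> > 0" and N: "symmetric_mat N"
  shows symmetric_contract_Dtens: "symmetric_mat (contract (Dtens B) N)"
    and closure_op_contract_Dtens: "closure_op B (contract (Dtens B) N) = N"
proof -
  let ?L = "closure_op B"
  have lin: "linear ?L" by (rule linear_closure_op[OF B])
  have "inj ?L"
    unfolding linear_injective_0[OF lin]
  proof (intro allI impI)
    fix M assume "?L M = 0"
    then have "trace B powr (- 5 / 2) / 5 * norm M \<le> 0" using norm_closure_op_ge[OF B order_refl, of M] by simp
    moreover have "trace B powr (- 5 / 2) / 5 > 0" using trace_pos[OF B] by simp
    ultimately show "M = 0" by (simp add: mult_le_0_iff)
  qed
  then obtain G where G: "linear G" "\<And>M. G (?L M) = M" "\<And>M. ?L (G M) = M"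
    using linear_injective_isomorphism[OF lin] by blast
  \<comment> \<open>\<open>closure_op B\<close> commutes with transposition, so its inverse
    preserves symmetry.\<close>
  have Gsym: "symmetric_mat (G M)" if "symmetric_mat M" for M
  proof -
    have "?L (transpose (G M)) = ?L (G M)"
      using that by (simp add: transpose_closure_op[OF B, symmetric] G(3) symmetric_mat_def)
    then show ?thesis using \<open>inj ?L\<close> by (simp add: symmetric_mat_def inj_eq)
  qed
  define Q where "Q D \<longleftrightarrow> (\<forall>i j k l. D i j k l = D j i k l \<and> D i j k l = D i j l k) \<and>
     (\<forall>M. symmetric_mat M \<longrightarrow>
        contract (Ctens B) (contract D M) = M \<and> contract D (contract (Ctens B) M) = M)" for D
  define D0 where "D0 = (\<lambda>i j k l. G (sym_unit k l) $ i $ j)"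
  have D0: "contract D0 M = G M" if "symmetric_mat M" for M
    unfolding D0_def by (rule contract_linear[OF G(1) that])
  have Lsym: "symmetric_mat (?L M)" if "symmetric_mat M" for M
    using that by (simp add: symmetric_mat_def transpose_closure_op[OF B])
  have "Q D0"
    unfolding Q_def
  proof (intro conjI allI impI)
    fix i j k l
    show "D0 i j k l = D0 j i k l"
      using Gsym[OF symmetric_sym_unit[of k l]] unfolding D0_def symmetric_mat_def
      by (rule symmetric_entry)
    show "D0 i j k l = D0 i j l k" by (simp add: D0_def sym_unit_commute[of k l])
  next
    fix M :: mat3 assume M: "symmetric_mat M"
    show "contract (Ctens B) (contract D0 M) = M"
      by (simp add: D0[OF M] contract_Ctens[OF B Gsym[OF M]] G(3))
    show "contract D0 (contract (Ctens B) M) = M"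
      by (simp add: contract_Ctens[OF B M] D0[OF Lsym[OF M]] G(2))
  qed
  moreover have "D = D0" if D: "Q D" for D
  proof (intro ext)
    fix i j k l
    have Dij: "D i j k l = D j i k l" and Dkl: "D i j k l = D i j l k" for i j k l
      using D unfolding Q_def by blast+
    have sC: "symmetric_mat (contract D M)" for M
      unfolding symmetric_mat_def contract_def transpose_def vec_eq_iff
      by (auto intro!: sum.cong simp: Dij)
    have "?L (contract D (sym_unit k l)) = sym_unit k l"
      using D symmetric_sym_unit[of k l] contract_Ctens[OF B sC] unfolding Q_def by metis
    then have "contract D (sym_unit k l) = G (sym_unit k l)" by (metis G(2))
    \<comment> \<open>Contraction with \<open>sym_unit k l\<close> sees only the average over
      \<open>k l\<close> and \<open>l k\<close>; symmetry in the last two indices recovers the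
      entry.\<close>
    moreover have "contract D (sym_unit k l) $ i $ j = D i j k l"
      using sum_sym_unit[of "D i j" k l] Dkl[of i j l k] by (simp add: contract_def)
    ultimately show "D i j k l = D0 i j k l" by (simp add: D0_def)
  qed
  ultimately have "(THE D. Q D) = D0" by (rule the_equality)
  then have "Dtens B = D0" by (simp add: Dtens_def Q_def)
  then have "contract (Dtens B) N = G N" using D0[OF N] by simp
  then show "symmetric_mat (contract (Dtens B) N)" "closure_op B (contract (Dtens B) N) = N"
    using Gsym[OF N] G(3) by auto
qed

text \<open>Stability of a linear equation: let \<open>M\<close> be the solution at the limit
  \<open>B\<close>. The defect \<open>N (X n) - closure_op (X n) M\<close> tends to 0 because
  \<open>M\<close> is fixed, and the uniform lower bound \<open>k\<close> on the operators turns a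
  small defect into a small error.\<close>

lemma continuous_on_contract_Dtens:
  assumes \<delta>: "\<delta> > 0" and K: "\<And>B. B \<in> K \<Longrightarrow> coercive \<delta> B \<and> trace B \<le> R"
    and N: "continuous_on K N" "\<And>B. B \<in> K \<Longrightarrow> symmetric_mat (N B)"
  shows "continuous_on K (\<lambda>B. contract (Dtens B) (N B))"
  unfolding continuous_on_sequentially comp_def
proof (intro allI ballI impI, elim conjE)
  fix X B assume B: "B \<in> K" and X: "\<forall>n. X n \<in> K" and lim: "X \<longlonglongrightarrow> B"
  define M where "M = contract (Dtens B) (N B)"
  define k where "k = R powr (- 5 / 2) / 5"
  have "R > 0" using K[OF B] trace_pos[of \<delta> B] \<delta> by linarith
  then have k: "k > 0" by (simp add: k_def)
  have LM: "closure_op B M = N B"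
    unfolding M_def using closure_op_contract_Dtens[OF _ \<delta> N(2)[OF B]] K[OF B] by blast
  have "(\<lambda>n. N (X n) - closure_op (X n) M) \<longlonglongrightarrow> N B - closure_op B M"
    using X B K lim
    by (intro tendsto_diff continuous_on_tendsto_compose[OF N(1)]
        continuous_on_tendsto_compose[OF continuous_on_closure_op[OF \<delta>]]) auto
  then have lim0: "(\<lambda>n. norm (N (X n) - closure_op (X n) M) / k) \<longlonglongrightarrow> 0"
    using LM by (auto intro!: tendsto_divide_zero tendsto_norm_zero)
  have le: "norm (contract (Dtens (X n)) (N (X n)) - M) \<le> norm (N (X n) - closure_op (X n) M) / k" for n
  proof -
    have c: "coercive \<delta> (X n)" "trace (X n) \<le> R" "X n \<in> K" using X K by auto
    have "k * norm (contract (Dtens (X n)) (N (X n)) - M)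
        \<le> norm (closure_op (X n) (contract (Dtens (X n)) (N (X n)) - M))"
      unfolding k_def by (rule norm_closure_op_ge[OF c(1) \<delta> c(2)])
    also have "\<dots> = norm (N (X n) - closure_op (X n) M)"
      by (simp add: linear_diff[OF linear_closure_op[OF c(1) \<delta>]] closure_op_contract_Dtens[OF c(1) \<delta> N(2)[OF c(3)]])
    finally show ?thesis using k by (simp add: field_simps)
  qed
  have "(\<lambda>n. contract (Dtens (X n)) (N (X n)) - M) \<longlonglongrightarrow> 0"
    by (rule Lim_null_comparison[OF always_eventually[OF allI[OF le]] lim0])
  then show "(\<lambda>n. contract (Dtens (X n)) (N (X n))) \<longlonglongrightarrow> contract (Dtens B) (N B)"
    unfolding M_def by (rule LIM_zero_cancel)
qed

section \<open>A priori estimates\<close>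

lemma trace_transpose: "trace (transpose W) = trace (W :: real^'n^'n)"
  by (simp add: trace_def transpose_def)

text \<open>With \<open>P = B + s I\<close> and \<open>X\<close> its inverse,
  \<open>X B = I - s X\<close>. Hence \<open>X (B W + W^T B) X\<close> equals
  \<open>W X + X W^T\<close> up to terms with a factor \<open>s\<close>; in the scalar part the
  identity contributes only \<open>trace W\<close>, which vanishes.\<close>

lemma closure_kernel_transport:
  assumes B: "coercive \<delta> B" and \<delta>: "\<delta> > 0" and s: "s \<ge> 0" and W: "trace W = 0"
  shows "closure_kernel (B + s *\<^sub>R mat 1) (B ** W + transpose W ** B) =
    2 *\<^sub>R (W ** moment_kernel (B + s *\<^sub>R mat 1) + moment_kernel (B + s *\<^sub>R mat 1) ** transpose W)
    - s *\<^sub>R closure_kernel (B + s *\<^sub>R mat 1) (W + transpose W)"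
proof -
  define P where "P = B + s *\<^sub>R mat 1"
  define X where "X = matrix_inv P"
  define w where "w = inv_sqrt_det P"
  have P: "coercive (\<delta> + s) P" "\<delta> + s > 0" unfolding P_def using coercive_shift[OF B] \<delta> s by auto
  have tX: "transpose X = X" unfolding X_def by (rule transpose_matrix_inv[OF P])
  have BP: "B = P - s *\<^sub>R mat 1" by (simp add: P_def)
  have XB: "X ** B = mat 1 - s *\<^sub>R X" "B ** X = mat 1 - s *\<^sub>R X"
    unfolding BP X_def
    by (simp_all add: matrix_mult_linear_simps matrix_inv_left[OF P] matrix_inv_right[OF P])
  have "X \<bullet> (B ** W) = - s * (X \<bullet> W)"
    using W by (simp add: inner_matrix_mult_left[of X] coerciveD(2)[OF B] XB inner_diff_left trace_eq_inner)
  moreover have "X \<bullet> (transpose W ** B) = - s * (X \<bullet> transpose W)"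
    using W by (simp add: inner_matrix_mult_right[of X] coerciveD(2)[OF B] XB inner_diff_left
        trace_eq_inner[symmetric] trace_transpose)
  ultimately have i: "X \<bullet> (B ** W + transpose W ** B) = - s * (X \<bullet> (W + transpose W))"
    by (simp add: inner_add_right algebra_simps)
  have "X ** (B ** W + transpose W ** B) ** X = (X ** B) ** W ** X + X ** transpose W ** (B ** X)"
    by (simp add: matrix_mult_linear_simps matrix_mul_assoc)
  also have "\<dots> = W ** X + X ** transpose W - s *\<^sub>R (X ** (W + transpose W) ** X)"
    unfolding XB by (simp add: matrix_mult_linear_simps matrix_mul_assoc scaleR_add_right)
  finally have m: "X ** (B ** W + transpose W ** B) ** X
      = W ** X + X ** transpose W - s *\<^sub>R (X ** (W + transpose W) ** X)" .
  show ?thesis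
    unfolding P_def[symmetric] closure_kernel_def moment_kernel_def X_def[symmetric] w_def[symmetric] m i
    by (simp add: matrix_mult_linear_simps(7,8) scaleR_add_right scaleR_diff_right) (simp add: mult_ac)
qed

text \<open>The factor \<open>s\<close> is absorbed by the decay of \<open>X\<close>:
  \<open>s * norm X \<le> 3\<close> and \<open>s * norm (X x)^2 \<le> x \<bullet> X x\<close>. This
  gives 5 = 3 + 2 * 1, with no trace of \<open>\<delta>\<close>.\<close>

lemma closure_kernel_quadratic_le:
  assumes B: "coercive \<delta> B" and \<delta>: "\<delta> > 0" and s: "s \<ge> 0"
  shows "s * (x \<bullet> (closure_kernel (B + s *\<^sub>R mat 1) S *v x))
    \<le> 5 * norm S * (x \<bullet> (moment_kernel (B + s *\<^sub>R mat 1) *v x))"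
proof -
  define P where "P = B + s *\<^sub>R mat 1"
  define X where "X = matrix_inv P"
  define w where "w = inv_sqrt_det P"
  have P: "coercive (\<delta> + s) P" "\<delta> + s > 0" unfolding P_def using coercive_shift[OF B] \<delta> s by auto
  have w: "w \<ge> 0" unfolding w_def using inv_sqrt_det_bounds[OF P] by simp
  have tX: "transpose X = X" unfolding X_def by (rule transpose_matrix_inv[OF P])
  have q0: "0 \<le> x \<bullet> (X *v x)" using coerciveD(3)[OF coercive_matrix_inv[OF P]] by (simp add: X_def)
  have "s * (X \<bullet> S) \<le> s * (norm X * norm S)"
    using s by (intro mult_left_mono norm_cauchy_schwarz)
  also have "\<dots> \<le> s * (3 / (\<delta> + s) * norm S)"
    using s norm_matrix_inv_le[OF P] by (intro mult_left_mono mult_right_mono) (auto simp: X_def)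
  also have "\<dots> = (s / (\<delta> + s)) * (3 * norm S)" by simp
  also have "\<dots> \<le> 1 * (3 * norm S)"
    using P(2) \<delta> s by (intro mult_right_mono) auto
  finally have 1: "s * (X \<bullet> S) * (x \<bullet> (X *v x)) \<le> 3 * norm S * (x \<bullet> (X *v x))"
    using q0 by (intro mult_right_mono) auto
  have "x \<bullet> ((X ** S ** X) *v x) = (X *v x) \<bullet> (S *v (X *v x))"
    using quadratic_form_transpose[of x X S] by (simp add: tX)
  also have "\<dots> \<le> norm (X *v x) * norm (S *v (X *v x))" by (rule norm_cauchy_schwarz)
  also have "\<dots> \<le> norm (X *v x) * (norm S * norm (X *v x))"
    by (intro mult_left_mono norm_matrix_vector_mult_le) auto
  also have "\<dots> = norm S * ((X *v x) \<bullet> (X *v x))"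
    by (simp add: power2_norm_eq_inner[symmetric] power2_eq_square)
  finally have "s * (x \<bullet> ((X ** S ** X) *v x)) \<le> s * (norm S * ((X *v x) \<bullet> (X *v x)))"
    using s by (rule mult_left_mono)
  also have "\<dots> \<le> (\<delta> + s) * (norm S * ((X *v x) \<bullet> (X *v x)))"
    using \<delta> by (intro mult_right_mono) auto
  also have "\<dots> = norm S * ((\<delta> + s) * ((X *v x) \<bullet> (X *v x)))" by simp
  also have "\<dots> \<le> norm S * (x \<bullet> (X *v x))"
    using matrix_inv_quadratic[OF P] by (intro mult_left_mono) (auto simp: X_def)
  finally have 2: "s * (x \<bullet> ((X ** S ** X) *v x)) \<le> norm S * (x \<bullet> (X *v x))" .
  have "s * (x \<bullet> (closure_kernel P S *v x)) =
      w * (s * (X \<bullet> S) * (x \<bullet> (X *v x)) + 2 * (s * (x \<bullet> ((X ** S ** X) *v x))))"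
    by (simp add: closure_kernel_def X_def w_def matrix_vector_mult_add_rdistrib inner_add_right
        scaleR_matrix_vector_assoc[symmetric] algebra_simps)
  also have "\<dots> \<le> w * (5 * norm S * (x \<bullet> (X *v x)))"
    using 1 2 w by (intro mult_left_mono) auto
  also have "\<dots> = 5 * norm S * (x \<bullet> (moment_kernel P *v x))"
    by (simp add: moment_kernel_def X_def w_def scaleR_matrix_vector_assoc[symmetric])
  finally show ?thesis by (simp add: P_def)
qed

text \<open>The transport term changes \<open>A\<close> by the infinitesimal congruence \<open>W A + A W\<^sup>T\<close>, up to an error
  that is controlled by \<open>A\<close> itself.\<close>

lemma closure_op_transport_ge:
  assumes B: "coercive \<delta> B" and \<delta>: "\<delta> > 0" and W: "trace W = 0"
  shows "x \<bullet> ((W ** Amap B + Amap B ** transpose W) *v x) - 5 / 2 * norm (W + transpose W) * (x \<bullet> (Amap B *v x))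
    \<le> x \<bullet> (closure_op B (B ** W + transpose W ** B) *v x)"
proof -
  \<comment> \<open>A bound that is linear in \<open>K\<close> commutes with the integral, so the
    pointwise inequality in \<open>s\<close> becomes one for \<open>Amap B\<close>.\<close>
  define \<phi> where "\<phi> K = 2 * (x \<bullet> ((W ** K + K ** transpose W) *v x)) - 5 * norm (W + transpose W) * (x \<bullet> (K *v x))"
    for K :: mat3
  let ?M = "B ** W + transpose W ** B"
  note Im = moment_kernel_integrable[OF B \<delta>] and Ic = closure_kernel_integrable[OF B \<delta>, of ?M]
  have bl: "bounded_linear (\<lambda>K :: mat3. x \<bullet> (K *v x))"
    by (rule bounded_linear_compose[OF bounded_linear_inner_right bounded_linear_matrix_apply])
  have lin: "linear \<phi>"
    by (rule linearI) (simp_all add: \<phi>_def matrix_mult_linear_simps matrix_vector_mult_add_rdistrib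
        inner_add_right scaleR_matrix_vector_assoc[symmetric] algebra_simps)
  then have bl\<phi>: "bounded_linear \<phi>" by (simp add: linear_conv_bounded_linear)
  have le: "\<phi> (moment_kernel (B + s *\<^sub>R mat 1)) \<le> x \<bullet> (closure_kernel (B + s *\<^sub>R mat 1) ?M *v x)"
    if "s \<in> {0..}" for s
  proof -
    have s: "s \<ge> 0" using that by simp
    show ?thesis
      unfolding closure_kernel_transport[OF B \<delta> s W] \<phi>_def
      using closure_kernel_quadratic_le[OF B \<delta> s, of x "W + transpose W"]
      by (simp add: matrix_vector_mult_diff_rdistrib matrix_vector_mult_add_rdistrib inner_add_right
          inner_diff_right scaleR_matrix_vector_assoc[symmetric])
  qed
  have "\<phi> (integral {0..} (\<lambda>s. moment_kernel (B + s *\<^sub>R mat 1)))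
      = integral {0..} (\<lambda>s. \<phi> (moment_kernel (B + s *\<^sub>R mat 1)))"
    by (rule integral_bounded_linear[OF Im bl\<phi>])
  also have "\<dots> \<le> integral {0..} (\<lambda>s. x \<bullet> (closure_kernel (B + s *\<^sub>R mat 1) ?M *v x))"
    using integrable_linear[OF Im bl\<phi>] integrable_linear[OF Ic bl] le
    by (intro integral_le) (auto simp: comp_def)
  also have "\<dots> = x \<bullet> (integral {0..} (\<lambda>s. closure_kernel (B + s *\<^sub>R mat 1) ?M) *v x)"
    by (rule integral_bounded_linear[OF Ic bl, symmetric])
  also have "\<dots> = 4 * (x \<bullet> (closure_op B ?M *v x))"
    by (simp add: closure_op_def scaleR_matrix_vector_assoc[symmetric])
  \<comment> \<open>The normalisations 1/2 of \<open>Amap\<close> and 1/4 of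
    \<open>closure_op\<close> turn the coefficients 2 and 5 into 1 and 5/2.\<close>
  also have "\<phi> (integral {0..} (\<lambda>s. moment_kernel (B + s *\<^sub>R mat 1))) = 2 * \<phi> (Amap B)"
    using linear_scale[OF lin, of 2 "Amap B"] by (simp add: Amap_eq)
  finally show ?thesis by (simp add: \<phi>_def)
qed

text \<open>\<open>trace (matrix_inv A ** A')\<close> is the logarithmic derivative of
  \<open>det A\<close>. By assumption \<open>Z = A' - (1/2) (W A + A W^T) + k A\<close> is positive
  semidefinite; paired with the inverse of \<open>A\<close>, the congruence yields a multiple of
  \<open>trace W = 0\<close>, and \<open>k A\<close> yields \<open>3 k\<close>.\<close>

lemma trace_logarithmic_derivative_ge:
  assumes A: "coercive c A" "c > 0" and A': "symmetric_mat A'" and W: "trace W = 0"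
    and ge: "\<And>x. 1 / 2 * (x \<bullet> ((W ** A + A ** transpose W) *v x)) - k * (x \<bullet> (A *v x)) \<le> x \<bullet> (A' *v x)"
  shows "- 3 * k \<le> trace (matrix_inv A ** A')"
proof -
  define Z where "Z = A' - (1 / 2) *\<^sub>R (W ** A + A ** transpose W) + k *\<^sub>R A"
  have "transpose Z = Z"
    using A' coerciveD(2)[OF A(1)]
    by (simp add: Z_def symmetric_mat_def transpose_add transpose_diff transpose_scalar matrix_transpose_mul add.commute)
  moreover have "x \<bullet> (Z *v x) \<ge> 0" for x
    using ge[of x]
    by (simp add: Z_def matrix_vector_mult_diff_rdistrib matrix_vector_mult_add_rdistrib inner_add_right
          inner_diff_right scaleR_matrix_vector_assoc[symmetric])
  ultimately have "coercive 0 Z" by (simp add: coercive_def symmetric_mat_def)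
  then have "0 \<le> trace (matrix_inv A ** Z)" by (rule trace_mult_nonneg[OF coercive_matrix_inv[OF A]])
  also have "\<dots> = trace (matrix_inv A ** A') - 1 / 2 * (trace (matrix_inv A ** (W ** A))
      + trace (matrix_inv A ** (A ** transpose W))) + k * trace (matrix_inv A ** A)"
    by (simp add: Z_def matrix_mult_linear_simps trace_add trace_sub trace_scaleR algebra_simps)
  also have "trace (matrix_inv A ** (W ** A)) = 0"
    by (subst trace_mul_sym) (simp add: matrix_mul_assoc[symmetric] matrix_inv_right[OF A] W)
  also have "trace (matrix_inv A ** (A ** transpose W)) = 0"
    by (simp add: matrix_mul_assoc matrix_inv_left[OF A] trace_transpose W)
  finally show ?thesis by (simp add: matrix_inv_left[OF A] trace_I)
qed

text \<open>The bound holds however close to degenerate \<open>B\<close> is: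
  \<open>trace (X B) = 3 - s * trace X\<close> is at most 3, and \<open>det B = 1\<close> bounds the
  weight by \<open>2 * (1 + s) powr (- 3 / 2)\<close>. Half the integral of
  \<open>6 * (1 + s) powr (- 3 / 2)\<close> is 6.\<close>

lemma trace_Amap_mult_le:
  assumes B: "coercive \<delta> B" and \<delta>: "\<delta> > 0" and d: "det B = 1"
  shows "trace (Amap B ** B) \<le> 6"
proof -
  have B0: "coercive 0 B" using coercive_mono[OF B] \<delta> by simp
  note I = moment_kernel_integrable[OF B \<delta>]
  have bl: "bounded_linear (\<lambda>K :: mat3. trace (K ** B))"
    by (rule bounded_linear_compose[OF bounded_linear_trace bounded_bilinear.bounded_linear_left[OF bounded_bilinear_matrix_mult]])
  have le: "trace (moment_kernel (B + s *\<^sub>R mat 1) ** B) \<le> 6 * (1 + s) powr (- 3 / 2)" if "s \<in> {0..}" for s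
  proof -
    have s: "s \<ge> 0" using that by simp
    define P where "P = B + s *\<^sub>R mat 1"
    have P: "coercive (\<delta> + s) P" "\<delta> + s > 0" unfolding P_def using coercive_shift[OF B] \<delta> s by auto
    have BP: "B = P - s *\<^sub>R mat 1" by (simp add: P_def)
    have "trace (matrix_inv P ** B) = 3 - s * trace (matrix_inv P)"
      unfolding BP by (simp add: matrix_mult_linear_simps matrix_inv_left[OF P] trace_sub trace_scaleR trace_I)
    also have "\<dots> \<le> 3"
      using s trace_mult_nonneg[OF coercive_matrix_inv[OF P], of "mat 1"]
      by (simp add: coercive_def symmetric_mat_def)
    finally have t: "trace (matrix_inv P ** B) \<le> 3" .
    \<comment> \<open>Convexity of the cube trades \<open>1 + s^3\<close> for a pure power of
      \<open>1 + s\<close>, whose integral is known.\<close>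
    have "(1 + s) ^ 3 \<le> 4 * (1 + s ^ 3)"
    proof -
      have "4 * (1 + s ^ 3) - (1 + s) ^ 3 = 3 * ((1 - s)\<^sup>2 * (1 + s))"
        by (simp add: power2_eq_square power3_eq_cube algebra_simps)
      also have "\<dots> \<ge> 0" using s by simp
      finally show ?thesis by simp
    qed
    then have "(1 + s) ^ 3 / 4 \<le> det P" using det_shift_superadditive[OF B0 s] d by (simp add: P_def)
    then have "1 / sqrt (det P) \<le> 1 / sqrt ((1 + s) ^ 3 / 4)"
      using s det_ge[OF P(1)] P(2) by (intro divide_left_mono mult_pos_pos real_sqrt_le_mono) (auto simp: less_le_trans[OF zero_less_power])
    also have "\<dots> = 2 * (1 / sqrt ((1 + s) ^ 3))" by (simp add: real_sqrt_divide)
    also have "\<dots> = 2 * (1 + s) powr (- 3 / 2)" using inverse_sqrt_cube[of "1 + s"] s by simp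
    finally have w: "inv_sqrt_det P \<le> 2 * (1 + s) powr (- 3 / 2)" by (simp add: inv_sqrt_det_def)
    have "trace (moment_kernel P ** B) = inv_sqrt_det P * trace (matrix_inv P ** B)"
      by (simp add: moment_kernel_def matrix_mult_linear_simps trace_scaleR)
    also have "\<dots> \<le> inv_sqrt_det P * 3"
      using t inv_sqrt_det_bounds(1)[OF P] by (intro mult_left_mono) auto
    also have "\<dots> \<le> 6 * (1 + s) powr (- 3 / 2)" using w by simp
    finally show ?thesis by (simp add: P_def)
  qed
  have i: "((\<lambda>s::real. 6 * (1 + s) powr (- 3 / 2)) has_integral 6 * (1 powr (- 3 / 2 + 1) / (- (- 3 / 2) - 1))) {0..}"
    by (intro has_integral_mult_right has_integral_shifted_powr_to_inf) auto
  have "trace (integral {0..} (\<lambda>s. moment_kernel (B + s *\<^sub>R mat 1)) ** B)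
      = integral {0..} (\<lambda>s. trace (moment_kernel (B + s *\<^sub>R mat 1) ** B))"
    by (rule integral_bounded_linear[OF I bl])
  also have "\<dots> \<le> 6 * (1 powr (- 3 / 2 + 1) / (- (- 3 / 2) - 1))"
    using integrable_linear[OF I bl] le by (intro has_integral_le[OF integrable_integral i]) (auto simp: comp_def)
  finally show ?thesis
    by (simp add: Amap_eq matrix_mult_linear_simps trace_scaleR)
qed

text \<open>A lower bound on \<open>det A\<close> confines \<open>B\<close> to a compact subset of the cone of positive definite
  matrices: \<open>A \<ge> \<epsilon> I\<close> because \<open>tr A = 1\<close>, hence \<open>\<epsilon> tr B \<le> tr (A B) \<le> 6\<close>.\<close>

lemma det_Amap_confines:
  assumes B: "coercive \<delta> B" and \<delta>: "\<delta> > 0" and d: "det B = 1" and \<epsilon>: "\<epsilon> > 0" "\<epsilon> \<le> det (Amap B)"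
  shows "trace B \<le> 6 / \<epsilon>" "coercive (1 / (6 / \<epsilon>)\<^sup>2) B"
proof -
  have B0: "coercive 0 B" using coercive_mono[OF B] \<delta> by simp
  obtain c where c: "c > 0" "coercive c (Amap B)" using coercive_Amap[OF B \<delta>] by blast
  have "trace (Amap B) \<le> 1" using trace_Amap[OF B \<delta>] d by (simp add: inv_sqrt_det_def)
  then have "coercive (\<epsilon> / 1\<^sup>2) (Amap B)"
    using c \<epsilon> coercive_mono[OF c(2), of 0] by (intro coercive_of_det_trace) auto
  then have "0 \<le> trace ((Amap B - \<epsilon> *\<^sub>R mat 1) ** B)"
    by (intro trace_mult_nonneg[OF coercive_diff_mat B0]) simp
  also have "\<dots> = trace (Amap B ** B) - \<epsilon> * trace B"
    by (simp add: matrix_mult_linear_simps trace_sub trace_scaleR)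
  finally have "\<epsilon> * trace B \<le> 6" using trace_Amap_mult_le[OF B \<delta> d] by simp
  then show t: "trace B \<le> 6 / \<epsilon>" using \<epsilon> by (simp add: field_simps)
  show "coercive (1 / (6 / \<epsilon>)\<^sup>2) B"
    by (rule coercive_of_det_trace[OF B0 t]) (use \<epsilon> d in auto)
qed

text \<open>Since \<open>B \<le> (trace B) I\<close>, pairing the difference with \<open>B\<close>
  bounds \<open>B \<bullet> B\<close> by the square of the trace. A trace bound thus makes the
  trapping set bounded.\<close>

lemma norm_le_trace:
  assumes "coercive 0 B" shows "norm B \<le> trace B"
proof -
  have "coercive 0 (trace B *\<^sub>R mat 1 - B)"
    using quadratic_form_le_trace[OF assms] coerciveD(2)[OF assms]
    by (auto simp: coercive_def symmetric_mat_def transpose_diff transpose_scalar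
        matrix_vector_mult_diff_rdistrib inner_diff_right scaleR_matrix_vector_assoc[symmetric])
  from trace_mult_nonneg[OF this assms] have "B \<bullet> B \<le> trace B * trace B"
    using trace_mult_eq_inner[of B B] coerciveD(2)[OF assms]
    by (simp add: matrix_mult_linear_simps trace_sub trace_scaleR)
  then have "(norm B)\<^sup>2 \<le> (trace B)\<^sup>2"
    unfolding power2_norm_eq_inner by (simp add: power2_eq_square)
  moreover have "0 \<le> trace B"
    using trace_mult_nonneg[OF assms, of "mat 1"] by (simp add: coercive_def symmetric_mat_def)
  ultimately show ?thesis by (rule power2_le_imp_le)
qed

definition trapping_set :: "real \<Rightarrow> real \<Rightarrow> mat3 set" where
  "trapping_set \<delta> R = {B. coercive \<delta> B \<and> trace B \<le> R}"

lemma compact_trapping_set: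
  assumes "\<delta> \<ge> 0" shows "compact (trapping_set \<delta> R)"
proof -
  have "bounded (trapping_set \<delta> R)"
    unfolding bounded_iff
  proof (intro exI ballI)
    fix B assume "B \<in> trapping_set \<delta> R"
    then have "coercive 0 B" "trace B \<le> R" using coercive_mono[OF _ assms] by (auto simp: trapping_set_def)
    then show "norm B \<le> R" using norm_le_trace[of B] by simp
  qed
  moreover have "trapping_set \<delta> R = {B. transpose B = B} \<inter> (\<Inter>x. {B. \<delta> * (x \<bullet> x) \<le> x \<bullet> (B *v x)}) \<inter> {B. trace B \<le> R}"
    by (auto simp: trapping_set_def coercive_def symmetric_mat_def)
  moreover have "closed {B :: mat3. transpose B = B}"
    by (intro closed_Collect_eq continuous_on_id bounded_linear.continuous_on[OF bounded_linear_transpose])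
  moreover have "closed {B :: mat3. \<delta> * (x \<bullet> x) \<le> x \<bullet> (B *v x)}" for x
    by (intro closed_Collect_le continuous_intros bounded_linear.continuous_on[OF bounded_linear_matrix_apply])
  moreover have "closed {B :: mat3. trace B \<le> R}"
    by (intro closed_Collect_le continuous_intros)
  ultimately have "closed (trapping_set \<delta> R)" by (simp only:) (intro closed_Int closed_INT, auto)
  then show ?thesis using \<open>bounded _\<close> by (simp add: compact_eq_bounded_closed)
qed

section \<open>The flow\<close>

text \<open>The field takes symmetric values everywhere, so \<open>transpose (B t) - B t\<close> is
  constant. Symmetry along the path is what makes \<open>trapping_set_neighbourhood\<close>
  applicable.\<close>

lemma symmetric_solution:
  assumes f: "\<And>t B. t \<in> {a..b} \<Longrightarrow> symmetric_mat (f t B)" and B0: "symmetric_mat (B a)"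
    and d: "\<And>t. t \<in> {a..b} \<Longrightarrow> (B has_vector_derivative f t (B t)) (at t within {a..b})"
    and t: "t \<in> {a..b}"
  shows "symmetric_mat (B t)"
proof -
  have "((\<lambda>t. transpose (B t) - B t) has_vector_derivative 0) (at t within {a..b})" if "t \<in> {a..b}" for t
  proof -
    have "((\<lambda>t. transpose (B t) - B t) has_vector_derivative (transpose (f t (B t)) - f t (B t))) (at t within {a..b})"
      by (intro has_vector_derivative_diff bounded_linear.has_vector_derivative[OF bounded_linear_transpose] d that)
    then show ?thesis using f[OF that, of "B t"] by (simp add: symmetric_mat_def)
  qed
  then obtain c where c: "\<And>t. t \<in> {a..b} \<Longrightarrow> transpose (B t) - B t = c"
    using has_vector_derivative_zero_constant[of "{a..b}" "\<lambda>t. transpose (B t) - B t"] by auto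
  have "a \<in> {a..b}" using t by auto
  then have "c = 0" using c[of a] B0 by (simp add: symmetric_mat_def)
  then show ?thesis using c[OF t] by (simp add: symmetric_mat_def)
qed

text \<open>The margins \<open>\<delta> / 2\<close> and 1 make room for a ball around
  \<open>B\<close>. It is taken within the symmetric matrices, since the trapping set has empty
  interior among all matrices.\<close>

lemma trapping_set_neighbourhood:
  assumes B: "coercive \<delta> B" "trace B \<le> R" and \<delta>: "\<delta> > 0"
  obtains e where "e > 0" "\<And>C. symmetric_mat C \<Longrightarrow> norm (C - B) < e \<Longrightarrow> C \<in> trapping_set (\<delta> / 2) (R + 1)"
proof
  \<comment> \<open>The first entry protects the quadratic form, the second the trace, as
    \<open>trace (C - B) \<le> norm (mat 1) * norm (C - B)\<close>.\<close>
  show "min (\<delta> / 2) (1 / (norm (mat 1 :: mat3) + 1)) > 0" using \<delta> by (simp add: add_nonneg_pos)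
  fix C assume s: "symmetric_mat C" and n: "norm (C - B) < min (\<delta> / 2) (1 / (norm (mat 1 :: mat3) + 1))"
  have "\<delta> / 2 * (x \<bullet> x) \<le> x \<bullet> (C *v x)" for x
  proof -
    have "\<bar>x \<bullet> ((C - B) *v x)\<bar> \<le> norm x * norm ((C - B) *v x)" by (rule Cauchy_Schwarz_ineq2)
    also have "\<dots> \<le> norm x * (norm (C - B) * norm x)"
      by (intro mult_left_mono norm_matrix_vector_mult_le) auto
    also have "\<dots> \<le> norm x * ((\<delta> / 2) * norm x)"
      using n by (intro mult_left_mono mult_right_mono) auto
    also have "\<dots> = \<delta> / 2 * (x \<bullet> x)" by (simp add: power2_norm_eq_inner[symmetric] power2_eq_square)
    finally have "- (\<delta> / 2 * (x \<bullet> x)) \<le> x \<bullet> ((C - B) *v x)" by linarith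
    then show ?thesis
      using coerciveD(3)[OF B(1), of x]
      by (simp add: matrix_vector_mult_diff_rdistrib inner_diff_right)
  qed
  moreover have "trace C \<le> R + 1"
  proof -
    have "trace (C - B) \<le> norm (mat 1 :: mat3) * norm (C - B)"
      unfolding trace_eq_inner by (rule norm_cauchy_schwarz)
    also have "\<dots> \<le> (norm (mat 1 :: mat3) + 1) * (1 / (norm (mat 1 :: mat3) + 1))"
      using n by (intro mult_mono) auto
    also have "\<dots> = 1" by (simp add: add_nonneg_eq_0_iff)
    finally show ?thesis using B(2) by (simp add: trace_sub)
  qed
  ultimately show "C \<in> trapping_set (\<delta> / 2) (R + 1)" using s by (simp add: trapping_set_def coercive_def)
qed

text \<open>At the supremum of the times up to which the path has stayed in \<open>K\<close>,
  closedness keeps the path in \<open>K\<close> and \<open>trap\<close> pushes it further.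
  \<open>trap\<close> is demanded only at times whose whole past lies in \<open>K\<close>, which is
  how the a priori estimates become available.\<close>

lemma first_exit:
  fixes B :: "real \<Rightarrow> 'a::metric_space"
  assumes ab: "a \<le> b" and cont: "continuous_on {a..b} B" and K: "closed K" and Ba: "B a \<in> K"
    and trap: "\<And>t. t \<in> {a..b} \<Longrightarrow> (\<And>s. s \<in> {a..t} \<Longrightarrow> B s \<in> K) \<Longrightarrow>
       \<exists>e>0. \<forall>s\<in>{a..b}. dist (B s) (B t) < e \<longrightarrow> B s \<in> K"
    and t: "t \<in> {a..b}"
  shows "B t \<in> K"
proof -
  define S where "S = {t \<in> {a..b}. \<forall>s\<in>{a..t}. B s \<in> K}"
  have aS: "a \<in> S" using ab Ba by (auto simp: S_def)
  have bdd: "bdd_above S" by (auto simp: S_def bdd_above_def)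
  define m where "m = Sup S"
  have am: "a \<le> m" unfolding m_def by (rule cSup_upper[OF aS bdd])
  have mb: "m \<le> b" unfolding m_def by (rule cSup_least) (use aS in \<open>auto simp: S_def\<close>)
  have below: "B s \<in> K" if "a \<le> s" "s < m" for s
  proof -
    obtain u where "u \<in> S" "s < u"
      using \<open>s < m\<close> aS unfolding m_def by (metis less_cSupE empty_iff)
    then show ?thesis using that by (auto simp: S_def)
  qed
  have "closed ({a..b} \<inter> B -` K)" 
    by (rule continuous_closed_preimage[OF cont closed_atLeastAtMost K])
  have Bm: "B m \<in> K"
  proof (cases "a = m")
    case False
    then have "a < m" using am by simp
    then have "m \<in> closure {a..<m}" by simp
    also have "\<dots> \<subseteq> {a..b} \<inter> B -` K"
      by (rule closure_minimal) (use below mb \<open>closed ({a..b} \<inter> B -` K)\<close> in auto)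
    finally show ?thesis by simp
  qed (use Ba in simp)
  have upto: "B s \<in> K" if "s \<in> {a..m}" for s
    using below Bm that by (cases "s = m") auto
  have "m = b"
  proof (rule ccontr)
    assume "m \<noteq> b"
    then have "m < b" using mb by simp
    obtain e where e: "e > 0" "\<And>s. s \<in> {a..b} \<Longrightarrow> dist (B s) (B m) < e \<Longrightarrow> B s \<in> K"
      using trap[of m] upto am mb by auto
    obtain r where r: "r > 0" "\<And>s. s \<in> {a..b} \<Longrightarrow> dist s m < r \<Longrightarrow> dist (B s) (B m) < e"
      using cont am mb e(1) unfolding continuous_on_iff by (metis atLeastAtMost_iff)
    define u where "u = min b (m + r / 2)"
    have u: "m < u" "u \<le> b" using \<open>m < b\<close> r(1) by (auto simp: u_def)
    have "B s \<in> K" if "s \<in> {a..u}" for s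
    proof (cases "s \<le> m")
      case False
      then have "dist s m < r" using that r(1) by (auto simp: dist_real_def u_def)
      then show ?thesis using e(2) r(2) that u by auto
    qed (use upto that in auto)
    then have "u \<in> S" using u am by (auto simp: S_def)
    then have "u \<le> m" unfolding m_def by (rule cSup_upper[OF _ bdd])
    then show False using u by simp
  qed
  then show ?thesis using upto t by simp
qed

text \<open>The flow sees the velocity gradient only through
  \<open>W = \<Omega> + \<lambda> \<Gamma>\<close>, because
  \<open>- \<Omega> + \<lambda> \<Gamma>\<close> is its transpose. The bounds
  \<open>\<omega>\<close> and \<open>\<rho>\<close> hold for all times, so one rate serves every
  unit interval.\<close>

locale closure_flow =
  fixes W :: "real \<Rightarrow> mat3" and Dr :: "real \<Rightarrow> real" and \<omega> \<rho> :: real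
  assumes continuous_W: "continuous_on {0..} W" and continuous_Dr: "continuous_on {0..} Dr"
    and trace_W: "\<And>t. t \<ge> 0 \<Longrightarrow> trace (W t) = 0" and norm_W: "\<And>t. t \<ge> 0 \<Longrightarrow> norm (W t) \<le> \<omega>"
    and Dr_nonneg: "\<And>t. t \<ge> 0 \<Longrightarrow> 0 \<le> Dr t" and Dr_le: "\<And>t. t \<ge> 0 \<Longrightarrow> Dr t \<le> \<rho>"
begin

definition transport :: "real \<Rightarrow> mat3 \<Rightarrow> mat3" where
  "transport t B = B ** W t + transpose (W t) ** B"

definition drift :: "real \<Rightarrow> mat3 \<Rightarrow> mat3" where
  "drift t B = - (1 / 2) *\<^sub>R transport t B - Dr t *\<^sub>R contract (Dtens B) (2 *\<^sub>R mat 1 - 6 *\<^sub>R Amap B)"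

lemma symmetric_relaxation:
  assumes "coercive \<delta> B" "\<delta> > 0" shows "symmetric_mat (2 *\<^sub>R mat 1 - 6 *\<^sub>R Amap B)"
proof -
  obtain c where "coercive c (Amap B)" using coercive_Amap[OF assms] by blast
  then show ?thesis
    using coerciveD(2) by (simp add: symmetric_mat_def transpose_diff transpose_scalar)
qed

lemma symmetric_transport:
  assumes "symmetric_mat B" shows "symmetric_mat (transport t B)"
  using assms by (simp add: symmetric_mat_def transport_def transpose_add matrix_transpose_mul add.commute)

lemma symmetric_drift:
  assumes "coercive \<delta> B" "\<delta> > 0" shows "symmetric_mat (drift t B)"
  using symmetric_transport[OF coerciveD(1)[OF assms(1)]]
    symmetric_contract_Dtens[OF assms symmetric_relaxation[OF assms]]
  by (simp add: symmetric_mat_def drift_def transpose_diff transpose_scalar transpose_minus)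

lemma continuous_on_drift:
  assumes \<delta>: "\<delta> > 0"
  shows "continuous_on ({0..} \<times> trapping_set \<delta> R) (\<lambda>p. drift (fst p) (snd p))"
proof -
  have A: "continuous_on (trapping_set \<delta> R) (\<lambda>B. 2 *\<^sub>R mat 1 - 6 *\<^sub>R Amap B)"
    by (intro continuous_intros continuous_on_subset[OF continuous_on_Amap[OF \<delta>]])
       (auto simp: trapping_set_def)
  have D: "continuous_on (trapping_set \<delta> R) (\<lambda>B. contract (Dtens B) (2 *\<^sub>R mat 1 - 6 *\<^sub>R Amap B))"
    by (rule continuous_on_contract_Dtens[OF \<delta> _ A])
       (use symmetric_relaxation \<delta> in \<open>auto simp: trapping_set_def\<close>)
  show ?thesis
    unfolding drift_def transport_def
    by (intro continuous_intros bounded_linear.continuous_on[OF bounded_linear_transpose]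
        continuous_on_compose2[OF continuous_W continuous_on_fst]
        continuous_on_compose2[OF continuous_Dr continuous_on_fst]
        continuous_on_compose2[OF D continuous_on_snd]) auto
qed

lemma closure_op_drift:
  assumes "coercive \<delta> B" "\<delta> > 0"
  shows "- closure_op B (drift t B) = (1 / 2) *\<^sub>R closure_op B (transport t B) + Dr t *\<^sub>R (2 *\<^sub>R mat 1 - 6 *\<^sub>R Amap B)"
proof -
  note lin = linear_closure_op[OF assms]
  show ?thesis
    unfolding drift_def linear_diff[OF lin] linear_scale[OF lin]
      closure_op_contract_Dtens[OF assms symmetric_relaxation[OF assms]]
    by simp
qed

text \<open>\<open>\<delta>\<close> and \<open>N\<close> justify the calculus along the path, but
  neither enters the conclusions below; this keeps the later bootstrap from being circular.\<close>

context
  fixes a b \<delta> N :: real and B :: "real \<Rightarrow> mat3"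
  assumes a: "a \<ge> 0" and \<delta>: "\<delta> > 0"
    and coercive_B: "\<And>t. t \<in> {a..b} \<Longrightarrow> coercive \<delta> (B t)"
    and deriv_B: "\<And>t. t \<in> {a..b} \<Longrightarrow> (B has_vector_derivative drift t (B t)) (at t within {a..b})"
    and norm_drift: "\<And>t. t \<in> {a..b} \<Longrightarrow> norm (drift t (B t)) \<le> N"
begin

lemma deriv_Amap:
  assumes "t \<in> {a..b}"
  shows "((\<lambda>u. Amap (B u)) has_vector_derivative
    (1 / 2) *\<^sub>R closure_op (B t) (transport t (B t)) + Dr t *\<^sub>R (2 *\<^sub>R mat 1 - 6 *\<^sub>R Amap (B t))) (at t within {a..b})"
  using has_vector_derivative_Amap[OF \<delta> coercive_B deriv_B norm_drift assms]
  unfolding closure_op_drift[OF coercive_B[OF assms] \<delta>] .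

lemma det_preserved:
  assumes "det (B a) = 1" "t \<in> {a..b}" shows "det (B t) = 1"
proof -
  define u where "u t = inv_sqrt_det (B t)" for t
  have "u t - 1 = 0"
  proof (rule linear_decay_from_zero[where f = "\<lambda>t. u t - 1" and k = "\<lambda>t. 6 * Dr t", OF _ _ _ assms(2)])
    fix t assume t: "t \<in> {a..b}"
    note c = coercive_B[OF t]
    have t0: "t \<ge> 0" using a t by auto
    have "matrix_inv (B t) \<bullet> transport t (B t)
        = trace (W t) + trace (transpose (W t))"
      unfolding transport_def inner_add_right inner_matrix_mult_left[of _ "B t"] inner_matrix_mult_right[of _ _ "B t"]
      by (simp add: coerciveD(2)[OF c] matrix_inv_right[OF c \<delta>] matrix_inv_left[OF c \<delta>] trace_eq_inner)
    then have "trace (closure_op (B t) (transport t (B t))) = 0"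
      using trace_W[OF t0] by (simp add: trace_closure_op[OF c \<delta>] trace_transpose)
    then have "trace ((1 / 2) *\<^sub>R closure_op (B t) (transport t (B t)) + Dr t *\<^sub>R (2 *\<^sub>R mat 1 - 6 *\<^sub>R Amap (B t)))
        = - (6 * Dr t) * (u t - 1)"
      by (simp add: trace_add trace_sub trace_scaleR trace_I trace_Amap[OF c \<delta>] u_def algebra_simps)
    moreover have "((\<lambda>v. trace (Amap (B v)) - 1) has_vector_derivative
       trace ((1 / 2) *\<^sub>R closure_op (B t) (transport t (B t)) + Dr t *\<^sub>R (2 *\<^sub>R mat 1 - 6 *\<^sub>R Amap (B t))) - 0) (at t within {a..b})"
      by (intro has_vector_derivative_diff has_vector_derivative_const
          bounded_linear.has_vector_derivative[OF bounded_linear_trace deriv_Amap[OF t]])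
    ultimately have "((\<lambda>v. trace (Amap (B v)) - 1) has_vector_derivative - (6 * Dr t) * (u t - 1)) (at t within {a..b})"
      by simp
    then show "((\<lambda>v. u v - 1) has_vector_derivative - (6 * Dr t) * (u t - 1)) (at t within {a..b})"
      by (rule has_vector_derivative_transform[OF t, rotated])
         (simp add: u_def trace_Amap[OF coercive_B \<delta>])
    show "0 \<le> 6 * Dr t" using Dr_nonneg[OF t0] by simp
  qed (simp add: u_def inv_sqrt_det_def assms(1))
  then have "sqrt (det (B t)) = 1" by (auto simp: u_def inv_sqrt_det_def field_simps)
  then show ?thesis by simp
qed

text \<open>The rate is 3 times \<open>5/2 \<omega> + 6 \<rho>\<close>: half of 5/2 times
  \<open>norm (W + W^T) \<le> 2 \<omega>\<close> from transport, and \<open>6 \<rho>\<close> from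
  \<open>- 6 Dr A\<close>, while \<open>2 Dr I\<close> is nonnegative and discarded.\<close>

lemma det_Amap_lower_bound:
  assumes t: "t \<in> {a..b}"
  shows "exp (- (15 / 2 * \<omega> + 18 * \<rho>) * (t - a)) * det (Amap (B a)) \<le> det (Amap (B t))"
proof (rule exponential_lower_bound[where f = "\<lambda>t. det (Amap (B t))", OF _ _ t])
  fix t assume t: "t \<in> {a..b}"
  note c = coercive_B[OF t]
  have t0: "t \<ge> 0" using a t by auto
  define A where "A = Amap (B t)"
  define A' where "A' = (1 / 2) *\<^sub>R closure_op (B t) (transport t (B t)) + Dr t *\<^sub>R (2 *\<^sub>R mat 1 - 6 *\<^sub>R A)"
  obtain d where d: "d > 0" "coercive d A" unfolding A_def using coercive_Amap[OF c \<delta>] by blast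
  have pos: "det A > 0" using det_ge[OF d(2)] d(1) by (smt (verit) zero_less_power)
  show "((\<lambda>t. det (Amap (B t))) has_vector_derivative det (Amap (B t)) * trace (matrix_inv A ** A')) (at t within {a..b})"
    using has_vector_derivative_det[OF deriv_Amap[OF t], of "matrix_inv A"] matrix_inv_right[OF d(2,1)]
    by (simp add: A_def A'_def)
  have sA': "symmetric_mat A'"
    using symmetric_relaxation[OF c \<delta>] symmetric_transport[OF coerciveD(1)[OF c], of t]
    by (simp add: A'_def A_def symmetric_mat_def transpose_add transpose_scalar transpose_closure_op[OF c \<delta>])
  have "- 3 * (5 / 2 * \<omega> + 6 * \<rho>) \<le> trace (matrix_inv A ** A')"
  proof (rule trace_logarithmic_derivative_ge[OF d(2,1) sA' trace_W[OF t0]])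
    fix x
    have q: "0 \<le> x \<bullet> (A *v x)" using coerciveD(3)[OF coercive_mono[OF d(2), of 0], of x] d(1) by simp
    have n: "norm (W t + transpose (W t)) \<le> 2 * \<omega>"
      using norm_triangle_ineq[of "W t" "transpose (W t)"] norm_W[OF t0] by (simp add: norm_transpose)
    have "x \<bullet> ((W t ** A + A ** transpose (W t)) *v x) - 5 / 2 * (2 * \<omega>) * (x \<bullet> (A *v x))
        \<le> x \<bullet> ((W t ** A + A ** transpose (W t)) *v x) - 5 / 2 * norm (W t + transpose (W t)) * (x \<bullet> (A *v x))"
      using mult_right_mono[OF n q] by (simp add: algebra_simps)
    also have "\<dots> \<le> x \<bullet> (closure_op (B t) (transport t (B t)) *v x)"
      unfolding A_def transport_def by (rule closure_op_transport_ge[OF c \<delta> trace_W[OF t0]])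
    finally have 1: "1 / 2 * (x \<bullet> ((W t ** A + A ** transpose (W t)) *v x)) - 5 / 2 * \<omega> * (x \<bullet> (A *v x))
        \<le> 1 / 2 * (x \<bullet> (closure_op (B t) (transport t (B t)) *v x))" by simp
    have "- 6 * \<rho> * (x \<bullet> (A *v x)) \<le> - 6 * Dr t * (x \<bullet> (A *v x))"
      using Dr_le[OF t0] q by (intro mult_right_mono) auto
    also have "\<dots> \<le> Dr t * (2 * (x \<bullet> x)) - 6 * Dr t * (x \<bullet> (A *v x))"
      using Dr_nonneg[OF t0] by simp
    finally have 2: "- 6 * \<rho> * (x \<bullet> (A *v x)) \<le> Dr t * (2 * (x \<bullet> x)) - 6 * Dr t * (x \<bullet> (A *v x))" .
    have "x \<bullet> (A' *v x) = 1 / 2 * (x \<bullet> (closure_op (B t) (transport t (B t)) *v x))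
        + (Dr t * (2 * (x \<bullet> x)) - 6 * Dr t * (x \<bullet> (A *v x)))"
      by (simp add: A'_def matrix_vector_mult_diff_rdistrib matrix_vector_mult_add_rdistrib inner_add_right
          inner_diff_right scaleR_matrix_vector_assoc[symmetric] algebra_simps)
    then show "1 / 2 * (x \<bullet> ((W t ** A + A ** transpose (W t)) *v x)) - (5 / 2 * \<omega> + 6 * \<rho>) * (x \<bullet> (A *v x))
        \<le> x \<bullet> (A' *v x)"
      using 1 2 by (simp add: algebra_simps)
  qed
  then have "det A * (- 3 * (5 / 2 * \<omega> + 6 * \<rho>)) \<le> det A * trace (matrix_inv A ** A')"
    using pos by (intro mult_left_mono) auto
  then show "- (15 / 2 * \<omega> + 18 * \<rho>) * det (Amap (B t)) \<le> det (Amap (B t)) * trace (matrix_inv A ** A')"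
    by (simp add: A_def algebra_simps)
qed

end

text \<open>Peano's theorem asks for a bounded field on all matrices, while \<open>drift\<close> is
  controlled on the trapping set. Dugundji's theorem extends it within a convex set containing its
  values; taking bounded symmetric matrices preserves both the bound and the symmetry that
  \<open>symmetric_solution\<close> uses.\<close>

lemma drift_extension:
  assumes \<delta>: "\<delta> > 0" and a: "a \<ge> 0"
  obtains f M where "continuous_on ({a..b} \<times> UNIV) (\<lambda>p. f (fst p) (snd p))"
    "\<And>t B. t \<in> {a..b} \<Longrightarrow> norm (f t B) \<le> M" "\<And>t B. t \<in> {a..b} \<Longrightarrow> symmetric_mat (f t B)"
    "\<And>t B. t \<in> {a..b} \<Longrightarrow> B \<in> trapping_set \<delta> R \<Longrightarrow> f t B = drift t B"
proof -
  let ?S = "{a..b} \<times> trapping_set \<delta> R"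
  have cS: "compact ?S" using \<delta> by (intro compact_Times compact_trapping_set) auto
  have cd: "continuous_on ?S (\<lambda>p. drift (fst p) (snd p))"
    by (rule continuous_on_subset[OF continuous_on_drift[OF \<delta>]]) (use a in auto)
  obtain M where M: "\<And>p. p \<in> ?S \<Longrightarrow> norm (drift (fst p) (snd p)) \<le> M"
    using compact_imp_bounded[OF compact_continuous_image[OF cd cS]] unfolding bounded_iff by blast
  define C where "C = cball 0 (max M 0) \<inter> {B. symmetric_mat B}"
  have C: "convex C" unfolding C_def
    by (intro convex_Int convex_cball)
       (auto simp: convex_def symmetric_mat_def transpose_add transpose_scalar)
  have C0: "C \<noteq> {}"
  proof -
    have "0 \<in> C" by (simp add: C_def symmetric_mat_def transpose_def vec_eq_iff)
    then show ?thesis by blast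
  qed
  have cl: "closedin (top_of_set ({a..b} \<times> UNIV)) ?S"
    by (rule closed_subset[OF _ compact_imp_closed[OF cS]]) auto
  have im: "(\<lambda>p. drift (fst p) (snd p)) ` ?S \<subseteq> C"
  proof (rule image_subsetI)
    fix p assume p: "p \<in> ?S"
    have "symmetric_mat (drift (fst p) (snd p))"
      using p \<delta> by (intro symmetric_drift[of \<delta>]) (auto simp: trapping_set_def)
    then show "drift (fst p) (snd p) \<in> C"
      using M[OF p] by (simp add: C_def)
  qed
  obtain g where g: "continuous_on ({a..b} \<times> UNIV) g" "g ` ({a..b} \<times> UNIV) \<subseteq> C"
    "\<And>p. p \<in> ?S \<Longrightarrow> g p = drift (fst p) (snd p)"
    using Dugundji[OF C C0 cl cd im] by blast
  show ?thesis
  proof (rule that[of "\<lambda>t B. g (t, B)" "max M 0"])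
    show "continuous_on ({a..b} \<times> UNIV) (\<lambda>p. g (fst p, snd p))" using g(1) by simp
    show "norm (g (t, B)) \<le> max M 0" "symmetric_mat (g (t, B))" if "t \<in> {a..b}" for t B
    proof -
      have "g (t, B) \<in> C" using g(2) that by auto
      then show "norm (g (t, B)) \<le> max M 0" "symmetric_mat (g (t, B))" by (auto simp: C_def)
    qed
    show "g (t, B) = drift t B" if "t \<in> {a..b}" "B \<in> trapping_set \<delta> R" for t B
      using g(3)[of "(t, B)"] that by simp
  qed
qed

text \<open>The confining constants are fixed before the solution is constructed, from
  \<open>det (Amap B0)\<close> and the decay rate. They may deteriorate from one interval to the
  next, but the length 1 does not.\<close>

lemma unit_step:
  assumes B0: "spd B0" "det B0 = 1" and a: "a \<ge> 0"
  shows "\<exists>B. B a = B0 \<and> (\<forall>t\<in>{a..a + 1}. (spd (B t) \<and> det (B t) = 1) \<and>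
    (B has_vector_derivative drift t (B t)) (at t within {a..a + 1}))"
proof -
  obtain \<delta>0 where \<delta>0: "\<delta>0 > 0" "coercive \<delta>0 B0" using spd_imp_coercive[OF B0(1)] by blast
  obtain c where "c > 0" "coercive c (Amap B0)" using coercive_Amap[OF \<delta>0(2,1)] by blast
  then have detA0: "det (Amap B0) > 0" using det_ge[of c "Amap B0"] by (smt (verit) zero_less_power)
  define k where "k = 15 / 2 * \<omega> + 18 * \<rho>"
  have k: "k \<ge> 0"
    using order_trans[OF norm_ge_zero norm_W[of 0]] order_trans[OF Dr_nonneg[of 0] Dr_le[of 0]]
    by (simp add: k_def)
  \<comment> \<open>The a priori lower bound for \<open>det (Amap (B t))\<close> at the end of a
    unit of time.\<close>
  define \<epsilon> where "\<epsilon> = exp (- k) * det (Amap B0)"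
  have \<epsilon>: "\<epsilon> > 0" using detA0 by (simp add: \<epsilon>_def)
  define R where "R = 6 / \<epsilon>"
  define \<delta> where "\<delta> = 1 / R\<^sup>2"
  have \<delta>: "\<delta> > 0" using \<epsilon> by (simp add: \<delta>_def R_def)
  have confine: "coercive \<delta> B \<and> trace B \<le> R"
    if "coercive c B" "c > 0" "det B = 1" "\<epsilon> \<le> det (Amap B)" for c B
    using det_Amap_confines[OF that(1-3) \<epsilon> that(4)] by (simp add: \<delta>_def R_def)
  let ?K = "trapping_set (\<delta> / 2) (R + 1)" and ?b = "a + 1"
  obtain f M where f: "continuous_on ({a..?b} \<times> UNIV) (\<lambda>p. f (fst p) (snd p))"
    and fM: "\<And>t B. t \<in> {a..?b} \<Longrightarrow> norm (f t B) \<le> M"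
    and fs: "\<And>t B. t \<in> {a..?b} \<Longrightarrow> symmetric_mat (f t B)"
    and fK: "\<And>t B. t \<in> {a..?b} \<Longrightarrow> B \<in> ?K \<Longrightarrow> f t B = drift t B"
    using drift_extension[of "\<delta> / 2" a ?b "R + 1"] \<delta> a by auto
  obtain B where Ba: "B a = B0"
    and dB: "\<And>t. t \<in> {a..?b} \<Longrightarrow> (B has_vector_derivative f t (B t)) (at t within {a..?b})"
    using peano_existence[OF _ f fM, of B0] by auto
  have symB: "symmetric_mat (B t)" if "t \<in> {a..?b}" for t
    by (rule symmetric_solution[where f = f and B = B, OF fs _ dB that]) (use \<delta>0 coerciveD Ba in auto)
  \<comment> \<open>Bootstrap: while the path has stayed in \<open>?K\<close>, the extended field is
    \<open>drift\<close>, so the a priori bounds apply and return the stricter constants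
    \<open>\<delta>\<close> and \<open>R\<close> in place of \<open>\<delta> / 2\<close> and
    \<open>R + 1\<close>.\<close>
  have estimate: "det (B t) = 1 \<and> coercive \<delta> (B t) \<and> trace (B t) \<le> R"
    if t: "t \<in> {a..?b}" and K: "\<And>s. s \<in> {a..t} \<Longrightarrow> B s \<in> ?K" for t
  proof -
    have co: "coercive (\<delta> / 2) (B s)" if "s \<in> {a..t}" for s
      using K[OF that] by (simp add: trapping_set_def)
    have d: "(B has_vector_derivative drift s (B s)) (at s within {a..t})" if "s \<in> {a..t}" for s
    proof -
      have s: "s \<in> {a..?b}" using that t by auto
      show ?thesis
        using has_vector_derivative_within_subset[OF dB[OF s], of "{a..t}"] t fK[OF s K[OF that]] by auto
    qed
    have n: "norm (drift s (B s)) \<le> M" if "s \<in> {a..t}" for s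
    proof -
      have s: "s \<in> {a..?b}" using that t by auto
      show ?thesis using fM[OF s, of "B s"] fK[OF s K[OF that]] by simp
    qed
    have tt: "t \<in> {a..t}" using t by auto
    have \<delta>2: "\<delta> / 2 > 0" using \<delta> by simp
    have det: "det (B t) = 1"
      by (rule det_preserved[OF a \<delta>2 co d n _ tt]) (simp_all add: Ba B0)
    have "exp (- k * (t - a)) * det (Amap B0) \<le> det (Amap (B t))"
      using det_Amap_lower_bound[OF a \<delta>2 co d n tt] by (simp add: Ba k_def)
    moreover have "\<epsilon> \<le> exp (- k * (t - a)) * det (Amap B0)"
      unfolding \<epsilon>_def using k t detA0 mult_left_mono[of "t - a" 1 k] by (intro mult_right_mono) auto
    ultimately show ?thesis using confine[OF co[OF tt] \<delta>2 det] det by auto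
  qed
  have inK: "B t \<in> ?K" if "t \<in> {a..?b}" for t
  proof (rule first_exit[of a ?b B ?K, OF _ _ _ _ _ that])
    show "continuous_on {a..?b} B"
      using dB has_vector_derivative_continuous continuous_on_eq_continuous_within by blast
    show "closed ?K" using \<delta> by (intro compact_imp_closed compact_trapping_set) auto
    have "exp (- k) \<le> 1" using k by simp
    then have "\<epsilon> \<le> det (Amap B0)" unfolding \<epsilon>_def using detA0 by (simp add: mult_le_cancel_right2)
    then have "coercive \<delta> B0 \<and> trace B0 \<le> R" using confine[OF \<delta>0(2,1) B0(2)] by simp
    then show "B a \<in> ?K" using coercive_mono[of \<delta> B0 "\<delta> / 2"] \<delta> by (simp add: Ba trapping_set_def)
    show "\<exists>e>0. \<forall>s\<in>{a..?b}. dist (B s) (B t) < e \<longrightarrow> B s \<in> ?K"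
      if t: "t \<in> {a..?b}" "\<And>s. s \<in> {a..t} \<Longrightarrow> B s \<in> ?K" for t
    proof -
      from estimate[OF t] have "coercive \<delta> (B t)" "trace (B t) \<le> R" by auto
      from trapping_set_neighbourhood[OF this \<delta>] obtain e where
        "e > 0" "\<And>C. symmetric_mat C \<Longrightarrow> norm (C - B t) < e \<Longrightarrow> C \<in> ?K" by blast
      then show ?thesis using symB by (intro exI[of _ e]) (auto simp: dist_norm)
    qed
  qed simp
  show ?thesis
  proof (intro exI[of _ B] conjI ballI)
    fix t assume t: "t \<in> {a..?b}"
    have "det (B t) = 1 \<and> coercive \<delta> (B t) \<and> trace (B t) \<le> R"
      by (rule estimate[OF t]) (use inK t in auto)
    then show "spd (B t)" "det (B t) = 1" using coercive_imp_spd \<delta> by auto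
    show "(B has_vector_derivative drift t (B t)) (at t within {a..?b})"
      using dB[OF t] fK[OF t inK[OF t]] by simp
  qed (rule Ba)
qed

theorem global_solution:
  assumes "spd B0" "det B0 = 1"
  obtains B where "B 0 = B0"
    "\<And>t. t \<ge> 0 \<Longrightarrow> spd (B t)" "\<And>t. t \<ge> 0 \<Longrightarrow> det (B t) = 1"
    "\<And>t. t \<ge> 0 \<Longrightarrow> (B has_vector_derivative drift t (B t)) (at t within {0..})"
    "\<And>t. t \<ge> 0 \<Longrightarrow> ((\<lambda>u. Amap (B u)) has_vector_derivative
      (1 / 2) *\<^sub>R closure_op (B t) (transport t (B t)) + Dr t *\<^sub>R (2 *\<^sub>R mat 1 - 6 *\<^sub>R Amap (B t))) (at t within {0..})"
proof -
  have "\<exists>B. B (real n) = B1 \<and> (\<forall>t\<in>{real n..real (Suc n)}. (spd (B t) \<and> det (B t) = 1) \<and>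
    (B has_vector_derivative drift t (B t)) (at t within {real n..real (Suc n)}))"
    if "spd B1 \<and> det B1 = 1" for n B1
    using unit_step[of B1 "real n"] that by (simp add: add.commute)
  from glue_unit_interval_solutions[where P = "\<lambda>B. spd B \<and> det B = 1" and F = drift, OF this]
  obtain B where B: "B 0 = B0" "\<And>t. t \<ge> 0 \<Longrightarrow> spd (B t) \<and> det (B t) = 1"
    "\<And>t. t \<ge> 0 \<Longrightarrow> (B has_vector_derivative drift t (B t)) (at t within {0..})"
    using assms by blast
  have "((\<lambda>u. Amap (B u)) has_vector_derivative
      (1 / 2) *\<^sub>R closure_op (B t) (transport t (B t)) + Dr t *\<^sub>R (2 *\<^sub>R mat 1 - 6 *\<^sub>R Amap (B t))) (at t within {0..})"
    if t: "t \<ge> 0" for t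
  proof -
    \<comment> \<open>The interval reaches beyond \<open>t\<close>, hence is a neighbourhood of
      \<open>t\<close> in the half-line; its compactness, with \<open>det (B u) = 1\<close>,
      supplies the uniform \<open>\<delta>\<close> and \<open>N\<close> for the chain rule.\<close>
    let ?I = "{0..t + 1}"
    have d: "(B has_vector_derivative drift u (B u)) (at u within ?I)" if "u \<in> ?I" for u
      by (rule has_vector_derivative_within_subset[OF B(3)]) (use that in auto)
    have cont: "continuous_on ?I B"
      using d has_vector_derivative_continuous continuous_on_eq_continuous_within by blast
    have "compact ((\<lambda>u. trace (B u)) ` ?I)"
      by (intro compact_continuous_image continuous_intros cont) auto
    then have "bounded ((\<lambda>u. trace (B u)) ` ?I)" by (rule compact_imp_bounded)
    then obtain R where R: "\<And>u. u \<in> ?I \<Longrightarrow> norm (trace (B u)) \<le> R"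
      unfolding bounded_iff by blast
    have R1: "max R 1 > 0" by simp
    have tr: "trace (B u) \<le> max R 1" if "u \<in> ?I" for u using R[OF that] by auto
    have co: "coercive (1 / (max R 1)\<^sup>2) (B u)" if u: "u \<in> ?I" for u
    proof -
      obtain c where "c > 0" "coercive c (B u)" using B(2)[of u] spd_imp_coercive u by auto
      then have "coercive 0 (B u)" using coercive_mono[of c "B u" 0] by simp
      then show ?thesis using B(2)[of u] that by (intro coercive_of_det_trace[OF _ tr[OF that] R1]) auto
    qed
    let ?K = "trapping_set (1 / (max R 1)\<^sup>2) (max R 1)"
    have \<delta>: "1 / (max R 1)\<^sup>2 > 0" using R1 by simp
    have "continuous_on ?I (\<lambda>u. drift (fst (u, B u)) (snd (u, B u)))"
      by (rule continuous_on_compose2[OF continuous_on_drift[OF \<delta>, of "max R 1"]])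
         (use co tr in \<open>auto intro!: continuous_on_Pair cont simp: trapping_set_def\<close>)
    then have "compact ((\<lambda>u. drift u (B u)) ` ?I)" by (intro compact_continuous_image) auto
    then have "bounded ((\<lambda>u. drift u (B u)) ` ?I)" by (rule compact_imp_bounded)
    then obtain N where N: "\<And>u. u \<in> ?I \<Longrightarrow> norm (drift u (B u)) \<le> N"
      unfolding bounded_iff by blast
    have "t \<in> ?I" using t by simp
    from deriv_Amap[OF order_refl \<delta> co d N this]
    show ?thesis
      by (subst at_within_nhd[of t "{..<t + 1}" "{0..}" ?I]) auto
  qed
  then show ?thesis using that B by blast
qed

end

theorem theorem1:
  fixes lam :: real and Om Ga :: "real \<Rightarrow> mat3" and Dr :: "real \<Rightarrow> real" and B0 :: mat3
  assumes "continuous_on {0..} Om" "bounded (Om ` {0..})"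
      and "continuous_on {0..} Ga" "bounded (Ga ` {0..})"
      and "continuous_on {0..} Dr" "bounded (Dr ` {0..})"
      and "\<forall>t\<ge>0. antisymmetric_mat (Om t)"
      and "\<forall>t\<ge>0. symmetric_mat (Ga t) \<and> trace (Ga t) = 0"
      and "\<forall>t\<ge>0. Dr t \<ge> 0"
      and "spd B0" and "det B0 = 1"
  shows "\<exists>A B :: real \<Rightarrow> mat3.
     A 0 = Amap B0 \<and> B 0 = B0 \<and>
     (\<forall>t\<ge>0.
        (A has_vector_derivative
           ((1/2) *\<^sub>R contract (Ctens (B t))
              (B t ** (Om t + lam *\<^sub>R Ga t) + (- Om t + lam *\<^sub>R Ga t) ** B t)
            + Dr t *\<^sub>R (2 *\<^sub>R mat 1 - 6 *\<^sub>R A t))) (at t within {0..}) \<and>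
        (B has_vector_derivative
           (- (1/2) *\<^sub>R (B t ** (Om t + lam *\<^sub>R Ga t) + (- Om t + lam *\<^sub>R Ga t) ** B t)
            - Dr t *\<^sub>R contract (Dtens (B t)) (2 *\<^sub>R mat 1 - 6 *\<^sub>R A t))) (at t within {0..})) \<and>
     (\<forall>t\<ge>0. spd (B t) \<and> det (B t) = 1 \<and> A t = Amap (B t) \<and>
        pos_def (A t) \<and> trace (A t) = 1)"
proof -
  obtain \<omega>1 where \<omega>1: "\<And>t. t \<ge> 0 \<Longrightarrow> norm (Om t) \<le> \<omega>1"
    using assms(2) unfolding bounded_iff by auto
  obtain \<omega>2 where \<omega>2: "\<And>t. t \<ge> 0 \<Longrightarrow> norm (Ga t) \<le> \<omega>2"
    using assms(4) unfolding bounded_iff by auto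
  obtain \<rho> where \<rho>: "\<And>t. t \<ge> 0 \<Longrightarrow> norm (Dr t) \<le> \<rho>"
    using assms(6) unfolding bounded_iff by auto
  define W where "W t = Om t + lam *\<^sub>R Ga t" for t
  have tW: "transpose (W t) = - Om t + lam *\<^sub>R Ga t" if "t \<ge> 0" for t
    using assms(7,8) that
    by (simp add: W_def transpose_add transpose_scalar antisymmetric_mat_def symmetric_mat_def)
  interpret closure_flow W Dr "\<omega>1 + \<bar>lam\<bar> * \<omega>2" \<rho>
  proof
    show "continuous_on {0..} W"
      unfolding W_def by (intro continuous_intros assms)
    show "continuous_on {0..} Dr" by (rule assms)
    fix t :: real assume t: "t \<ge> 0"
    have "trace (Om t) = 0"
      using trace_transpose[of "Om t"] assms(7) t
      by (simp add: antisymmetric_mat_def trace_eq_inner)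
    then show "trace (W t) = 0" using assms(8) t by (simp add: W_def trace_add trace_scaleR)
    have "norm (W t) \<le> norm (Om t) + \<bar>lam\<bar> * norm (Ga t)"
      unfolding W_def using norm_triangle_ineq[of "Om t" "lam *\<^sub>R Ga t"] by simp
    also have "\<dots> \<le> \<omega>1 + \<bar>lam\<bar> * \<omega>2"
      by (intro add_mono mult_left_mono \<omega>1 \<omega>2 t) auto
    finally show "norm (W t) \<le> \<omega>1 + \<bar>lam\<bar> * \<omega>2" .
    show "0 \<le> Dr t" using assms(9) t by simp
    show "Dr t \<le> \<rho>" using \<rho>[OF t] by simp
  qed
  obtain B where B: "B 0 = B0" "\<And>t. t \<ge> 0 \<Longrightarrow> spd (B t)" "\<And>t. t \<ge> 0 \<Longrightarrow> det (B t) = 1"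
    and dB: "\<And>t. t \<ge> 0 \<Longrightarrow> (B has_vector_derivative drift t (B t)) (at t within {0..})"
    and dA: "\<And>t. t \<ge> 0 \<Longrightarrow> ((\<lambda>u. Amap (B u)) has_vector_derivative
      (1 / 2) *\<^sub>R closure_op (B t) (transport t (B t)) + Dr t *\<^sub>R (2 *\<^sub>R mat 1 - 6 *\<^sub>R Amap (B t))) (at t within {0..})"
    using global_solution[OF assms(10,11)] by blast
  have T: "transport t (B t) = B t ** (Om t + lam *\<^sub>R Ga t) + (- Om t + lam *\<^sub>R Ga t) ** B t" if "t \<ge> 0" for t
    unfolding transport_def tW[OF that] by (simp add: W_def)
  \<comment> \<open>\<open>Ctens\<close> is identified with \<open>closure_op\<close> on symmetric
    arguments, so symmetry of the transport term enters here.\<close>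
  have phys: "contract (Ctens (B t)) (transport t (B t)) = closure_op (B t) (transport t (B t))
      \<and> pos_def (Amap (B t)) \<and> trace (Amap (B t)) = 1" if t: "t \<ge> 0" for t
  proof -
    obtain c where c: "c > 0" "coercive c (B t)" using spd_imp_coercive[OF B(2)[OF t]] by blast
    obtain d where "d > 0" "coercive d (Amap (B t))" using coercive_Amap[OF c(2,1)] by blast
    then have "pos_def (Amap (B t))" using coercive_imp_spd by (auto simp: spd_def pos_def_def)
    then show ?thesis
      using contract_Ctens[OF c(2,1) symmetric_transport[OF coerciveD(1)[OF c(2)]]]
        trace_Amap[OF c(2,1)] B(3)[OF t] by (simp add: inv_sqrt_det_def)
  qed
  show ?thesis
  proof (rule exI[of _ "\<lambda>t. Amap (B t)"], rule exI[of _ B], intro conjI allI impI)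
    fix t :: real assume t: "t \<ge> 0"
    show "((\<lambda>t. Amap (B t)) has_vector_derivative
           ((1/2) *\<^sub>R contract (Ctens (B t))
              (B t ** (Om t + lam *\<^sub>R Ga t) + (- Om t + lam *\<^sub>R Ga t) ** B t)
            + Dr t *\<^sub>R (2 *\<^sub>R mat 1 - 6 *\<^sub>R Amap (B t)))) (at t within {0..})"
      using dA[OF t] phys[OF t] unfolding T[OF t] by simp
    show "(B has_vector_derivative
           (- (1/2) *\<^sub>R (B t ** (Om t + lam *\<^sub>R Ga t) + (- Om t + lam *\<^sub>R Ga t) ** B t)
            - Dr t *\<^sub>R contract (Dtens (B t)) (2 *\<^sub>R mat 1 - 6 *\<^sub>R Amap (B t)))) (at t within {0..})"
      using dB[OF t] unfolding drift_def T[OF t] .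
  qed (use B phys in auto)
qed

end
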